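(* Let $f, g \colon (\mathbb{R}^2,0) \to (\mathbb{R},0)$ be non-zero reduced real analytic function germs in the variables $(x,y)$ which are mini-regular in $x$ of order $m$. Put $V_f=f^{-1}(0)$ and $V_g=g^{-1}(0)$, and let $\mathscr{L}(V_f,V_g)$ be the separation Łojasiewicz exponent of $V_f$ and $V_g$ at the origin. Then $$\mathscr{L}(V_f, V_g) = \max\{\mathscr{L}_{+}(V_f, V_g),\ \mathscr{L}_{-}(V_f, V_g)\},$$ where $$\mathscr{L}_+(V_f,V_g) := \max\{\ell(\gamma) \mid \gamma\in\mathcal{V}_a(f\cdot g)\},\qquad \ell(\gamma) := \frac{\min\{\mathrm{ord}\,d(\gamma,V_f),\ \mathrm{ord}\,d(\gamma,V_g)\}}{\mathrm{ord}\,d(\gamma,V_{\gcd(f,g)})},$$ and $\mathscr{L}_{-}(V_f,V_g) := \mathscr{L}_{+}(V_{\overline f},V_{\overline g})$ with $\overline f(x,y):=f(x,-y)$ and $\overline g(x,y):=g(x,-y)$.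
   Context: Separation exponent: for sets $A,B\subset\mathbb{R}^n$ with $0\in A\cap B$, $\mathscr{L}(A,B)$ is the infimum of the exponents $\beta\ge 1$ for which there exist $C,r>0$ with $d(p,A)+d(p,B)\ge C\,d(p,A\cap B)^\beta$ for all $\|p\|\le r$; here $d(p,X)$ is the Euclidean distance from $p$ to $X$. Mini-regular: $f$ is mini-regular in $x$ of order $m$ if its expansion into homogeneous components is $f=f_m+f_{m+1}+\cdots$ (with $f_k$ homogeneous of degree $k$) and $f_m(1,0)\neq 0$. Puiseux series: series $\phi(y)=c_1y^{n_1/N}+c_2y^{n_2/N}+\cdots\in\mathbb{C}\{y^{1/N}\}$ with integers $N\le n_1<n_2<\cdots$; its order $\mathrm{ord}\,\phi$ is the smallest exponent with non-zero coefficient. It is real if all its coefficients are real. A Newton–Puiseux root of $f$ is a Puiseux series $\phi$ with $f(\phi(y),y)=0$. Order of distance: for a Puiseux series $\phi$, $\mathrm{ord}\,d(\phi,V_f):=\max_j \mathrm{ord}(\phi-\beta_j)$, where the $\beta_j$ run over the real Newton–Puiseux roots of $f$, if $f$ has at least one real Newton–Puiseux root, and $\mathrm{ord}\,d(\phi,V_f):=1$ if $f$ has none. The quantities $\mathrm{ord}\,d(\cdot,V_g)$ and $\mathrm{ord}\,d(\cdot,V_{\gcd(f,g)})$ are defined in the same way; $\gcd(f,g)$ is the greatest common divisor in $\mathbb{R}\{x,y\}$. Approximations: for a Puiseux series $\phi=\sum a_iy^{\alpha_i}$ and $\rho>0$, the $\rho$-approximation of $\phi$ is $\sum_{\alpha_i<\rho}a_iy^{\alpha_i}+cy^\rho$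 with $c$ a generic real number (outside a suitable finite set of exceptional values). For two distinct Puiseux series $\phi_1,\phi_2$, their approximation $\phi_{1,2}$ is the $\rho$-approximation of $\phi_1$ (equivalently of $\phi_2$) with $\rho=\mathrm{ord}(\phi_1-\phi_2)$. For a real analytic germ $F$ that is mini-regular in $x$, with Newton–Puiseux roots $\phi_1,\dots,\phi_s$, the set $\mathcal{V}_a(F)$ consists of all approximations $\phi_{i,j}$ of pairs of distinct roots $\phi_i,\phi_j$ such that $\phi_{i,j}$ is a real Puiseux series. *)

theory Defs
  imports "HOL-Analysis.Analysis" "HOL-Computational_Algebra.Squarefree"
begin

unbundle no vec_syntax and fps_syntax

section \<open>The ring of convergent real power series in two variables\<close>

text \<open>
  A formal power series in \<open>(x, y)\<close> is a power series in \<open>x\<close> with coefficients in the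
  power series in \<open>y\<close>: \<open>F $ i $ j\<close> is the coefficient of \<open>x^i y^j\<close>.
\<close>

definition convergent2 :: "real fps fps \<Rightarrow> bool" where
  "convergent2 F \<longleftrightarrow> (\<exists>r>0. (\<lambda>(i, j). F $ i $ j * r ^ i * r ^ j) summable_on UNIV)"

lemma convergent2I:
  assumes "\<And>i j. \<bar>F $ i $ j\<bar> \<le> C * R ^ (i + j)" "R > 0"
  shows "convergent2 F"
proof -
  define r where "r = 1 / (2 * R)"
  have geo: "((\<lambda>n::nat. (1/2::real) ^ n) has_sum 2) UNIV"
    using geometric_sums[of "1/2::real"] by (intro sums_nonneg_imp_has_sum) auto
  have half: "(\<lambda>(i, j). (1/2::real) ^ i * (1/2) ^ j) summable_on UNIV"
  proof -
    have "(\<lambda>(i, j). (1/2::real) ^ i * (1/2) ^ j) summable_on (SIGMA i:UNIV. UNIV)"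
    proof (rule summable_on_SigmaI)
      show "((\<lambda>j. (\<lambda>(i, j). (1/2::real) ^ i * (1/2) ^ j) (i, j)) has_sum (1/2) ^ i * 2) UNIV"
        for i :: nat
        using has_sum_cmult_right[OF geo, of "(1/2) ^ i"] by simp
      show "(\<lambda>i::nat. (1/2::real) ^ i * 2) summable_on UNIV"
        using geo by (intro summable_on_cmult_left) (rule has_sum_imp_summable)
    qed auto
    thus ?thesis by simp
  qed
  have "(\<lambda>p. norm ((\<lambda>(i, j). F $ i $ j * r ^ i * r ^ j) p)) summable_on UNIV"
  proof (rule summable_on_comparison_test)
    show "(\<lambda>p. C * (\<lambda>(i, j). (1/2::real) ^ i * (1/2) ^ j) p) summable_on UNIV"
      using half by (rule summable_on_cmult_right)
  next
    fix p :: "nat \<times> nat"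
    obtain i j where p: "p = (i, j)" by (cases p)
    have "\<bar>F $ i $ j\<bar> * (r ^ i * r ^ j) \<le> C * R ^ (i + j) * (r ^ i * r ^ j)"
      using assms by (intro mult_right_mono) (auto simp: r_def)
    also have "\<dots> = C * ((R * r) ^ i * (R * r) ^ j)"
      by (simp add: power_add power_mult_distrib algebra_simps)
    also have "R * r = 1/2" using assms(2) by (simp add: r_def)
    finally show "norm ((\<lambda>(i, j). F $ i $ j * r ^ i * r ^ j) p) \<le>
        C * (\<lambda>(i, j). (1/2::real) ^ i * (1/2) ^ j) p"
      using assms(2) by (simp add: p abs_mult r_def mult.assoc)
  qed auto
  hence "(\<lambda>(i, j). F $ i $ j * r ^ i * r ^ j) summable_on UNIV"
    by (rule abs_summable_summable)
  moreover have "r > 0" using assms(2) by (simp add: r_def)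
  ultimately show ?thesis unfolding convergent2_def by blast
qed

lemma convergent2E:
  assumes "convergent2 F"
  obtains C R where "C \<ge> 0" "R \<ge> 1" "\<And>i j. \<bar>F $ i $ j\<bar> \<le> C * R ^ (i + j)"
proof -
  obtain r where r: "r > 0" "(\<lambda>(i, j). F $ i $ j * r ^ i * r ^ j) summable_on UNIV"
    using assms unfolding convergent2_def by blast
  define a where "a = (\<lambda>(i, j). F $ i $ j * r ^ i * r ^ j)"
  have sum: "(\<lambda>p. norm (a p)) summable_on UNIV"
    using r(2) unfolding a_def by (rule summable_on_iff_abs_summable_on_real[THEN iffD1])
  define C where "C = infsum (\<lambda>p. norm (a p)) UNIV"
  have C: "norm (a p) \<le> C" for p
    using finite_sum_le_infsum[OF sum, of "{p}"] by (simp add: C_def)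
  have C0: "C \<ge> 0" using C[of "(0, 0)"] norm_ge_zero order_trans by blast
  define R where "R = max 1 (1 / r)"
  have "\<bar>F $ i $ j\<bar> \<le> C * R ^ (i + j)" for i j
  proof -
    have "\<bar>F $ i $ j\<bar> * r ^ (i + j) \<le> C"
      using C[of "(i, j)"] r(1) by (simp add: a_def abs_mult power_add mult.assoc)
    hence "\<bar>F $ i $ j\<bar> \<le> C * (1 / r) ^ (i + j)"
      using r(1) by (simp add: field_simps)
    also have "\<dots> \<le> C * R ^ (i + j)"
      using C0 r(1) by (intro mult_left_mono power_mono) (auto simp: R_def)
    finally show ?thesis .
  qed
  thus ?thesis using that[of C R] C0 by (simp add: R_def)
qed

lemma convergent2_0: "convergent2 0"
  by (rule convergent2I[of _ 0 1]) auto

lemma convergent2_1: "convergent2 1"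
proof (rule convergent2I[of _ 1 1])
  show "\<bar>(1 :: real fps fps) $ i $ j\<bar> \<le> 1 * 1 ^ (i + j)" for i j
    by (cases "i = 0"; cases "j = 0"; simp)
qed simp

lemma convergent2_abs_cong:
  assumes "convergent2 F" "\<And>i j. \<bar>G $ i $ j\<bar> = \<bar>F $ i $ j\<bar>"
  shows "convergent2 G"
proof -
  obtain C R where "R \<ge> 1" "\<And>i j. \<bar>F $ i $ j\<bar> \<le> C * R ^ (i + j)"
    using assms(1) by (rule convergent2E) blast
  thus ?thesis
    by (intro convergent2I[of G C R]) (simp_all add: assms(2))
qed

lemma convergent2_uminus: "convergent2 F \<Longrightarrow> convergent2 (- F)"
  by (erule convergent2_abs_cong) simp

lemma convergent2_add:
  assumes "convergent2 F" "convergent2 G"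
  shows "convergent2 (F + G)"
proof -
  obtain C R where F: "C \<ge> 0" "R \<ge> 1" "\<And>i j. \<bar>F $ i $ j\<bar> \<le> C * R ^ (i + j)"
    using assms(1) by (rule convergent2E) blast
  obtain D S where G: "D \<ge> 0" "S \<ge> 1" "\<And>i j. \<bar>G $ i $ j\<bar> \<le> D * S ^ (i + j)"
    using assms(2) by (rule convergent2E) blast
  show ?thesis
  proof (rule convergent2I)
    fix i j
    have "\<bar>(F + G) $ i $ j\<bar> \<le> C * R ^ (i + j) + D * S ^ (i + j)"
      using F(3)[of i j] G(3)[of i j] by simp
    also have "\<dots> \<le> C * (R * S) ^ (i + j) + D * (R * S) ^ (i + j)"
      using F G by (intro add_mono mult_left_mono power_mono) auto
    finally show "\<bar>(F + G) $ i $ j\<bar> \<le> (C + D) * (R * S) ^ (i + j)"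
      by (simp add: algebra_simps)
  qed (use F G in auto)
qed

lemma convergent2_diff:
  "convergent2 F \<Longrightarrow> convergent2 G \<Longrightarrow> convergent2 (F - G)"
  using convergent2_add[of F "- G"] convergent2_uminus[of G] by simp

lemma convergent2_mult:
  assumes "convergent2 F" "convergent2 G"
  shows "convergent2 (F * G)"
proof -
  obtain C R where F: "C \<ge> 0" "R \<ge> 1" "\<And>i j. \<bar>F $ i $ j\<bar> \<le> C * R ^ (i + j)"
    using assms(1) by (rule convergent2E) blast
  obtain D S where G: "D \<ge> 0" "S \<ge> 1" "\<And>i j. \<bar>G $ i $ j\<bar> \<le> D * S ^ (i + j)"
    using assms(2) by (rule convergent2E) blast
  define B where "B = C * D"
  define T where "T = R * S"
  have T: "R \<le> T" "S \<le> T" "1 \<le> T" and B: "B \<ge> 0"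
    using F G mult_mono[of 1 R 1 S] by (auto simp: T_def B_def)
  have le: "real n + 1 \<le> 2 ^ n" for n
    by (induction n) auto
  show ?thesis
  proof (rule convergent2I)
    fix i j
    have "\<bar>(F * G) $ i $ j\<bar> = \<bar>\<Sum>k=0..i. \<Sum>l=0..j. F $ k $ l * G $ (i - k) $ (j - l)\<bar>"
      by (simp add: fps_mult_nth fps_sum_nth)
    also have "\<dots> \<le> (\<Sum>k=0..i. \<Sum>l=0..j. B * T ^ (i + j))"
    proof (intro order_trans[OF sum_abs] sum_mono)
      fix k l assume kl: "k \<in> {0..i}" "l \<in> {0..j}"
      have "\<bar>F $ k $ l * G $ (i - k) $ (j - l)\<bar>
          \<le> (C * R ^ (k + l)) * (D * S ^ ((i - k) + (j - l)))"
        unfolding abs_mult using F G by (intro mult_mono) auto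
      also have "\<dots> \<le> (C * T ^ (k + l)) * (D * T ^ ((i - k) + (j - l)))"
        using F G T by (intro mult_mono mult_left_mono power_mono) auto
      also have "\<dots> = B * T ^ ((k + l) + ((i - k) + (j - l)))"
        by (simp add: B_def power_add)
      also have "(k + l) + ((i - k) + (j - l)) = i + j"
        using kl by auto
      finally show "\<bar>F $ k $ l * G $ (i - k) $ (j - l)\<bar> \<le> B * T ^ (i + j)" .
    qed
    also have "\<dots> = (real i + 1) * (real j + 1) * (B * T ^ (i + j))"
      by (simp add: algebra_simps)
    also have "\<dots> \<le> 2 ^ i * 2 ^ j * (B * T ^ (i + j))"
      using le B T by (intro mult_right_mono mult_mono) auto
    finally show "\<bar>(F * G) $ i $ j\<bar> \<le> B * (2 * T) ^ (i + j)"
      by (simp add: power_add power_mult_distrib algebra_simps)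
  qed (use T in auto)
qed

text \<open>The ring \<open>\<real>{x, y}\<close>, i.e. the ring of real analytic function germs at the origin of the plane.\<close>

typedef cps2 = "{F :: real fps fps. convergent2 F}"
  morphisms series2 Abs_cps2
  using convergent2_0 by blast

setup_lifting type_definition_cps2

instantiation cps2 :: idom
begin

lift_definition zero_cps2 :: cps2 is 0 by (rule convergent2_0)
lift_definition one_cps2 :: cps2 is 1 by (rule convergent2_1)
lift_definition plus_cps2 :: "cps2 \<Rightarrow> cps2 \<Rightarrow> cps2" is "(+)" by (rule convergent2_add)
lift_definition minus_cps2 :: "cps2 \<Rightarrow> cps2 \<Rightarrow> cps2" is "(-)" by (rule convergent2_diff)
lift_definition uminus_cps2 :: "cps2 \<Rightarrow> cps2" is "uminus" by (rule convergent2_uminus)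
lift_definition times_cps2 :: "cps2 \<Rightarrow> cps2 \<Rightarrow> cps2" is "(*)" by (rule convergent2_mult)

instance
  by standard (transfer; simp add: algebra_simps)+

end

definition coeff2 :: "cps2 \<Rightarrow> nat \<Rightarrow> nat \<Rightarrow> real" where
  "coeff2 F i j = series2 F $ i $ j"

lift_definition reflect_y :: "cps2 \<Rightarrow> cps2"
  is "\<lambda>F. Abs_fps (\<lambda>i. Abs_fps (\<lambda>j. F $ i $ j * (- 1) ^ j))"
  by (erule convergent2_abs_cong) (simp add: abs_mult power_abs)

text \<open>
  The value of the series at a point; used for real and for complex arguments.  It is meaningful
  near the origin only (\<^const>\<open>infsum\<close> is \<open>0\<close> where the series does not converge).
\<close>

definition eval2 :: "cps2 \<Rightarrow> 'a::{banach, real_normed_field} \<Rightarrow> 'a \<Rightarrow> 'a" where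
  "eval2 F x y = (\<Sum>\<^sub>\<infinity>(i, j)\<in>UNIV. of_real (coeff2 F i j) * x ^ i * y ^ j)"

text \<open>\<open>f\<close> represents a real analytic function germ at the origin, with power series expansion \<open>F\<close>.\<close>

definition has_germ :: "(real \<times> real \<Rightarrow> real) \<Rightarrow> cps2 \<Rightarrow> bool" where
  "has_germ f F \<longleftrightarrow> (\<forall>\<^sub>F (x, y) in nhds (0, 0). f (x, y) = eval2 F x y)"

definition hom_component :: "cps2 \<Rightarrow> nat \<Rightarrow> real \<Rightarrow> real \<Rightarrow> real" where
  "hom_component F k x y = (\<Sum>i\<le>k. coeff2 F i (k - i) * x ^ i * y ^ (k - i))"

definition mini_regular :: "cps2 \<Rightarrow> nat \<Rightarrow> bool" where
  "mini_regular F m \<longleftrightarrow>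
     (\<forall>k<m. \<forall>x y. hom_component F k x y = 0) \<and> hom_component F m 1 0 \<noteq> 0"

text \<open>
  A greatest common divisor in \<open>\<real>{x, y}\<close>.  It is determined up to a unit factor,
  and such a factor does not change the Newton--Puiseux roots, so the choice is immaterial below.
\<close>

definition gcd2 :: "cps2 \<Rightarrow> cps2 \<Rightarrow> cps2" where
  "gcd2 F G = (SOME H. H dvd F \<and> H dvd G \<and> (\<forall>D. D dvd F \<longrightarrow> D dvd G \<longrightarrow> D dvd H))"


section \<open>Puiseux series\<close>

text \<open>
  A Puiseux series in \<open>y\<close> is represented by its coefficient function: \<open>\<phi> q\<close> is the coefficient
  of \<open>y^q\<close>.  All exponents are multiples \<open>n / N\<close> of some \<open>1 / N\<close> with \<open>n \<ge> N\<close>, and the series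
  converges as a power series in \<open>y^(1/N)\<close>.  The zero series is included.
\<close>

definition puiseux :: "(rat \<Rightarrow> complex) \<Rightarrow> bool" where
  "puiseux \<phi> \<longleftrightarrow> (\<exists>N>0.
     {q. \<phi> q \<noteq> 0} \<subseteq> {of_nat n / of_nat N | n. N \<le> n} \<and>
     fps_conv_radius (Abs_fps (\<lambda>n. \<phi> (of_nat n / of_nat N))) > 0)"

definition puiseux_real :: "(rat \<Rightarrow> complex) \<Rightarrow> bool" where
  "puiseux_real \<phi> \<longleftrightarrow> (\<forall>q. \<phi> q \<in> \<real>)"

definition puiseux_ord :: "(rat \<Rightarrow> complex) \<Rightarrow> ereal" where
  "puiseux_ord \<phi> =
     (if \<forall>q. \<phi> q = 0 then \<infinity> else ereal (of_rat (LEAST q. \<phi> q \<noteq> 0)))"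

definition puiseux_eval :: "(rat \<Rightarrow> complex) \<Rightarrow> real \<Rightarrow> complex" where
  "puiseux_eval \<phi> y = (\<Sum>\<^sub>\<infinity>q\<in>UNIV. \<phi> q * of_real (y powr of_rat q))"

text \<open>
  \<open>f(\<phi>(y), y) = 0\<close>, read as an identity of functions on a small interval \<open>0 < y < \<epsilon>\<close>
  (with \<open>y^(1/N) > 0\<close>).  As both series converge there, this is the same as the vanishing
  of the substituted series.
\<close>

definition np_root :: "cps2 \<Rightarrow> (rat \<Rightarrow> complex) \<Rightarrow> bool" where
  "np_root F \<phi> \<longleftrightarrow> puiseux \<phi> \<and>
     (\<forall>\<^sub>F y in at_right 0. eval2 F (puiseux_eval \<phi> y) (of_real y) = 0)"

definition real_np_roots :: "cps2 \<Rightarrow> (rat \<Rightarrow> complex) set" where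
  "real_np_roots F = {\<beta>. np_root F \<beta> \<and> puiseux_real \<beta>}"

text \<open>
  Without real roots the zero set of \<open>F\<close> has no branch in \<open>y > 0\<close>, and the distance from
  \<open>(\<phi>(y), y)\<close> to it has order \<open>1\<close> in \<open>y\<close>.
\<close>

definition ord_dist :: "(rat \<Rightarrow> complex) \<Rightarrow> cps2 \<Rightarrow> ereal" where
  "ord_dist \<phi> F = (if real_np_roots F = {} then 1
     else Max ((\<lambda>\<beta>. puiseux_ord (\<lambda>q. \<phi> q - \<beta> q)) ` real_np_roots F))"

definition approximation :: "(rat \<Rightarrow> complex) \<Rightarrow> rat \<Rightarrow> real \<Rightarrow> (rat \<Rightarrow> complex)" where
  "approximation \<phi> \<rho> c =
     (\<lambda>q. if q < \<rho> then \<phi> q else if q = \<rho> then of_real c else 0)"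

text \<open>
  The set \<open>V_a(F)\<close>.  The coefficient \<open>c\<close> is generic if it lies outside the finite set of
  coefficients of \<open>y^\<rho>\<close> in the Newton--Puiseux roots of \<open>F\<close>; all approximations with such \<open>c\<close>
  are included (the order of contact of the approximation with any root of \<open>F\<close> does not depend
  on the choice of a generic \<open>c\<close>).
\<close>

definition exceptional_values :: "cps2 \<Rightarrow> rat \<Rightarrow> real set" where
  "exceptional_values F \<rho> = {c. \<exists>\<phi>. np_root F \<phi> \<and> \<phi> \<rho> = of_real c}"

definition root_approximations :: "cps2 \<Rightarrow> (rat \<Rightarrow> complex) set" where
  "root_approximations F =
     {approximation \<phi>\<^sub>1 \<rho> c | \<phi>\<^sub>1 \<phi>\<^sub>2 \<rho> c.
        np_root F \<phi>\<^sub>1 \<and> np_root F \<phi>\<^sub>2 \<and> \<phi>\<^sub>1 \<noteq> \<phi>\<^sub>2 \<and>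
        puiseux_ord (\<lambda>q. \<phi>\<^sub>1 q - \<phi>\<^sub>2 q) = ereal (of_rat \<rho>) \<and>
        c \<notin> exceptional_values F \<rho> \<and>
        puiseux_real (approximation \<phi>\<^sub>1 \<rho> c)}"


section \<open>Separation exponents\<close>

definition separation_exponent :: "'a::euclidean_space set \<Rightarrow> 'a set \<Rightarrow> ereal" where
  "separation_exponent A B = Inf {ereal \<beta> | \<beta>. \<beta> \<ge> 1 \<and>
     (\<exists>C>0. \<exists>r>0. \<forall>p. norm p \<le> r \<longrightarrow>
        infdist p A + infdist p B \<ge> C * infdist p (A \<inter> B) powr \<beta>)}"

definition contact_ratio :: "cps2 \<Rightarrow> cps2 \<Rightarrow> (rat \<Rightarrow> complex) \<Rightarrow> ereal" where
  "contact_ratio F G \<gamma> = min (ord_dist \<gamma> F) (ord_dist \<gamma> G) / ord_dist \<gamma> (gcd2 F G)"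

text \<open>
  If \<open>F G\<close> has only one Newton--Puiseux root (both zero sets are then the same smooth curve),
  there is no approximation; the maximum over the empty set is taken to be \<open>1\<close>, the smallest
  value a separation exponent can have.
\<close>

definition exponent_plus :: "cps2 \<Rightarrow> cps2 \<Rightarrow> ereal" where
  "exponent_plus F G = (if root_approximations (F * G) = {} then 1
     else Max (contact_ratio F G ` root_approximations (F * G)))"

definition exponent_minus :: "cps2 \<Rightarrow> cps2 \<Rightarrow> ereal" where
  "exponent_minus F G = exponent_plus (reflect_y F) (reflect_y G)"

end

theory Submission
  imports Defs
begin

text \<open>
  Near the origin the zero set of a mini-regular series consists, in \<open>y > 0\<close>, of the graphs of its
  real Newton--Puiseux roots, so the distance of \<open>(x, y)\<close> to it is comparable with the minimum of
  \<open>y\<close> and the \<open>\<bar>x - \<beta>(y)\<bar>\<close>.  Along an approximation \<open>\<gamma>\<close> all these distances are powers of \<open>y\<close>,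
  which bounds the separation exponent from below by \<open>\<ell>(\<gamma>)\<close>.  Conversely, if \<open>\<beta>\<close> and \<open>\<delta>\<close> are
  distinct roots of \<open>f\<close> and \<open>g\<close> closest to \<open>(x, y)\<close> and \<open>\<gamma>\<close> is their approximation, then
  \<open>\<bar>x - \<beta>\<bar> + \<bar>x - \<delta>\<bar>\<close> dominates \<open>y^\<rho>\<close> with \<open>\<rho> = ord(\<beta> - \<delta>)\<close>, and the distance to the common
  zeros is at most \<open>\<bar>x - \<beta>\<bar>\<close> plus a multiple of \<open>y\<close> to the power \<open>ord d(\<gamma>, V_gcd)\<close>.

  The algebra rests on convergent Weierstrass division: it gives the greatest common divisor by a
  Euclidean algorithm, and it drives a Newton polygon induction showing that the real zeros in
  \<open>y > 0\<close> lie on finitely many convergent Puiseux arcs.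
\<close>

section \<open>Weierstrass division\<close>

text \<open>More than an equality of infima is shown: a real exponent is admissible exactly when it
  is at least the maximum. The set V_a also holds approximations of pairs of non-real roots. Each is
  a real arc along which all three distances are powers of y, so it is one more test curve for the
  bound from below; the bound from above uses pairs of a real root of f and a real root of g, whose
  approximation lies in V_a. Only y > 0 is studied, as y < 0 is its mirror image; outside a cone |x|
  < 2K|y| the distance to V_f alone is comparable with the norm.

  The Newton polygon induction asks for arcs that contain the zeros, not for arcs made of zeros.
  This weaker demand survives unions, translations and ramifications t = tau^q; the arcs made of
  zeros are sorted out at the end. The obstacle for the greatest common divisor is that R{x,y} is
  not Euclidean: remainders acquire powers of y. They may be stripped because y is prime, does not
  divide a regular series and has no zero along an arc over y > 0.\<close>

lemma sum_geometric_tail_le: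
  fixes x :: real
  assumes "0 \<le> x" "x \<le> 1/2"
  shows "(\<Sum>b=c..n. x ^ b) \<le> 2 * x ^ c"
proof (cases "c \<le> n")
  case True
  have "(\<Sum>b=c..n. x ^ b) = x ^ c * (\<Sum>b\<le>n-c. x ^ b)"
    using True by (induction rule: dec_induct) (auto simp: Suc_diff_le algebra_simps simp flip:
        power_add)
  also have "\<dots> \<le> x ^ c * 2"
  proof -
    have "(\<Sum>b\<le>k. x ^ b) \<le> 2" for k
    proof -
      have "(\<Sum>b\<le>k. x ^ b) * (1 - x) = 1 - x ^ Suc k"
        by (metis mult.commute sum_gp_basic)
      also have "\<dots> \<le> 1" using assms by simp
      also have "1 \<le> 2 * (1 - x)" using assms by simp
      finally show ?thesis using assms
        by (intro mult_right_le_imp_le[of _ "1 - x" 2]) (auto simp: mult.commute)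
    qed
    thus ?thesis using assms by (intro mult_left_mono) auto
  qed
  finally show ?thesis by (simp add: mult.commute)
qed (use assms in auto)

text \<open>
  Coefficients of the quotient of \<open>g\<close> by \<open>x^m + e\<close>, determined by the part of degree at least \<open>m\<close> in
  \<open>x\<close>.  If \<open>e\<close> only contains \<open>x^a\<close> with \<open>a > m\<close> and multiples of \<open>y\<close>, then multiplying by \<open>e\<close> and
  dividing by \<open>x^m\<close> raises the weight \<open>i + (m + 1) j\<close> of \<open>x^i y^j\<close>, so only terms of smaller weight
  occur in the sum.
\<close>

function division_coeff :: "nat \<Rightarrow> (nat \<Rightarrow> nat \<Rightarrow> real) \<Rightarrow> (nat \<Rightarrow> nat \<Rightarrow> real) \<Rightarrow> nat \<Rightarrow> nat \<Rightarrow> real" where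
  "division_coeff m e g i j = g (i + m) j -
     (\<Sum>(k, l) \<in> {(k, l). k \<le> i + m \<and> l \<le> j \<and> k + (m + 1) * l < i + (m + 1) * j}.
        division_coeff m e g k l * e (i + m - k) (j - l))"
  by auto
termination
  by (relation "Wellfounded.measure (\<lambda>(m, e, g, i, j). i + (m + 1) * j)") auto

declare division_coeff.simps [simp del]

lemma finite_weight: "finite {(k, l). k + (m + 1) * l < (n::nat)}"
proof (rule finite_subset)
  show "{(k, l). k + (m + 1) * l < n} \<subseteq> {..n} \<times> {..n}"
    by auto
qed auto

text \<open>In the norm with weights r^i s^j, multiplying by e and dividing by x^m is a contraction
  with factor 1/2. The partial norms \<open>N n\<close> over all monomials of weight below n
  therefore satisfy N(n+1) \<le> B + N(n)/2, and induction keeps them below 2B. Truncation by weight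
  takes the place of a fixed point argument in a Banach space.\<close>

lemma division_coeff_bound:
  fixes e g :: "nat \<Rightarrow> nat \<Rightarrow> real"
  assumes rs: "r > 0" "s > 0"
    and E: "\<And>A. finite A \<Longrightarrow> (\<Sum>(a, b)\<in>A. \<bar>e a b\<bar> * r ^ a * s ^ b) \<le> r ^ m / 2"
    and B: "\<And>A. finite A \<Longrightarrow> (\<Sum>(i, j)\<in>A. \<bar>g (i + m) j\<bar> * r ^ i * s ^ j) \<le> B"
  shows "\<bar>division_coeff m e g i j\<bar> * r ^ i * s ^ j \<le> 2 * B"
proof -
  define q where "q = division_coeff m e g"
  define W where "W n = {(k, l). k + (m + 1) * l < n}" for n
  define D where "D i j = {(k, l). k \<le> i + m \<and> l \<le> j \<and> k + (m + 1) * l < i + (m + 1) * j}" for i j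
  define N where "N n = (\<Sum>(i, j)\<in>W n. \<bar>q i j\<bar> * r ^ i * s ^ j)" for n
  \<comment> \<open>The share of the term (k, l) in the bound for (i, j): the weight r^i s^j is
    split as r^k s^l for q times r^(i+m-k) s^(j-l) / r^m for e.\<close>
  define t where "t = (\<lambda>i j k l. \<bar>q k l\<bar> * r ^ k * s ^ l * (\<bar>e (i + m - k) (j - l)\<bar> * r ^ (i + m -
      k) * s ^ (j - l) / r ^ m))"
  have finW: "finite (W n)" for n unfolding W_def by (rule finite_weight)
  have B0: "B \<ge> 0" using B[of "{}"] by simp
  have "N n \<le> 2 * B" for n
  proof (induction n)
    case 0
    have "W 0 = {}" by (auto simp: W_def)
    thus ?case using B0 by (simp add: N_def)
  next
    case (Suc n)
    have le: "\<bar>q i j\<bar> * r ^ i * s ^ j \<le> \<bar>g (i + m) j\<bar> * r ^ i * s ^ j + (\<Sum>(k, l)\<in>D i j. t i j k l)"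
        for i j
    proof -
      have "q i j = g (i + m) j - (\<Sum>(k, l)\<in>D i j. q k l * e (i + m - k) (j - l))"
        unfolding q_def D_def by (subst division_coeff.simps) simp
      hence "\<bar>q i j\<bar> \<le> \<bar>g (i + m) j\<bar> + \<bar>\<Sum>(k, l)\<in>D i j. q k l * e (i + m - k) (j - l)\<bar>"
        by simp
      also have "\<dots> \<le> \<bar>g (i + m) j\<bar> + (\<Sum>(k, l)\<in>D i j. \<bar>q k l\<bar> * \<bar>e (i + m - k) (j - l)\<bar>)"
        by (intro add_left_mono order_trans[OF sum_abs]) (auto simp: abs_mult case_prod_unfold)
      finally have "\<bar>q i j\<bar> * (r ^ i * s ^ j) \<le> (\<bar>g (i + m) j\<bar> + (\<Sum>(k, l)\<in>D i j. \<bar>q k l\<bar> * \<bar>e (i + m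
          - k) (j - l)\<bar>)) * (r ^ i * s ^ j)"
        using rs by (intro mult_right_mono) auto
      also have "\<dots> = \<bar>g (i + m) j\<bar> * r ^ i * s ^ j + (\<Sum>(k, l)\<in>D i j. \<bar>q k l\<bar> * \<bar>e (i + m - k) (j -
          l)\<bar> * (r ^ i * s ^ j))"
        by (simp add: algebra_simps sum_distrib_left case_prod_unfold)
      also have "(\<Sum>(k, l)\<in>D i j. \<bar>q k l\<bar> * \<bar>e (i + m - k) (j - l)\<bar> * (r ^ i * s ^ j)) =
          (\<Sum>(k, l)\<in>D i j. t i j k l)"
      proof (intro sum.cong refl, clarify)
        fix k l assume "(k, l) \<in> D i j"
        hence kl: "k \<le> i + m" "l \<le> j" by (auto simp: D_def)
        have "r ^ i * r ^ m = r ^ k * r ^ (i + m - k)" "s ^ j = s ^ l * s ^ (j - l)"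
          using kl by (simp_all flip: power_add)
        hence "r ^ i = r ^ k * r ^ (i + m - k) / r ^ m" "s ^ j = s ^ l * s ^ (j - l)"
          using rs by (auto simp: field_simps)
        thus "\<bar>q k l\<bar> * \<bar>e (i + m - k) (j - l)\<bar> * (r ^ i * s ^ j) = t i j k l"
          by (simp add: t_def)
      qed
      finally show ?thesis by (simp add: mult.assoc)
    qed
    have "N (Suc n) \<le> (\<Sum>(i, j)\<in>W (Suc n). \<bar>g (i + m) j\<bar> * r ^ i * s ^ j + (\<Sum>(k, l)\<in>D i j. t i j k
        l))"
      unfolding N_def by (intro sum_mono) (use le in auto)
    also have "\<dots> = (\<Sum>(i, j)\<in>W (Suc n). \<bar>g (i + m) j\<bar> * r ^ i * s ^ j) + (\<Sum>(i, j)\<in>W (Suc n). \<Sum>(k,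
        l)\<in>D i j. t i j k l)"
      by (simp add: case_prod_unfold sum.distrib)
    also have "\<dots> \<le> B + (\<Sum>(i, j)\<in>W (Suc n). \<Sum>(k, l)\<in>D i j. t i j k l)"
      by (intro add_right_mono B finW)
    \<comment> \<open>The order of summation is exchanged. For fixed (k, l) the pairs (i, j)
      correspond injectively to indices of e, so the inner sum is at most (r^m / 2) / r^m =
      1/2.\<close>
    also have "(\<Sum>(i, j)\<in>W (Suc n). \<Sum>(k, l)\<in>D i j. t i j k l) =
       (\<Sum>p\<in>W (Suc n). \<Sum>z\<in>{z\<in>W n. z \<in> D (fst p) (snd p)}. t (fst p) (snd p) (fst z) (snd z))"
      by (intro sum.cong refl) (auto simp: case_prod_unfold W_def D_def intro!: sum.cong)
    also have "\<dots> = (\<Sum>z\<in>W n. \<Sum>p\<in>{p\<in>W (Suc n). z \<in> D (fst p) (snd p)}. t (fst p) (snd p) (fst z) (snd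
        z))"
      by (rule sum.swap_restrict) (rule finW)+
    also have "\<dots> \<le> (\<Sum>z\<in>W n. (case z of (k, l) \<Rightarrow> \<bar>q k l\<bar> * r ^ k * s ^ l) * (1/2))"
    proof (intro sum_mono)
      fix z assume "z \<in> W n"
      obtain k l where z: "z = (k, l)" by (cases z)
      let ?P = "{p\<in>W (Suc n). z \<in> D (fst p) (snd p)}"
      have "(\<Sum>p\<in>?P. t (fst p) (snd p) k l) = \<bar>q k l\<bar> * r ^ k * s ^ l *
         ((\<Sum>p\<in>?P. \<bar>e (fst p + m - k) (snd p - l)\<bar> * r ^ (fst p + m - k) * s ^ (snd p - l)) / r ^ m)"
        unfolding t_def by (simp add: sum_distrib_left sum_divide_distrib mult.assoc)
      also have "(\<Sum>p\<in>?P. \<bar>e (fst p + m - k) (snd p - l)\<bar> * r ^ (fst p + m - k) * s ^ (snd p - l)) =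
         (\<Sum>(a, b)\<in>(\<lambda>p. (fst p + m - k, snd p - l)) ` ?P. \<bar>e a b\<bar> * r ^ a * s ^ b)"
        by (subst sum.reindex) (auto simp: inj_on_def z D_def)
      also have "\<bar>q k l\<bar> * r ^ k * s ^ l * (\<dots> / r ^ m) \<le>
          \<bar>q k l\<bar> * r ^ k * s ^ l * ((r ^ m / 2) / r ^ m)"
        using rs finW by (intro mult_left_mono divide_right_mono E) auto
      finally show "(\<Sum>p\<in>?P. t (fst p) (snd p) (fst z) (snd z)) \<le>
          (case z of (k, l) \<Rightarrow> \<bar>q k l\<bar> * r ^ k * s ^ l) * (1/2)"
        using rs by (simp add: z)
    qed
    also have "\<dots> = N n / 2"
      unfolding N_def by (simp add: sum_divide_distrib)
    finally show ?case using Suc.IH by simp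
  qed
  note N = this
  have "\<bar>q i j\<bar> * r ^ i * s ^ j \<le> N (Suc (i + (m + 1) * j))"
  proof -
    have "(\<Sum>(i, j)\<in>{(i, j)}. \<bar>q i j\<bar> * r ^ i * s ^ j) \<le> N (Suc (i + (m + 1) * j))"
      unfolding N_def using finW rs by (intro sum_mono2) (auto simp: W_def)
    thus ?thesis by simp
  qed
  from order_trans[OF this N] show ?thesis unfolding q_def .
qed

lemma sum_geometric2_le:
  fixes x y :: real
  assumes "0 \<le> x" "x \<le> 1/2" "0 \<le> y" "y \<le> 1/2" and A: "finite A" "\<And>a b. (a, b) \<in> A \<Longrightarrow> c \<le> a \<and> d \<le> b"
  shows "(\<Sum>(a, b)\<in>A. x ^ a * y ^ b) \<le> 4 * x ^ c * y ^ d"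
proof -
  obtain n where n: "\<And>a b. (a, b) \<in> A \<Longrightarrow> a \<le> n \<and> b \<le> n"
  proof -
    have "finite (fst ` A \<union> snd ` A)" using A by auto
    then obtain n where "\<forall>a\<in>fst ` A \<union> snd ` A. a \<le> n" using finite_nat_set_iff_bounded_le by blast
    thus ?thesis by (intro that[of n]) force
  qed
  have "(\<Sum>(a, b)\<in>A. x ^ a * y ^ b) \<le> (\<Sum>(a, b)\<in>{c..n} \<times> {d..n}. x ^ a * y ^ b)"
    using assms n by (intro sum_mono2) auto
  also have "\<dots> = (\<Sum>a=c..n. x ^ a) * (\<Sum>b=d..n. y ^ b)"
    by (simp add: sum_product sum.cartesian_product)
  also have "\<dots> \<le> (2 * x ^ c) * (2 * y ^ d)"
    using assms by (intro mult_mono sum_geometric_tail_le) (auto intro!: sum_nonneg)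
  finally show ?thesis by simp
qed

text \<open>With f = x^m + e, the radii are picked so that e has weighted norm at most r^m / 2,
  which is what the contraction argument asks for. The terms of e are pure powers x^a with a > m,
  small compared with r^m for small r, and multiples of y, small for s chosen after r.\<close>

lemma division_core:
  fixes f g :: "nat \<Rightarrow> nat \<Rightarrow> real"
  assumes f: "\<And>i j. \<bar>f i j\<bar> \<le> C * R ^ (i + j)" and g: "\<And>i j. \<bar>g i j\<bar> \<le> C * R ^ (i + j)"
    and CR: "C \<ge> 0" "R \<ge> 1" and m: "\<And>i. i < m \<Longrightarrow> f i 0 = 0" "f m 0 = 1"
  obtains q D S where "S > 0" "\<And>i j. \<bar>q i j\<bar> \<le> D * S ^ (i + j)"
    "\<And>i j. g (i + m) j = (\<Sum>k\<le>i+m. \<Sum>l\<le>j. q k l * f (i + m - k) (j - l))"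
proof -
  define e where "e i j = (if i = m \<and> j = 0 then 0 else f i j)" for i j
  define q where "q = division_coeff m e g"
  \<comment> \<open>The bound 1/(2R) makes the geometric ratios at most 1/2, so a double geometric
    sum is at most 4 times its first term. The other bounds leave r^m / 4 for each of the two kinds
    of terms of e; C + 1 keeps the denominators positive.\<close>
  define r where "r = min (1 / (2 * R)) (1 / (16 * (C + 1) * R ^ (m + 1)))"
  define s where "s = min (1 / (2 * R)) (r ^ m / (16 * (C + 1) * R))"
  have r: "r > 0" "R * r \<le> 1/2" "R * r \<ge> 0"
    using CR by (auto simp: r_def min_def field_simps intro!: mult_pos_pos add_pos_nonneg simp del:
        power_Suc)
  have s: "s > 0" "R * s \<le> 1/2" "R * s \<ge> 0"
    using CR r by (auto simp: s_def min_def field_simps intro!: divide_pos_pos mult_pos_pos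
        add_pos_nonneg)
  have r2: "4 * C * (R * r) ^ (m + 1) \<le> r ^ m / 4"
  proof -
    have "r \<le> 1 / (16 * (C + 1) * R ^ (m + 1))" by (simp add: r_def)
    moreover have "16 * (C + 1) * R ^ (m + 1) > 0" using CR by (intro mult_pos_pos) auto
    ultimately have "16 * (C + 1) * R ^ (m + 1) * r \<le> 1"
      by (metis mult.commute pos_le_divide_eq)
    moreover have "16 * C * R ^ (m + 1) * r \<le> 16 * (C + 1) * R ^ (m + 1) * r"
      using CR r by (intro mult_right_mono) auto
    ultimately have "16 * C * R ^ (m + 1) * r \<le> 1" by linarith
    hence "16 * C * R ^ (m + 1) * r * r ^ m \<le> 1 * r ^ m" using r by (intro mult_right_mono) auto
    thus ?thesis by (simp add: power_mult_distrib field_simps)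
  qed
  have s2: "4 * C * (R * s) \<le> r ^ m / 4"
  proof -
    have "s \<le> r ^ m / (16 * (C + 1) * R)" by (simp add: s_def)
    moreover have "16 * (C + 1) * R > 0" using CR by (intro mult_pos_pos) auto
    ultimately have "16 * (C + 1) * R * s \<le> r ^ m"
      by (metis mult.commute pos_le_divide_eq)
    moreover have "16 * C * R * s \<le> 16 * (C + 1) * R * s"
      using CR s by (intro mult_right_mono) auto
    ultimately have "16 * C * R * s \<le> r ^ m" by linarith
    thus ?thesis by (simp add: field_simps)
  qed
  have E: "(\<Sum>(a, b)\<in>A. \<bar>e a b\<bar> * r ^ a * s ^ b) \<le> r ^ m / 2" if A: "finite A" for A
  proof -
    define A1 where "A1 = {(a, b)\<in>A. b = 0 \<and> m + 1 \<le> a}"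
    define A2 where "A2 = {(a, b)\<in>A. 1 \<le> b}"
    have fin: "finite A1" "finite A2" using A by (auto simp: A1_def A2_def case_prod_unfold)
    have le: "\<bar>e a b\<bar> * r ^ a * s ^ b \<le> C * ((R * r) ^ a * (R * s) ^ b)" for a b
    proof -
      have "\<bar>e a b\<bar> \<le> C * R ^ (a + b)" using f[of a b] CR by (auto simp: e_def)
      hence "\<bar>e a b\<bar> * (r ^ a * s ^ b) \<le> C * R ^ (a + b) * (r ^ a * s ^ b)"
        using r s by (intro mult_right_mono) auto
      thus ?thesis by (simp add: power_add power_mult_distrib algebra_simps)
    qed
    have "(\<Sum>(a, b)\<in>A. \<bar>e a b\<bar> * r ^ a * s ^ b) = (\<Sum>(a, b)\<in>A1 \<union> A2. \<bar>e a b\<bar> * r ^ a * s ^ b)"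
    proof (rule sum.mono_neutral_right[OF A])
      show "\<forall>p\<in>A - (A1 \<union> A2). (case p of (a, b) \<Rightarrow> \<bar>e a b\<bar> * r ^ a * s ^ b) = 0"
      proof
        fix p assume p: "p \<in> A - (A1 \<union> A2)"
        obtain a b where ab: "p = (a, b)" by (cases p)
        have "b = 0" "a \<le> m" using p unfolding ab by (auto simp: A1_def A2_def)
        hence "e a b = 0" using m by (auto simp: e_def)
        thus "(case p of (a, b) \<Rightarrow> \<bar>e a b\<bar> * r ^ a * s ^ b) = 0" by (simp add: ab)
      qed
    qed (auto simp: A1_def A2_def)
    also have "\<dots> = (\<Sum>(a, b)\<in>A1. \<bar>e a b\<bar> * r ^ a * s ^ b) + (\<Sum>(a, b)\<in>A2. \<bar>e a b\<bar> * r ^ a * s ^ b)"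
      using fin by (intro sum.union_disjoint) (auto simp: A1_def A2_def)
    also have "\<dots> \<le> (\<Sum>(a, b)\<in>A1. C * ((R * r) ^ a * (R * s) ^ b)) + (\<Sum>(a, b)\<in>A2. C * ((R * r) ^ a *
        (R * s) ^ b))"
      by (intro add_mono sum_mono) (use le in auto)
    also have "\<dots> = C * (\<Sum>(a, b)\<in>A1. (R * r) ^ a * (R * s) ^ b) + C * (\<Sum>(a, b)\<in>A2. (R * r) ^ a * (R *
        s) ^ b)"
      by (simp add: sum_distrib_left case_prod_unfold)
    also have "\<dots> \<le> C * (4 * (R * r) ^ (m + 1) * (R * s) ^ 0) + C * (4 * (R * r) ^ 0 * (R * s) ^ 1)"
      using r s CR fin by (intro add_mono mult_left_mono sum_geometric2_le) (auto simp: A1_def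
          A2_def)
    also have "\<dots> \<le> r ^ m / 4 + r ^ m / 4"
      using r2 s2 by (intro add_mono) (auto simp: mult_ac)
    finally show ?thesis by simp
  qed
  have B: "(\<Sum>(i, j)\<in>A. \<bar>g (i + m) j\<bar> * r ^ i * s ^ j) \<le> 4 * C * R ^ m" if A: "finite A" for A
  proof -
    have "(\<Sum>(i, j)\<in>A. \<bar>g (i + m) j\<bar> * r ^ i * s ^ j) \<le>
        (\<Sum>(i, j)\<in>A. C * R ^ m * ((R * r) ^ i * (R * s) ^ j))"
    proof (intro sum_mono, clarify)
      fix i j
      have "\<bar>g (i + m) j\<bar> * (r ^ i * s ^ j) \<le> C * R ^ (i + m + j) * (r ^ i * s ^ j)"
        using r s g[of "i + m" j] by (intro mult_right_mono) auto
      thus "\<bar>g (i + m) j\<bar> * r ^ i * s ^ j \<le> C * R ^ m * ((R * r) ^ i * (R * s) ^ j)"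
        by (simp add: power_add power_mult_distrib algebra_simps)
    qed
    also have "\<dots> = C * R ^ m * (\<Sum>(i, j)\<in>A. (R * r) ^ i * (R * s) ^ j)"
      by (simp add: sum_distrib_left case_prod_unfold)
    also have "\<dots> \<le> C * R ^ m * (4 * (R * r) ^ 0 * (R * s) ^ 0)"
      using r s CR A by (intro mult_left_mono sum_geometric2_le) auto
    finally show ?thesis by simp
  qed
  have q: "\<bar>q i j\<bar> * r ^ i * s ^ j \<le> 2 * (4 * C * R ^ m)" for i j
    unfolding q_def using r(1) s(1) E B by (rule division_coeff_bound)
  define S where "S = max (1 / r) (1 / s)"
  have S: "S > 0" using r s by (auto simp: S_def max_def)
  have "\<bar>q i j\<bar> \<le> 8 * C * R ^ m * S ^ (i + j)" for i j
  proof -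
    have "\<bar>q i j\<bar> \<le> 8 * C * R ^ m * ((1 / r) ^ i * (1 / s) ^ j)"
      using q[of i j] r s by (simp add: field_simps)
    also have "\<dots> \<le> 8 * C * R ^ m * (S ^ i * S ^ j)"
      using r s CR S by (intro mult_left_mono mult_mono power_mono) (auto simp: S_def)
    finally show ?thesis by (simp add: power_add)
  qed
  moreover have "g (i + m) j = (\<Sum>k\<le>i+m. \<Sum>l\<le>j. q k l * f (i + m - k) (j - l))" for i j
  proof -
    let ?D = "{(k, l). k \<le> i + m \<and> l \<le> j \<and> k + (m + 1) * l < i + (m + 1) * j}"
    let ?P = "{..i+m} \<times> {..j}"
    have "g (i + m) j = q i j + (\<Sum>(k, l)\<in>?D. q k l * e (i + m - k) (j - l))"
      unfolding q_def by (subst (1) division_coeff.simps) simp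
    also have "(\<Sum>(k, l)\<in>?D. q k l * e (i + m - k) (j - l)) =
        (\<Sum>(k, l)\<in>?P. q k l * e (i + m - k) (j - l))"
    \<comment> \<open>Outside the index set of the recursion only l = j and k \<ge> i remain. There
      e is evaluated at (i+m-k, 0) with i+m-k \<le> m, where it vanishes.\<close>
    proof (rule sum.mono_neutral_left)
      show "\<forall>p\<in>?P - ?D. (case p of (k, l) \<Rightarrow> q k l * e (i + m - k) (j - l)) = 0"
      proof
        fix p assume p: "p \<in> ?P - ?D"
        obtain k l where pkl: "p = (k, l)" by (cases p)
        have kl: "k \<le> i + m" "l \<le> j" and W: "\<not> (k + (m + 1) * l < i + (m + 1) * j)"
          using p unfolding pkl by auto
        have "l = j"
        proof (rule ccontr)
          assume "l \<noteq> j"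
          hence "(m + 1) * (l + 1) \<le> (m + 1) * j" using kl by (intro mult_left_mono) auto
          thus False using W kl by (simp add: algebra_simps)
        qed
        moreover from this have "k \<ge> i" using W by simp
        ultimately have "e (i + m - k) (j - l) = 0"
          using m kl by (cases "k = i") (auto simp: e_def)
        thus "(case p of (k, l) \<Rightarrow> q k l * e (i + m - k) (j - l)) = 0" by (simp add: pkl)
      qed
    qed auto
    \<comment> \<open>The isolated term q i j is the contribution of the monomial x^m, which e lacks
      and f has with coefficient 1.\<close>
    also have "q i j = (\<Sum>p\<in>?P. if p = (i, j) then q i j else 0)"
      by (subst sum.delta) auto
    also have "(\<Sum>p\<in>?P. if p = (i, j) then q i j else 0) + (\<Sum>(k, l)\<in>?P. q k l * e (i + m - k) (j -
        l)) =
       (\<Sum>(k, l)\<in>?P. q k l * f (i + m - k) (j - l))"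
      unfolding sum.distrib[symmetric] using m
          by (intro sum.cong refl) (auto simp: e_def split: if_splits)
    finally show ?thesis by (simp add: sum.cartesian_product)
  qed
  ultimately show ?thesis using S that by blast
qed

section \<open>Coefficients of convergent double series\<close>

lemma coeff2_inject: "(\<And>i j. coeff2 F i j = coeff2 G i j) \<Longrightarrow> F = G"
  unfolding coeff2_def by (metis fps_ext series2_inject)

lemma coeff2_simps [simp]:
  "coeff2 0 i j = 0"
  "coeff2 (F + G) i j = coeff2 F i j + coeff2 G i j"
  "coeff2 (F - G) i j = coeff2 F i j - coeff2 G i j"
  "coeff2 (- F) i j = - coeff2 F i j"
  by (simp_all add: coeff2_def zero_cps2.rep_eq plus_cps2.rep_eq minus_cps2.rep_eq
      uminus_cps2.rep_eq)

lemma coeff2_1 [simp]: "coeff2 1 i j = (if i = 0 \<and> j = 0 then 1 else 0)"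
  by (simp add: coeff2_def one_cps2.rep_eq)

lemma coeff2_mult:
  "coeff2 (F * G) i j = (\<Sum>k\<le>i. \<Sum>l\<le>j. coeff2 F k l * coeff2 G (i - k) (j - l))"
  by (simp add: coeff2_def times_cps2.rep_eq fps_mult_nth fps_sum_nth atLeast0AtMost)

lemma coeff2_bound:
  obtains C R where "C \<ge> 0" "R \<ge> 1" "\<And>i j. \<bar>coeff2 F i j\<bar> \<le> C * R ^ (i + j)"
  using convergent2E[of "series2 F"] series2[of F] unfolding coeff2_def by blast

lemma cps2_of_coeffs:
  assumes "\<And>i j. \<bar>a i j\<bar> \<le> C * R ^ (i + j)" "R > 0"
  obtains F where "\<And>i j. coeff2 F i j = a i j"
proof -
  have "convergent2 (Abs_fps (\<lambda>i. Abs_fps (a i)))"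
    using assms by (intro convergent2I[of _ C R]) auto
  thus ?thesis
    by (intro that[of "Abs_cps2 (Abs_fps (\<lambda>i. Abs_fps (a i)))"]) (simp add: coeff2_def
        Abs_cps2_inverse)
qed

lemma coeff2_bound2:
  obtains C R where "C \<ge> 0" "R \<ge> 1" "\<And>i j. \<bar>coeff2 F i j\<bar> \<le> C * R ^ (i + j)"
    "\<And>i j. \<bar>coeff2 G i j\<bar> \<le> C * R ^ (i + j)"
proof -
  obtain C R where F: "C \<ge> 0" "R \<ge> 1" "\<And>i j. \<bar>coeff2 F i j\<bar> \<le> C * R ^ (i + j)"
    by (rule coeff2_bound[of F]) blast
  obtain D S where G: "D \<ge> 0" "S \<ge> 1" "\<And>i j. \<bar>coeff2 G i j\<bar> \<le> D * S ^ (i + j)"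
    by (rule coeff2_bound[of G]) blast
  show ?thesis
  proof (rule that)
    show "max C D \<ge> 0" "max R S \<ge> 1" using F G by auto
    show "\<bar>coeff2 F i j\<bar> \<le> max C D * max R S ^ (i + j)" for i j
      using F(3)[of i j] by (rule order_trans) (use F G in \<open>intro mult_mono power_mono, auto\<close>)
    show "\<bar>coeff2 G i j\<bar> \<le> max C D * max R S ^ (i + j)" for i j
      using G(3)[of i j] by (rule order_trans) (use F G in \<open>intro mult_mono power_mono, auto\<close>)
  qed
qed

lemma monomial2_exists: "\<exists>X. \<forall>i j. coeff2 X i j = (if i = a \<and> j = b then 1 else 0)"
proof -
  define c :: "nat \<Rightarrow> nat \<Rightarrow> real" where "c = (\<lambda>i j. if i = a \<and> j = b then 1 else 0)"
  have "\<bar>c i j\<bar> \<le> 1 * 1 ^ (i + j)" for i j by (simp add: c_def)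
  then obtain X where "\<And>i j. coeff2 X i j = c i j"
    using zero_less_one by (rule cps2_of_coeffs) blast
  thus ?thesis unfolding c_def by blast
qed

text \<open>The restriction of F to the line y = 0 has order exactly m. This is the hypothesis of
  the Weierstrass theorems; unlike mini-regularity it survives the translations in x used below, and
  having it for some m amounts to not being divisible by y.\<close>

definition x_regular :: "cps2 \<Rightarrow> nat \<Rightarrow> bool" where
  "x_regular F m \<longleftrightarrow> (\<forall>i<m. coeff2 F i 0 = 0) \<and> coeff2 F m 0 \<noteq> 0"

theorem weierstrass_division:
  assumes "x_regular F m"
  obtains Q R where "G = Q * F + R" "\<And>i j. i \<ge> m \<Longrightarrow> coeff2 R i j = 0"
proof -
  define u where "u = coeff2 F m 0"
  have u: "u \<noteq> 0" using assms by (simp add: u_def x_regular_def)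
  obtain C R where CR: "C \<ge> 0" "R \<ge> 1" and F: "\<And>i j. \<bar>coeff2 F i j\<bar> \<le> C * R ^ (i + j)"
    and G: "\<And>i j. \<bar>coeff2 G i j\<bar> \<le> C * R ^ (i + j)"
    by (rule coeff2_bound2[where F = F and G = G]) blast
  define f where "f i j = coeff2 F i j / u" for i j
  define D where "D = max C (C / \<bar>u\<bar>)"
  have D: "D \<ge> 0" using CR by (auto simp: D_def)
  have f: "\<bar>f i j\<bar> \<le> D * R ^ (i + j)" for i j
  proof -
    have "\<bar>f i j\<bar> \<le> C * R ^ (i + j) / \<bar>u\<bar>"
      using F[of i j] by (simp add: f_def divide_right_mono)
    also have "\<dots> = C / \<bar>u\<bar> * R ^ (i + j)" by simp
    also have "\<dots> \<le> D * R ^ (i + j)" using CR by (intro mult_right_mono) (auto simp: D_def)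
    finally show ?thesis .
  qed
  have g: "\<bar>coeff2 G i j\<bar> \<le> D * R ^ (i + j)" for i j
    using G[of i j] by (rule order_trans) (use CR in \<open>auto intro!: mult_right_mono simp: D_def\<close>)
  obtain q B S where S: "S > 0" and q: "\<And>i j. \<bar>q i j\<bar> \<le> B * S ^ (i + j)"
    and eq: "\<And>i j. coeff2 G (i + m) j = (\<Sum>k\<le>i+m. \<Sum>l\<le>j. q k l * f (i + m - k) (j - l))"
  proof (rule division_core[of f D R "coeff2 G" m, OF f g D CR(2)])
    show "f i 0 = 0" if "i < m" for i using assms that by (simp add: x_regular_def f_def)
    show "f m 0 = 1" using u by (simp add: f_def u_def)
  qed blast
  have "\<bar>q i j / u\<bar> \<le> B / \<bar>u\<bar> * S ^ (i + j)" for i j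
    using q[of i j] by (simp add: divide_right_mono)
  then obtain Q where Q: "\<And>i j. coeff2 Q i j = q i j / u"
    using S by (rule cps2_of_coeffs) blast
  have "coeff2 (G - Q * F) i j = 0" if "i \<ge> m" for i j
    using eq[of "i - m" j] that by (simp add: coeff2_mult Q f_def)
  thus ?thesis by (intro that[of Q "G - Q * F"]) auto
qed

text \<open>Dividing 1 by F leaves a remainder of degree below 0 in x, that is zero, so the quotient
  is an inverse.\<close>

lemma x_regular_0_unit:
  assumes "x_regular F 0"
  obtains V where "V * F = 1"
proof -
  obtain Q R where QR: "1 = Q * F + R" "\<And>i j. i \<ge> 0 \<Longrightarrow> coeff2 R i j = 0"
    using weierstrass_division[OF assms] by blast
  have "R = 0" by (rule coeff2_inject) (use QR(2) in auto)
  thus ?thesis using QR(1) that[of Q] by simp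
qed

lemma coeff2_mult_y0:
  "coeff2 (F * G) i 0 = (\<Sum>k\<le>i. coeff2 F k 0 * coeff2 G (i - k) 0)"
  by (simp add: coeff2_mult)

lemma x_regular_mult:
  assumes "x_regular F m" "x_regular G n"
  shows "x_regular (F * G) (m + n)"
  unfolding x_regular_def
proof (intro conjI allI impI)
  fix i assume "i < m + n"
  thus "coeff2 (F * G) i 0 = 0"
    unfolding coeff2_mult_y0
  proof (intro sum.neutral ballI)
    fix k assume "k \<in> {..i}"
    hence "k < m \<or> i - k < n" using \<open>i < m + n\<close> by auto
    thus "coeff2 F k 0 * coeff2 G (i - k) 0 = 0"
      using assms by (auto simp: x_regular_def)
  qed
next
  have "coeff2 (F * G) (m + n) 0 = (\<Sum>k\<in>{m}. coeff2 F k 0 * coeff2 G (m + n - k) 0)"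
    unfolding coeff2_mult_y0
  proof (intro sum.mono_neutral_right ballI)
    fix k assume "k \<in> {..m+n} - {m}"
    hence "k < m \<or> m + n - k < n" by auto
    thus "coeff2 F k 0 * coeff2 G (m + n - k) 0 = 0"
      using assms by (auto simp: x_regular_def)
  qed auto
  thus "coeff2 (F * G) (m + n) 0 \<noteq> 0" using assms by (simp add: x_regular_def)
qed

text \<open>Division of x^m by F gives Q F = x^m - R. Comparing the coefficients of x^m on y = 0
  shows that Q has a nonzero constant term, so Q is a unit and x^m - R is the Weierstrass
  polynomial.\<close>

theorem weierstrass_preparation:
  assumes "x_regular F m"
  obtains U V P where "U * V = 1" "U * F = P" "\<And>i j. i > m \<Longrightarrow> coeff2 P i j = 0"
    "\<And>j. coeff2 P m j = (if j = 0 then 1 else 0)" "\<And>i. i < m \<Longrightarrow> coeff2 P i 0 = 0"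
proof -
  obtain X where X: "\<And>i j. coeff2 X i j = (if i = m \<and> j = 0 then 1 else 0)"
    using monomial2_exists[of m 0] by blast
  obtain Q R where QR: "X = Q * F + R" "\<And>i j. i \<ge> m \<Longrightarrow> coeff2 R i j = 0"
    using weierstrass_division[OF assms] by blast
  have Qm: "coeff2 (Q * F) m 0 = coeff2 Q 0 0 * coeff2 F m 0"
  proof -
    have "coeff2 (Q * F) m 0 = (\<Sum>k\<in>{0}. coeff2 Q k 0 * coeff2 F (m - k) 0)"
      unfolding coeff2_mult_y0
      using assms by (intro sum.mono_neutral_right) (auto simp: x_regular_def)
    thus ?thesis by simp
  qed
  have low: "coeff2 (Q * F) i 0 = 0" if "i < m" for i
    unfolding coeff2_mult_y0 using assms that by (auto simp: x_regular_def intro!: sum.neutral)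
  have P: "Q * F = X - R" using QR(1) by simp
  have "coeff2 Q 0 0 * coeff2 F m 0 = 1"
    using Qm X QR(2)[of m 0] by (simp add: P)
  hence "x_regular Q 0" by (auto simp: x_regular_def)
  then obtain V where V: "V * Q = 1" by (rule x_regular_0_unit)
  show ?thesis
  proof (rule that[of Q V "Q * F"])
    show "Q * V = 1" using V by (simp add: mult.commute)
    show "coeff2 (Q * F) i j = 0" if "i > m" for i j using that X QR(2)[of i j] by (simp add: P)
    show "coeff2 (Q * F) m j = (if j = 0 then 1 else 0)" for j using X QR(2)[of m j]
        by (simp add: P)
  qed (use low in auto)
qed

section \<open>Greatest common divisors\<close>

definition Y2 :: cps2 where
  "Y2 = (SOME Y. \<forall>i j. coeff2 Y i j = (if i = 0 \<and> j = 1 then 1 else 0))"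

lemma coeff2_Y2 [simp]: "coeff2 Y2 i j = (if i = 0 \<and> j = 1 then 1 else 0)"
  using someI_ex[OF monomial2_exists[of 0 1]] unfolding Y2_def by blast

lemma coeff2_Y2_mult: "coeff2 (Y2 * F) i j = (if j = 0 then 0 else coeff2 F i (j - 1))"
proof -
  have "coeff2 (Y2 * F) i j = (\<Sum>k\<le>i. \<Sum>l\<le>j. if k = 0 \<and> l = 1 then coeff2 F (i - k) (j - l) else 0)"
    unfolding coeff2_mult by (intro sum.cong refl) auto
  also have "\<dots> = (\<Sum>k\<le>i. if k = 0 then \<Sum>l\<le>j. if l = 1 then coeff2 F (i - k) (j - l) else 0 else 0)"
    by (intro sum.cong refl) auto
  also have "\<dots> = (if j = 0 then 0 else coeff2 F i (j - 1))"
    by (simp add: sum.delta)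
  finally show ?thesis .
qed

lemma Y2_dvd_iff: "Y2 dvd F \<longleftrightarrow> (\<forall>i. coeff2 F i 0 = 0)"
proof
  assume "Y2 dvd F" thus "\<forall>i. coeff2 F i 0 = 0" by (auto simp: dvd_def coeff2_Y2_mult)
next
  assume F: "\<forall>i. coeff2 F i 0 = 0"
  obtain C R where CR: "C \<ge> 0" "R \<ge> 1" "\<And>i j. \<bar>coeff2 F i j\<bar> \<le> C * R ^ (i + j)"
      by (rule coeff2_bound[of F]) blast
  have "\<bar>coeff2 F i (j + 1)\<bar> \<le> (C * R) * R ^ (i + j)" for i j
    using CR(3)[of i "j + 1"] by (simp add: mult_ac)
  then obtain G where "\<And>i j. coeff2 G i j = coeff2 F i (j + 1)"
    using CR(2) by (elim cps2_of_coeffs) auto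
  hence "F = Y2 * G" using F by (intro coeff2_inject) (auto simp: coeff2_Y2_mult)
  thus "Y2 dvd F" by simp
qed

lemma not_Y2_dvd_iff: "\<not> Y2 dvd F \<longleftrightarrow> (\<exists>m. x_regular F m)"
proof
  assume "\<not> Y2 dvd F"
  hence ex: "\<exists>i. coeff2 F i 0 \<noteq> 0" by (auto simp: Y2_dvd_iff)
  have "x_regular F (LEAST i. coeff2 F i 0 \<noteq> 0)"
    using LeastI_ex[OF ex] not_less_Least by (auto simp: x_regular_def)
  thus "\<exists>m. x_regular F m" ..
qed (auto simp: Y2_dvd_iff x_regular_def)

text \<open>A series not divisible by y has a restriction to y = 0 of finite order, and these orders
  add under multiplication.\<close>

lemma prime_Y2:
  assumes "Y2 dvd F * G"
  shows "Y2 dvd F \<or> Y2 dvd G"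
proof (rule ccontr)
  assume "\<not> ?thesis"
  hence "\<not> Y2 dvd F" "\<not> Y2 dvd G" by simp_all
  then obtain m n where "x_regular F m" "x_regular G n" unfolding not_Y2_dvd_iff by auto
  from x_regular_mult[OF this] have "\<not> Y2 dvd F * G" unfolding not_Y2_dvd_iff ..
  thus False using assms by simp
qed

lemma Y2_nonzero: "Y2 \<noteq> 0"
proof
  assume "Y2 = 0"
  hence "coeff2 Y2 0 1 = 0" by simp
  thus False by simp
qed

lemma Y2_power_dvd: "\<not> Y2 dvd D \<Longrightarrow> Y2 ^ k dvd D * E \<Longrightarrow> Y2 ^ k dvd E"
proof (induction k arbitrary: E)
  case (Suc k)
  have "Y2 dvd D * E" using Suc.prems by (meson dvd_trans dvd_power zero_less_Suc)
  with Suc.prems prime_Y2 obtain E' where E: "E = Y2 * E'" by blast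
  have "Y2 * Y2 ^ k dvd Y2 * (D * E')" using Suc.prems by (simp add: E mult_ac)
  hence "Y2 ^ k dvd D * E'" using Y2_nonzero by (simp add: dvd_times_left_cancel_iff)
  hence "Y2 ^ k dvd E'" using Suc by blast
  thus ?case by (simp add: E)
qed auto

lemma Y2_power_factor:
  assumes "F \<noteq> 0"
  obtains k G where "F = Y2 ^ k * G" "\<not> Y2 dvd G"
proof -
  obtain i j where ij: "coeff2 F i j \<noteq> 0" using assms coeff2_inject[of F 0] by auto
  have "\<exists>k G. F = Y2 ^ k * G \<and> \<not> Y2 dvd G"
    if "coeff2 F i j \<noteq> 0" for F
    using that
  proof (induction j arbitrary: F)
    case 0
    thus ?case by (intro exI[of _ 0] exI[of _ F]) (auto simp: Y2_dvd_iff)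
  next
    case (Suc j)
    show ?case
    proof (cases "Y2 dvd F")
      case True
      then obtain G where G: "F = Y2 * G" by auto
      with Suc have "coeff2 G i j \<noteq> 0" by (simp add: coeff2_Y2_mult)
      with Suc.IH obtain k H where "G = Y2 ^ k * H" "\<not> Y2 dvd H" by blast
      thus ?thesis using G by (intro exI[of _ "Suc k"] exI[of _ H]) auto
    qed (auto intro!: exI[of _ 0] exI[of _ F])
  qed
  thus ?thesis using ij that by blast
qed

text \<open>Cancelling y mirrors the step of the Euclidean algorithm that replaces a remainder y^k S
  by S. With this closure property the computed divisor stays in any ideal that contains the two
  given series, although it need not be a linear combination of them.\<close>

definition y_saturated_ideal :: "cps2 set \<Rightarrow> bool" where
  "y_saturated_ideal I \<longleftrightarrow> (\<forall>A\<in>I. \<forall>B\<in>I. A - B \<in> I) \<and> (\<forall>A\<in>I. \<forall>B. B * A \<in> I) \<and>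
     (\<forall>A. Y2 * A \<in> I \<longrightarrow> A \<in> I)"

text \<open>
  The Euclidean algorithm: the power of \<open>y\<close> in a remainder of Weierstrass division is irrelevant,
  as \<open>y\<close> is prime and does not divide \<open>G\<close>.  The last condition is applied to the ideal of
  all series that vanish along a Puiseux arc.
\<close>

lemma gcd2_exists:
  assumes "x_regular G n"
  shows "\<exists>H. H dvd F \<and> H dvd G \<and> (\<forall>D. D dvd F \<longrightarrow> D dvd G \<longrightarrow> D dvd H) \<and>
    (\<forall>I. y_saturated_ideal I \<longrightarrow> F \<in> I \<longrightarrow> G \<in> I \<longrightarrow> H \<in> I)"
  using assms
proof (induction n arbitrary: F G rule: less_induct)
  case (less n)
  obtain Q R where QR: "F = Q * G + R" "\<And>i j. i \<ge> n \<Longrightarrow> coeff2 R i j = 0"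
    using less.prems by (rule weierstrass_division) blast
  have R: "R = F - Q * G" using QR(1) by (simp add: algebra_simps)
  show ?case
  proof (cases "R = 0")
    case True
    have "G dvd F" using QR(1) True by simp
    thus ?thesis by (intro exI[of _ G] conjI allI impI) simp_all
  next
    case False
    then obtain k S where S: "R = Y2 ^ k * S" "\<not> Y2 dvd S" by (rule Y2_power_factor) blast
    obtain d where d: "x_regular S d" using S(2) unfolding not_Y2_dvd_iff ..
    have shift: "coeff2 (Y2 ^ k * S) i k = coeff2 S i 0" for i
      by (induction k) (simp_all add: mult.assoc coeff2_Y2_mult)
    \<comment> \<open>The coefficient of x^d y^k in R is that of x^d in S on y = 0. As R has degree
      below n in x, the order d of S is smaller than n, and the induction on the order
      proceeds.\<close>
    have "coeff2 R d k \<noteq> 0" using d shift[of d] by (simp add: S(1) x_regular_def)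
    hence "d < n" using QR(2)[of d k] by (cases "d < n") auto
    from less.IH[OF this d, of G] obtain H where H: "H dvd G" "H dvd S"
      "\<And>D. D dvd G \<Longrightarrow> D dvd S \<Longrightarrow> D dvd H" and
      I: "\<And>I. y_saturated_ideal I \<Longrightarrow> G \<in> I \<Longrightarrow> S \<in> I \<Longrightarrow> H \<in> I"
      by (elim exE conjE) blast
    have "H dvd Q * G + Y2 ^ k * S" using H(1,2) by (intro dvd_add dvd_mult)
    hence HF: "H dvd F" unfolding QR(1) S(1) .
    have DH: "D dvd H" if D: "D dvd F" "D dvd G" for D
    proof -
      have "D dvd R" unfolding R using D by (intro dvd_diff dvd_mult)
      then obtain E where E: "Y2 ^ k * S = D * E" unfolding S(1) by (rule dvdE)
      \<comment> \<open>A common divisor D of F and G cannot be divisible by y, since G is not.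
        Hence y^k must divide the cofactor E, and cancelling it shows that D divides S.\<close>
      have nG: "\<not> Y2 dvd G" unfolding not_Y2_dvd_iff using less.prems ..
      have "\<not> Y2 dvd D"
      proof
        assume "Y2 dvd D"
        hence "Y2 dvd G" using D(2) by (rule dvd_trans)
        with nG show False ..
      qed
      moreover have "Y2 ^ k dvd D * E" unfolding E[symmetric] by (rule dvd_triv_left)
      ultimately have "Y2 ^ k dvd E" by (rule Y2_power_dvd)
      then obtain E' where E': "E = Y2 ^ k * E'" by (rule dvdE)
      have "Y2 ^ k * S = Y2 ^ k * (D * E')" unfolding E E' by (rule mult.left_commute)
      moreover have "Y2 ^ k \<noteq> 0" using Y2_nonzero by (rule power_not_zero)
      ultimately have "S = D * E'" by (metis mult_left_cancel)
      hence "D dvd S" by (rule dvdI)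
      with D(2) show "D dvd H" by (rule H(3))
    qed
    have HI: "H \<in> I" if I': "y_saturated_ideal I" "F \<in> I" "G \<in> I" for I
    proof (rule I[OF I'(1,3)])
      have diff: "A - B \<in> I" if "A \<in> I" "B \<in> I" for A B
        using I'(1) that unfolding y_saturated_ideal_def by blast
      have mult: "B * A \<in> I" if "A \<in> I" for A B
        using I'(1) that unfolding y_saturated_ideal_def by blast
      have cancel: "A \<in> I" if "Y2 * A \<in> I" for A
        using I'(1) that unfolding y_saturated_ideal_def by blast
      have "R \<in> I" unfolding R using I'(2,3) by (intro diff mult)
      hence "Y2 ^ k * S \<in> I" unfolding S(1) .
      thus "S \<in> I"
      proof (induction k)
        case (Suc k)
        have "Y2 * (Y2 ^ k * S) \<in> I" using Suc.prems by (simp add: mult.assoc)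
        thus ?case by (rule Suc.IH[OF cancel])
      qed simp
    qed
    show ?thesis
    proof (intro exI[of _ H] conjI allI impI)
      show "D dvd H" if "D dvd F" "D dvd G" for D using that by (rule DH)
      show "H \<in> I" if "y_saturated_ideal I" "F \<in> I" "G \<in> I" for I using that by (rule HI)
    qed (fact HF, fact H(1))
  qed
qed

section \<open>Values of power series near the origin\<close>

lemma infsum_product:
  fixes a :: "'i \<Rightarrow> 'a::{banach, real_normed_field}" and b :: "'j \<Rightarrow> 'a"
  assumes a: "a abs_summable_on A" and b: "b abs_summable_on B"
  shows "(\<lambda>(p, q). a p * b q) abs_summable_on A \<times> B"
    and "infsum (\<lambda>(p, q). a p * b q) (A \<times> B) = infsum a A * infsum b B"
proof -
  have "(\<lambda>(p, q). norm (a p) * norm (b q)) summable_on A \<times> B"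
  proof (rule summable_on_SigmaI)
    show "((\<lambda>q. case (p, q) of (p, q) \<Rightarrow> norm (a p) * norm (b q)) has_sum
        norm (a p) * infsum (\<lambda>q. norm (b q)) B) B" for p
      using has_sum_cmult_right[OF has_sum_infsum[OF b], of "norm (a p)"] by simp
    show "(\<lambda>p. norm (a p) * infsum (\<lambda>q. norm (b q)) B) summable_on A"
      using a by (rule summable_on_cmult_left)
  qed auto
  thus abs: "(\<lambda>(p, q). a p * b q) abs_summable_on A \<times> B"
    by (simp add: case_prod_unfold norm_mult)
  have "infsum (\<lambda>(p, q). a p * b q) (A \<times> B) = infsum (\<lambda>p. infsum (\<lambda>q. a p * b q) B) A"
    using infsum_Sigma_banach[OF abs_summable_summable[OF abs]] by simp
  also have "\<dots> = infsum a A * infsum b B"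
    by (simp add: infsum_cmult_right' infsum_cmult_left')
  finally show "infsum (\<lambda>(p, q). a p * b q) (A \<times> B) = infsum a A * infsum b B" .
qed

definition term2 :: "cps2 \<Rightarrow> 'a::{banach, real_normed_field} \<Rightarrow> 'a \<Rightarrow> nat \<times> nat \<Rightarrow> 'a" where
  "term2 F x y = (\<lambda>(i, j). of_real (coeff2 F i j) * x ^ i * y ^ j)"

definition conv2 :: "cps2 \<Rightarrow> 'a::{banach, real_normed_field} \<Rightarrow> 'a \<Rightarrow> bool" where
  "conv2 F x y \<longleftrightarrow> term2 F x y abs_summable_on UNIV"

lemma eval2_eq: "eval2 F x y = infsum (term2 F x y) UNIV"
  by (simp add: eval2_def term2_def)

lemma conv2D: "conv2 F x y \<Longrightarrow> term2 F x y summable_on UNIV"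
  unfolding conv2_def by (rule abs_summable_summable)

lemma eventually_nhds_00_iff:
  "(\<forall>\<^sub>F (x, y) in nhds (0::'a::real_normed_vector, 0::'b::real_normed_vector). P x y) \<longleftrightarrow>
     (\<exists>r>0. \<forall>x y. norm x < r \<longrightarrow> norm y < r \<longrightarrow> P x y)" (is "?L \<longleftrightarrow> ?R")
proof
  assume ?L
  then obtain d where d: "d > 0" "\<And>p. dist p (0::'a, 0::'b) < d \<Longrightarrow> (case p of (x, y) \<Rightarrow> P x y)"
    by (auto simp: eventually_nhds_metric)
  show ?R
  proof (intro exI[of _ "d/2"] conjI allI impI)
    fix x :: 'a and y :: 'b assume "norm x < d/2" "norm y < d/2"
    hence "dist (x, y) (0, 0) < d"
      using sqrt_sum_squares_le_sum_abs[of "norm x" "norm y"] by (simp add: dist_Pair_Pair)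
    thus "P x y" using d(2)[of "(x, y)"] by simp
  qed (use d in auto)
next
  assume ?R
  then obtain r where r: "r > 0" "\<And>x y. norm x < r \<Longrightarrow> norm y < r \<Longrightarrow> P x y" by auto
  show ?L unfolding eventually_nhds_metric
  proof (intro exI[of _ r] conjI allI impI r(1))
    fix p :: "'a \<times> 'b" assume *: "dist p (0, 0) < r"
    obtain x y where p: "p = (x, y)" by (cases p)
    have "norm x \<le> dist p (0, 0)" "norm y \<le> dist p (0, 0)"
      by (simp_all add: p dist_Pair_Pair real_le_rsqrt)
    thus "case p of (x, y) \<Rightarrow> P x y" using * r by (simp add: p)
  qed
qed

lemma eventually_conv2:
  "\<forall>\<^sub>F (x, y) in nhds (0::'a::{banach, real_normed_field}, 0). conv2 F x y"
proof -
  obtain C R where CR: "C \<ge> 0" "R \<ge> 1" "\<And>i j. \<bar>coeff2 F i j\<bar> \<le> C * R ^ (i + j)"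
    by (rule coeff2_bound[of F]) blast
  \<comment> \<open>The series with all coefficients 1 supplies a radius at which the double
    geometric series converges; scaled by 1/R it majorises F.\<close>
  have "convergent2 (Abs_fps (\<lambda>i. Abs_fps (\<lambda>j. 1)))"
    by (rule convergent2I[of _ 1 1]) auto
  then obtain r where r: "r > 0" "(\<lambda>(i, j). r ^ i * r ^ j :: real) summable_on UNIV"
    unfolding convergent2_def by auto
  have "conv2 F x y" if xy: "norm x < r / R" "norm y < r / R" for x y :: 'a
    unfolding conv2_def
  proof (rule summable_on_comparison_test)
    show "(\<lambda>p. C * (\<lambda>(i, j). r ^ i * r ^ j) p) summable_on UNIV"
      using r(2) by (rule summable_on_cmult_right)
    show "norm (term2 F x y p) \<le> C * (\<lambda>(i, j). r ^ i * r ^ j) p" for p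
    proof -
      obtain i j where p: "p = (i, j)" by (cases p)
      have "norm (term2 F x y p) = \<bar>coeff2 F i j\<bar> * (norm x ^ i * norm y ^ j)"
        by (simp add: p term2_def norm_mult norm_power)
      also have "\<dots> \<le> C * R ^ (i + j) * ((r / R) ^ i * (r / R) ^ j)"
        using CR xy r by (intro mult_mono power_mono) auto
      also have "\<dots> = C * (r ^ i * r ^ j)"
        using CR by (simp add: power_divide power_add field_simps)
      finally show ?thesis by (simp add: p)
    qed
  qed auto
  moreover have "r / R > 0" using r CR by simp
  ultimately show ?thesis unfolding eventually_nhds_00_iff by blast
qed

lemma eval2_diff:
  assumes "conv2 F x y" "conv2 G x y"
  shows "eval2 (F - G) x y = eval2 F x y - eval2 G x y"
proof -
  have "term2 (F - G) x y = (\<lambda>p. term2 F x y p + (- 1) * term2 G x y p)"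
    by (auto simp: term2_def algebra_simps)
  thus ?thesis using assms
    by (simp only: eval2_eq infsum_add conv2D summable_on_cmult_right infsum_cmult_right')
       (simp add: infsum_uminus)
qed

lemma eval2_1 [simp]: "eval2 1 x y = 1"
proof -
  have "eval2 1 x y = infsum (term2 1 x y) {(0, 0)}"
    unfolding eval2_eq by (rule infsum_cong_neutral) (auto simp: term2_def split: if_splits)
  thus ?thesis by (simp add: term2_def)
qed

lemma eval2_0_0: "eval2 F 0 0 = of_real (coeff2 F 0 0)"
proof -
  have "eval2 F 0 0 = infsum (term2 F 0 0) {(0, 0)}"
    unfolding eval2_eq by (rule infsum_cong_neutral) (auto simp: term2_def split: if_splits)
  thus ?thesis by (simp add: term2_def)
qed

lemma eval2_Y2: "eval2 Y2 x y = y"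
proof -
  have "eval2 Y2 x y = infsum (term2 Y2 x y) {(0, 1)}"
    unfolding eval2_eq by (rule infsum_cong_neutral) (auto simp: term2_def split: if_splits)
  thus ?thesis by (simp add: term2_def)
qed

lemma eval2_mult:
  fixes x y :: "'a::{banach, real_normed_field}"
  assumes F: "conv2 F x y" and G: "conv2 G x y"
  shows "eval2 (F * G) x y = eval2 F x y * eval2 G x y"
proof -
  let ?f = "\<lambda>(p, q). term2 F x y p * term2 G x y q"
  let ?S = "\<lambda>n::nat \<times> nat. {..fst n} \<times> {..snd n}"
  let ?h = "\<lambda>(n, p). term2 F x y p * term2 G x y (n - p)"
  have "(?f has_sum (eval2 F x y * eval2 G x y)) (UNIV \<times> UNIV)"
    using infsum_product[OF F[unfolded conv2_def] G[unfolded conv2_def]]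
    by (metis abs_summable_summable eval2_eq has_sum_infsum)
  \<comment> \<open>Cauchy product: a pair of exponent vectors (p, q) is listed by its sum n = p + q
    and by p, so for fixed n the vector p runs through the finite rectangle
    \<open>?S n\<close>.\<close>
  also have "?this \<longleftrightarrow> (?h has_sum (eval2 F x y * eval2 G x y)) (Sigma UNIV ?S)"
    by (rule has_sum_reindex_bij_witness[of _ "\<lambda>(n, p). (p, n - p)" "\<lambda>(p, q). (p + q, p)"]) auto
  finally have h: "(?h has_sum (eval2 F x y * eval2 G x y)) (Sigma UNIV ?S)" .
  hence "eval2 F x y * eval2 G x y = infsum ?h (Sigma UNIV ?S)"
    by (simp add: infsumI)
  also have "\<dots> = infsum (\<lambda>n. infsum (\<lambda>p. ?h (n, p)) (?S n)) UNIV"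
    using h by (intro infsum_Sigma_banach[symmetric]) (auto simp: summable_on_def)
  also have "\<dots> = infsum (term2 (F * G) x y) UNIV"
  proof (rule infsum_cong)
    fix n :: "nat \<times> nat"
    obtain i j where n: "n = (i, j)" by (cases n)
    have "infsum (\<lambda>p. ?h (n, p)) (?S n) = (\<Sum>p\<in>?S n. ?h (n, p))" by simp
    also have "\<dots> = (\<Sum>(k, l)\<in>{..i} \<times> {..j}. of_real (coeff2 F k l * coeff2 G (i - k) (j - l)) * x ^ i
        * y ^ j)"
    proof (rule sum.cong)
      fix p assume "p \<in> {..i} \<times> {..j}"
      then obtain k l where p: "p = (k, l)" and "k \<le> i" "l \<le> j" by auto
      hence "x ^ i = x ^ k * x ^ (i - k)" "y ^ j = y ^ l * y ^ (j - l)"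
        by (simp_all flip: power_add)
      thus "?h (n, p) = (case p of (k, l) \<Rightarrow> of_real (coeff2 F k l * coeff2 G (i - k) (j - l)) * x ^
          i * y ^ j)"
        by (simp add: term2_def n p)
    qed (simp add: n)
    also have "\<dots> = term2 (F * G) x y n"
      by (simp add: term2_def n coeff2_mult sum.cartesian_product sum_distrib_right
          case_prod_unfold)
    finally show "infsum (\<lambda>p. ?h (n, p)) (?S n) = term2 (F * G) x y n" .
  qed
  finally show ?thesis by (simp add: eval2_eq)
qed

lemma eventually_eval2_mult:
  "\<forall>\<^sub>F (x, y) in nhds (0::'a::{banach, real_normed_field}, 0). eval2 (F * G) x y =
      eval2 F x y * eval2 G x y"
  using eventually_conj[OF eventually_conv2[of F] eventually_conv2[of G]]
  by eventually_elim (auto simp: eval2_mult)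

lemma eventually_eval2_unit_mult:
  assumes "U * V = 1"
  shows "\<forall>\<^sub>F (x, y) in nhds (0::'a::{banach, real_normed_field}, 0). eval2 (U * F) x y = 0 \<longleftrightarrow>
      eval2 F x y = 0"
  using eventually_conj[OF eventually_eval2_mult[of U V] eventually_eval2_mult[of U F]]
  by eventually_elim (auto simp: assms)

lemma eval2_of_real:
  assumes "conv2 F (x::real) y"
  shows "eval2 F (of_real x) (of_real y :: 'a::{banach, real_normed_field}) = of_real (eval2 F x y)"
proof -
  have "((\<lambda>p. of_real (term2 F x y p) :: 'a) has_sum of_real (eval2 F x y)) UNIV"
    unfolding eval2_eq using conv2D[OF assms] by (intro has_sum_of_real has_sum_infsum)
  hence "eval2 F (of_real x) (of_real y :: 'a) = of_real (eval2 F x y)"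
    unfolding eval2_eq term2_def by (intro infsumI) (simp add: case_prod_unfold)
  thus ?thesis .
qed

section \<open>The coefficient series in y and their radii of convergence\<close>

definition x_coeff :: "cps2 \<Rightarrow> nat \<Rightarrow> 'a::{banach, real_normed_field} fps" where
  "x_coeff F i = Abs_fps (\<lambda>j. of_real (coeff2 F i j))"

text \<open>A bound C R^n on the coefficients is easy to carry through respacing, truncation and
  changes of scalars, where the radius of convergence itself would have to be recomputed.\<close>

lemma fps_conv_radius_pos_iff:
  fixes f :: "'a::{banach, real_normed_field} fps"
  shows "fps_conv_radius f > 0 \<longleftrightarrow> (\<exists>C R. R > 0 \<and> (\<forall>n. norm (fps_nth f n) \<le> C * R ^ n))"
proof
  assume "fps_conv_radius f > 0"
  then obtain r where r: "r > 0" "ereal r < fps_conv_radius f"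
    by (metis ereal_dense2 ereal_less(2) less_ereal.simps(1) zero_ereal_def)
  hence "summable (\<lambda>n. norm (fps_nth f n * of_real r ^ n))"
    by (intro norm_summable_fps) auto
  hence "Bseq (\<lambda>n. norm (fps_nth f n * of_real r ^ n))"
    by (intro convergent_imp_Bseq summable_LIMSEQ_zero[THEN convergentI])
  then obtain C where C: "\<And>n. norm (fps_nth f n * of_real r ^ n) \<le> C"
    by (auto simp: Bseq_def)
  have "norm (fps_nth f n) \<le> C * (1 / r) ^ n" for n
    using C[of n] r by (simp add: norm_mult norm_power field_simps)
  thus "\<exists>C R. R > 0 \<and> (\<forall>n. norm (fps_nth f n) \<le> C * R ^ n)"
    using r by (intro exI[of _ C] exI[of _ "1 / r"]) auto
next
  assume "\<exists>C R. R > 0 \<and> (\<forall>n. norm (fps_nth f n) \<le> C * R ^ n)"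
  then obtain C R where CR: "R > 0" "\<And>n. norm (fps_nth f n) \<le> C * R ^ n" by auto
  have "summable (\<lambda>n. fps_nth f n * of_real (1 / (2 * R)) ^ n)"
  proof (rule summable_comparison_test')
    show "summable (\<lambda>n. C * (1 / 2 :: real) ^ n)" by (intro summable_mult summable_geometric) auto
    show "norm (fps_nth f n * of_real (1 / (2 * R)) ^ n) \<le> C * (1 / 2) ^ n" for n
    proof -
      have "norm (fps_nth f n * of_real (1 / (2 * R)) ^ n) = norm (fps_nth f n) * (1 / (2 * R)) ^ n"
        using CR by (simp add: norm_mult norm_power norm_divide)
      also have "\<dots> \<le> C * R ^ n * (1 / (2 * R)) ^ n"
        using CR by (intro mult_right_mono) auto
      also have "\<dots> = C * (1 / 2) ^ n" using CR by (simp add: power_divide power_mult_distrib)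
      finally show ?thesis .
    qed
  qed
  hence "fps_conv_radius f \<ge> norm (of_real (1 / (2 * R)) :: 'a)"
    unfolding fps_conv_radius_def by (rule conv_radius_geI)
  moreover have "norm (of_real (1 / (2 * R)) :: 'a) > 0" using CR by simp
  ultimately show "fps_conv_radius f > 0"
    by (metis ereal_less(2) less_le_trans)
qed

lemma fps_conv_radius_x_coeff: "fps_conv_radius (x_coeff F i) > 0"
proof -
  obtain C R where CR: "C \<ge> 0" "R \<ge> 1" "\<And>i j. \<bar>coeff2 F i j\<bar> \<le> C * R ^ (i + j)"
    by (rule coeff2_bound[of F]) blast
  show ?thesis unfolding fps_conv_radius_pos_iff
    by (rule exI[of _ "C * R ^ i"], rule exI[of _ R])
       (use CR(2) CR(3)[of i] in \<open>auto simp: x_coeff_def power_add mult.assoc\<close>)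
qed

lemma has_sum_eval_fps:
  assumes "norm y < fps_conv_radius f"
  shows "((\<lambda>n. fps_nth f n * y ^ n) has_sum eval_fps f y) UNIV"
  using norm_summable_imp_has_sum[OF norm_summable_fps[OF assms] sums_eval_fps[OF assms]] .

lemma eventually_eval2_eq_sum:
  assumes "\<And>i j. i \<ge> n \<Longrightarrow> coeff2 F i j = 0"
  shows "\<forall>\<^sub>F (x, y) in nhds (0::'a::{banach, real_normed_field}, 0).
    eval2 F x y = (\<Sum>i<n. eval_fps (x_coeff F i) y * x ^ i)"
proof -
  have "\<forall>\<^sub>F (x, y) in nhds (0::'a, 0::'a). ereal (norm y) < fps_conv_radius (x_coeff F i :: 'a fps)"
      for i
  proof -
    obtain r where "r > 0" "ereal r < fps_conv_radius (x_coeff F i :: 'a fps)"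
      using fps_conv_radius_x_coeff[of F i, where 'a = 'a]
      by (metis ereal_dense2 ereal_less(2) less_ereal.simps(1) zero_ereal_def)
    thus ?thesis unfolding eventually_nhds_00_iff
      by (intro exI[of _ r]) (auto intro: less_trans[of _ "ereal r"])
  qed
  hence "\<forall>\<^sub>F p in nhds (0::'a, 0::'a). \<forall>i\<in>{..<n}. ereal (norm (snd p)) < fps_conv_radius (x_coeff F
      i :: 'a fps)"
    by (intro eventually_ball_finite) (auto simp: case_prod_unfold)
  with eventually_conv2[of F, where 'a = 'a] show ?thesis
  proof eventually_elim
    case (elim p)
    obtain x y where p: "p = (x, y)" by (cases p)
    have conv: "term2 F x y summable_on UNIV" using elim conv2D by (auto simp: p)
    have "eval2 F x y = infsum (term2 F x y) ({..<n} \<times> UNIV)"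
      unfolding eval2_eq
    proof (rule infsum_cong_neutral)
      fix p assume "p \<in> UNIV - {..<n} \<times> (UNIV :: nat set)"
      hence "coeff2 F (fst p) (snd p) = 0" by (intro assms) (auto simp: not_less mem_Times_iff)
      thus "term2 F x y p = 0" by (simp add: term2_def case_prod_unfold)
    qed auto
    also have "\<dots> = infsum (\<lambda>i. infsum (\<lambda>j. term2 F x y (i, j)) UNIV) {..<n}"
      by (rule infsum_Sigma_banach[symmetric]) (rule summable_on_subset_banach[OF conv], simp)
    also have "\<dots> = (\<Sum>i<n. infsum (\<lambda>j. term2 F x y (i, j)) UNIV)" by simp
    also have "\<dots> = (\<Sum>i<n. eval_fps (x_coeff F i) y * x ^ i)"
    proof (intro sum.cong refl)
      fix i assume "i \<in> {..<n}"
      hence "norm y < fps_conv_radius (x_coeff F i :: 'a fps)" using elim by (auto simp: p)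
      from has_sum_cmult_left[OF has_sum_eval_fps[OF this], of "x ^ i"]
      show "infsum (\<lambda>j. term2 F x y (i, j)) UNIV = eval_fps (x_coeff F i) y * x ^ i"
        by (intro infsumI) (simp add: term2_def x_coeff_def mult_ac)
    qed
    finally show ?case by (simp add: p)
  qed
qed

section \<open>Puiseux series\<close>

text \<open>The denominator is made explicit and need not be the smallest one, so that two series
  can be written in powers of the same y^(1/N).\<close>

definition puiseux_denom :: "nat \<Rightarrow> (rat \<Rightarrow> complex) \<Rightarrow> bool" where
  "puiseux_denom N \<phi> \<longleftrightarrow> N > 0 \<and>
     {q. \<phi> q \<noteq> 0} \<subseteq> {of_nat n / of_nat N | n. N \<le> n} \<and>
     fps_conv_radius (Abs_fps (\<lambda>n. \<phi> (of_nat n / of_nat N))) > 0"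

lemma puiseux_iff_denom: "puiseux \<phi> \<longleftrightarrow> (\<exists>N. puiseux_denom N \<phi>)"
  by (auto simp: puiseux_def puiseux_denom_def)

lemma puiseux_denom_mult:
  assumes "puiseux_denom N \<phi>" "M > 0"
  shows "puiseux_denom (N * M) \<phi>"
proof -
  have N: "N > 0" and supp: "\<And>q. \<phi> q \<noteq> 0 \<Longrightarrow> \<exists>n\<ge>N. q = of_nat n / of_nat N"
    using assms by (auto simp: puiseux_denom_def)
  obtain C R where CR: "R > 0" "\<And>n. norm (\<phi> (of_nat n / of_nat N)) \<le> C * R ^ n"
    using assms(1) by (auto simp: puiseux_denom_def fps_conv_radius_pos_iff)
  have C: "C \<ge> 0" using CR(2)[of 0] by (simp add: order_trans[OF norm_ge_zero])
  \<comment> \<open>Passing from N to N M moves the coefficient with index k to k M. A base of at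
    least 1 is wanted so that S^k \<le> S^(k M).\<close>
  define S where "S = max 1 R"
  have "norm (\<phi> (of_nat n / of_nat (N * M))) \<le> C * S ^ n" for n
  proof (cases "\<phi> (of_nat n / of_nat (N * M)) = 0")
    case False
    then obtain k where k: "of_nat n / of_nat (N * M) = (of_nat k / of_nat N :: rat)" using supp
        by blast
    hence "of_nat n = (of_nat (k * M) :: rat)" using N assms(2) by (simp add: field_simps)
    hence nk: "n = k * M" by (simp only: of_nat_eq_iff)
    have "norm (\<phi> (of_nat n / of_nat (N * M))) \<le> C * R ^ k" using CR(2)[of k] k by simp
    also have "\<dots> \<le> C * S ^ k" using C CR by (intro mult_left_mono power_mono) (auto simp: S_def)
    also have "\<dots> \<le> C * S ^ n"
      using C assms(2) by (intro mult_left_mono power_increasing) (auto simp: S_def nk)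
    finally show ?thesis .
  qed (use C in \<open>simp add: S_def\<close>)
  hence "fps_conv_radius (Abs_fps (\<lambda>n. \<phi> (of_nat n / of_nat (N * M)))) > 0"
    unfolding fps_conv_radius_pos_iff by (intro exI[of _ C] exI[of _ S]) (auto simp: S_def)
  moreover have "{q. \<phi> q \<noteq> 0} \<subseteq> {of_nat n / of_nat (N * M) | n. N * M \<le> n}"
  proof
    fix q assume "q \<in> {q. \<phi> q \<noteq> 0}"
    then obtain n where n: "n \<ge> N" "q = of_nat n / of_nat N" using supp by blast
    have "q = of_nat (n * M) / of_nat (N * M)" using n N assms(2) by (simp add: field_simps)
    moreover have "N * M \<le> n * M" using n by simp
    ultimately show "q \<in> {of_nat n / of_nat (N * M) | n. N * M \<le> n}" by blast
  qed
  ultimately show ?thesis using N assms(2) by (simp add: puiseux_denom_def)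
qed

lemma puiseux_denom_common:
  assumes "puiseux \<phi>" "puiseux \<psi>"
  obtains N where "puiseux_denom N \<phi>" "puiseux_denom N \<psi>"
proof -
  obtain N M where NM: "puiseux_denom N \<phi>" "puiseux_denom M \<psi>" using assms
      by (auto simp: puiseux_iff_denom)
  hence "N > 0" "M > 0" by (auto simp: puiseux_denom_def)
  thus ?thesis using NM puiseux_denom_mult[of N \<phi> M] puiseux_denom_mult[of M \<psi> N] that[of "N * M"]
    by (simp add: mult.commute)
qed

definition puiseux_fps :: "nat \<Rightarrow> (rat \<Rightarrow> complex) \<Rightarrow> complex fps" where
  "puiseux_fps N \<phi> = Abs_fps (\<lambda>n. \<phi> (of_nat n / of_nat N))"

lemma root_tendsto_0:
  assumes "N > 0"
  shows "((\<lambda>y::real. y powr (1 / of_nat N)) \<longlongrightarrow> 0) (at_right 0)"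
proof -
  have "\<forall>\<^sub>F y in at_right (0::real). 0 \<le> y"
    using eventually_at_right_less[of 0] by eventually_elim simp
  moreover have "((\<lambda>y::real. y) \<longlongrightarrow> 0) (at_right 0)" by (rule tendsto_ident_at)
  ultimately have "((\<lambda>y::real. y powr (1 / of_nat N)) \<longlongrightarrow> 0 powr (1 / of_nat N)) (at_right 0)"
    using assms by (intro tendsto_powr') auto
  thus ?thesis by simp
qed

lemma eventually_powr_less_radius:
  assumes "fps_conv_radius (f :: complex fps) > 0" "N > 0"
  shows "\<forall>\<^sub>F y in at_right (0::real). norm (of_real (y powr (1 / of_nat N)) :: complex) <
      fps_conv_radius f"
proof -
  obtain r where r: "r > 0" "ereal r < fps_conv_radius f"
    using assms by (metis ereal_dense2 ereal_less(2) less_ereal.simps(1) zero_ereal_def)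
  have "((\<lambda>y::real. y powr (1 / of_nat N)) \<longlongrightarrow> 0) (at_right 0)"
    by (rule root_tendsto_0[OF assms(2)])
  hence "\<forall>\<^sub>F y in at_right (0::real). y powr (1 / of_nat N) < r"
    using r(1) by (rule order_tendstoD)
  thus ?thesis
    by eventually_elim (use r(2) in \<open>auto intro: less_trans[of _ "ereal r"]\<close>)
qed

lemma puiseux_eval_eq:
  assumes \<phi>: "puiseux_denom N \<phi>" and y: "y > 0"
    "norm (of_real (y powr (1 / of_nat N)) :: complex) < fps_conv_radius (puiseux_fps N \<phi>)"
  shows "puiseux_eval \<phi> y = eval_fps (puiseux_fps N \<phi>) (of_real (y powr (1 / of_nat N)))"
proof -
  let ?e = "\<lambda>n::nat. of_nat n / of_nat N :: rat"
  have N: "N > 0" using \<phi> by (simp add: puiseux_denom_def)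
  have inj: "inj ?e" using N by (auto simp: inj_on_def)
  have "puiseux_eval \<phi> y = infsum (\<lambda>q. \<phi> q * of_real (y powr of_rat q)) (range ?e)"
    unfolding puiseux_eval_def
  proof (rule infsum_cong_neutral)
    fix q assume "q \<in> UNIV - range ?e"
    hence "\<phi> q = 0" using \<phi> by (auto simp: puiseux_denom_def)
    thus "\<phi> q * of_real (y powr of_rat q) = 0" by simp
  qed auto
  also have "\<dots> = infsum (\<lambda>n. \<phi> (?e n) * of_real (y powr of_rat (?e n))) UNIV"
    by (subst infsum_reindex[OF inj]) (simp add: o_def)
  also have "(\<lambda>n. \<phi> (?e n) * of_real (y powr of_rat (?e n))) =
      (\<lambda>n. fps_nth (puiseux_fps N \<phi>) n * of_real (y powr (1 / of_nat N)) ^ n)"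
  proof
    fix n
    have "y powr of_rat (?e n) = (y powr (1 / of_nat N)) ^ n"
      using y(1) by (simp add: of_rat_divide powr_power)
    thus "\<phi> (?e n) * of_real (y powr of_rat (?e n)) =
      fps_nth (puiseux_fps N \<phi>) n * of_real (y powr (1 / of_nat N)) ^ n"
      by (simp add: puiseux_fps_def)
  qed
  also have "infsum \<dots> UNIV = eval_fps (puiseux_fps N \<phi>) (of_real (y powr (1 / of_nat N)))"
    by (rule infsumI[OF has_sum_eval_fps[OF y(2)]])
  finally show ?thesis .
qed

lemma eventually_puiseux_eval:
  assumes "puiseux_denom N \<phi>"
  shows "\<forall>\<^sub>F y in at_right 0. puiseux_eval \<phi> y = eval_fps (puiseux_fps N \<phi>) (of_real (y powr (1 /
      of_nat N)))"
proof -
  have "fps_conv_radius (puiseux_fps N \<phi>) > 0" "N > 0"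
    using assms by (simp_all add: puiseux_denom_def puiseux_fps_def)
  from eventually_powr_less_radius[OF this] eventually_at_right_less[of 0]
  show ?thesis by eventually_elim (rule puiseux_eval_eq[OF assms])
qed

section \<open>Differences and leading terms of Puiseux series\<close>

lemma puiseux_denom_diff:
  assumes "puiseux_denom N \<phi>" "puiseux_denom N \<psi>"
  shows "puiseux_denom N (\<lambda>q. \<phi> q - \<psi> q)"
proof -
  have "Abs_fps (\<lambda>n. \<phi> (of_nat n / of_nat N) - \<psi> (of_nat n / of_nat N)) =
      puiseux_fps N \<phi> - puiseux_fps N \<psi>"
    by (auto simp: fps_eq_iff puiseux_fps_def)
  moreover have "fps_conv_radius \<dots> > 0"
    using assms less_le_trans[OF _ fps_conv_radius_diff[of "puiseux_fps N \<phi>" "puiseux_fps N \<psi>"]]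
    by (simp add: puiseux_denom_def puiseux_fps_def)
  moreover have "{q. \<phi> q - \<psi> q \<noteq> 0} \<subseteq> {q. \<phi> q \<noteq> 0} \<union> {q. \<psi> q \<noteq> 0}" by auto
  ultimately show ?thesis using assms unfolding puiseux_denom_def by auto
qed

lemma puiseux_diff:
  assumes "puiseux \<phi>" "puiseux \<psi>"
  shows "puiseux (\<lambda>q. \<phi> q - \<psi> q)"
proof -
  obtain N where "puiseux_denom N \<phi>" "puiseux_denom N \<psi>" by (rule puiseux_denom_common[OF assms])
  hence "puiseux_denom N (\<lambda>q. \<phi> q - \<psi> q)" by (rule puiseux_denom_diff)
  thus ?thesis unfolding puiseux_iff_denom ..
qed

lemma eventually_puiseux_eval_diff:
  assumes "puiseux \<phi>" "puiseux \<psi>"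
  shows "\<forall>\<^sub>F y in at_right 0. puiseux_eval (\<lambda>q. \<phi> q - \<psi> q) y = puiseux_eval \<phi> y - puiseux_eval \<psi> y"
proof -
  obtain N where N: "puiseux_denom N \<phi>" "puiseux_denom N \<psi>" by (rule puiseux_denom_common[OF assms])
  have pos: "fps_conv_radius (puiseux_fps N \<phi>) > 0" "fps_conv_radius (puiseux_fps N \<psi>) > 0" "N > 0"
    using N by (simp_all add: puiseux_denom_def puiseux_fps_def)
  have eq: "puiseux_fps N (\<lambda>q. \<phi> q - \<psi> q) = puiseux_fps N \<phi> - puiseux_fps N \<psi>"
    by (auto simp: fps_eq_iff puiseux_fps_def)
  from eventually_puiseux_eval[OF N(1)] eventually_puiseux_eval[OF N(2)]
    eventually_puiseux_eval[OF puiseux_denom_diff[OF N]]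
    eventually_powr_less_radius[OF pos(1,3)] eventually_powr_less_radius[OF pos(2,3)]
  show ?thesis by eventually_elim (simp add: eq eval_fps_diff)
qed

lemma puiseux_ordI:
  assumes "\<psi> \<rho> \<noteq> 0" "\<And>q. q < \<rho> \<Longrightarrow> \<psi> q = 0"
  shows "puiseux_ord \<psi> = ereal (of_rat \<rho>)"
proof -
  have "(LEAST q. \<psi> q \<noteq> 0) = \<rho>"
    using assms by (intro Least_equality) (auto simp: not_less[symmetric])
  thus ?thesis using assms(1) by (auto simp: puiseux_ord_def)
qed

lemma puiseux_denom_leading:
  assumes "puiseux_denom N \<psi>" "\<psi> \<noteq> (\<lambda>_. 0)"
  defines "d \<equiv> subdegree (puiseux_fps N \<psi>)"
  shows "puiseux_fps N \<psi> \<noteq> 0" "\<psi> (of_nat d / of_nat N) \<noteq> 0" "\<And>q. q < of_nat d / of_nat N \<Longrightarrow> \<psi> q = 0"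
      "d \<ge> N"
proof -
  have N: "N > 0" and supp: "\<And>q. \<psi> q \<noteq> 0 \<Longrightarrow> \<exists>n\<ge>N. q = of_nat n / of_nat N"
    using assms by (auto simp: puiseux_denom_def)
  obtain q where "\<psi> q \<noteq> 0" using assms(2) by auto
  then obtain n where "q = of_nat n / of_nat N" using supp by blast
  hence "fps_nth (puiseux_fps N \<psi>) n \<noteq> 0" using \<open>\<psi> q \<noteq> 0\<close> by (simp add: puiseux_fps_def)
  thus nz: "puiseux_fps N \<psi> \<noteq> 0" by auto
  from nth_subdegree_nonzero[OF nz] show d: "\<psi> (of_nat d / of_nat N) \<noteq> 0"
    by (simp add: d_def puiseux_fps_def)
  from supp[OF d] obtain n where "n \<ge> N" "of_nat d / of_nat N = (of_nat n / of_nat N :: rat)"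
      by blast
  thus "d \<ge> N" using N by simp
  show "\<psi> q = 0" if "q < of_nat d / of_nat N" for q
  proof (rule ccontr)
    assume "\<psi> q \<noteq> 0"
    then obtain n where n: "q = of_nat n / of_nat N" using supp by blast
    hence "n < d" using that N by (simp add: field_simps)
    hence "fps_nth (puiseux_fps N \<psi>) n = 0" unfolding d_def by (rule nth_less_subdegree_zero)
    thus False using \<open>\<psi> q \<noteq> 0\<close> n by (simp add: puiseux_fps_def)
  qed
qed

lemma puiseux_leading:
  assumes "puiseux \<psi>" "\<psi> \<noteq> (\<lambda>_. 0)"
  obtains \<rho> where "\<rho> \<ge> 1" "\<psi> \<rho> \<noteq> 0" "\<And>q. q < \<rho> \<Longrightarrow> \<psi> q = 0" "puiseux_ord \<psi> = ereal (of_rat \<rho>)"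
proof -
  obtain N where N: "puiseux_denom N \<psi>" using assms by (auto simp: puiseux_iff_denom)
  note * = puiseux_denom_leading[OF N assms(2)]
  have "N > 0" using N by (simp add: puiseux_denom_def)
  show ?thesis
  proof (rule that[OF _ *(2,3)])
    show "1 \<le> (of_nat (subdegree (puiseux_fps N \<psi>)) / of_nat N :: rat)"
      using *(4) \<open>N > 0\<close> by (simp add: field_simps)
    show "puiseux_ord \<psi> = ereal (of_rat (of_nat (subdegree (puiseux_fps N \<psi>)) / of_nat N))"
      using *(2,3) by (rule puiseux_ordI)
  qed
qed

text \<open>As a power series in t = y^(1/N) the function is t^d g(t) with g(0) nonzero. By
  continuity |g| eventually lies between half and twice |g(0)|, and t^d is y to the order of the
  series.\<close>

lemma puiseux_asymptotics:
  assumes "puiseux \<psi>" "puiseux_ord \<psi> = ereal (of_rat \<rho>)"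
  obtains c C where "c > 0" "C > 0"
    "\<forall>\<^sub>F y in at_right 0. c * y powr of_rat \<rho> \<le> norm (puiseux_eval \<psi> y) \<and>
       norm (puiseux_eval \<psi> y) \<le> C * y powr of_rat \<rho>"
proof -
  obtain N where N: "puiseux_denom N \<psi>" using assms by (auto simp: puiseux_iff_denom)
  have N0: "N > 0" using N by (simp add: puiseux_denom_def)
  have nz: "\<psi> \<noteq> (\<lambda>_. 0)" using assms(2) by (auto simp: puiseux_ord_def)
  define f where "f = puiseux_fps N \<psi>"
  define d where "d = subdegree f"
  note lead = puiseux_denom_leading[OF N nz, folded f_def, folded d_def]
  have "of_rat \<rho> = (of_rat (of_nat d / of_nat N) :: real)"
    using puiseux_ordI[of \<psi>, OF lead(2) lead(3)] assms(2) by simp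
  hence \<rho>: "of_rat \<rho> = real d / real N" by (simp add: of_rat_divide)
  define g where "g = fps_shift d f"
  have fg: "f = g * fps_X ^ d" unfolding g_def d_def by (rule subdegree_decompose)
  have g0: "fps_nth g 0 \<noteq> 0" using lead(1) by (simp add: g_def d_def)
  have rad: "fps_conv_radius f > 0" using N by (simp add: f_def puiseux_denom_def puiseux_fps_def)
  hence radg: "fps_conv_radius g > 0" by (simp add: g_def)
  let ?t = "\<lambda>y::real. y powr (1 / of_nat N)"
  have lim: "((\<lambda>y::real. complex_of_real (?t y)) \<longlongrightarrow> 0) (at_right 0)"
    using tendsto_of_real[OF root_tendsto_0[OF N0]] by simp
  have "isCont (eval_fps g) 0" using radg by (intro continuous_eval_fps) (auto simp: zero_ereal_def)
  hence "((\<lambda>y. eval_fps g (of_real (?t y))) \<longlongrightarrow> eval_fps g 0) (at_right 0)"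
    using lim by (rule isCont_tendsto_compose)
  hence "((\<lambda>y. norm (eval_fps g (of_real (?t y)))) \<longlongrightarrow> norm (fps_nth g 0)) (at_right 0)"
    using tendsto_norm by (simp add: eval_fps_at_0)
  from order_tendstoD(1)[OF this, of "norm (fps_nth g 0) / 2"] order_tendstoD(2)[OF this, of "2 *
      norm (fps_nth g 0)"]
  have "\<forall>\<^sub>F y in at_right 0. norm (eval_fps g (of_real (?t y))) > norm (fps_nth g 0) / 2"
    "\<forall>\<^sub>F y in at_right 0. norm (eval_fps g (of_real (?t y))) < 2 * norm (fps_nth g 0)"
    using g0 by simp_all
  with eventually_puiseux_eval[OF N] eventually_at_right_less[of 0] eventually_powr_less_radius[OF
      rad N0]
  have "\<forall>\<^sub>F y in at_right 0. norm (fps_nth g 0) / 2 * y powr of_rat \<rho> \<le> norm (puiseux_eval \<psi> y) \<and>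
       norm (puiseux_eval \<psi> y) \<le> 2 * norm (fps_nth g 0) * y powr of_rat \<rho>"
  proof eventually_elim
    case (elim y)
    have "eval_fps f (of_real (?t y)) = eval_fps g (of_real (?t y)) * of_real (?t y) ^ d"
      using elim(3) by (subst fg, subst eval_fps_mult) (auto simp: g_def)
    hence "norm (puiseux_eval \<psi> y) = norm (eval_fps g (of_real (?t y))) * (?t y) ^ d"
      using elim by (simp add: f_def norm_mult norm_power)
    also have "(?t y) ^ d = y powr of_rat \<rho>" using elim by (simp add: \<rho> powr_power)
    finally show ?case using elim by (auto intro!: mult_right_mono)
  qed
  thus ?thesis using g0 by (intro that[of "norm (fps_nth g 0) / 2" "2 * norm (fps_nth g 0)"]) auto
qed

lemma eventually_puiseux_eval_neq:
  assumes "puiseux \<phi>" "puiseux \<psi>" "\<phi> \<noteq> \<psi>"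
  shows "\<forall>\<^sub>F y in at_right 0. puiseux_eval \<phi> y \<noteq> puiseux_eval \<psi> y"
proof -
  have diff: "puiseux (\<lambda>q. \<phi> q - \<psi> q)" by (rule puiseux_diff[OF assms(1,2)])
  moreover have "(\<lambda>q. \<phi> q - \<psi> q) \<noteq> (\<lambda>_. 0)"
  proof
    assume "(\<lambda>q. \<phi> q - \<psi> q) = (\<lambda>_. 0)"
    hence "\<phi> q = \<psi> q" for q by (metis eq_iff_diff_eq_0)
    thus False using assms(3) by auto
  qed
  ultimately obtain \<rho> where "puiseux_ord (\<lambda>q. \<phi> q - \<psi> q) = ereal (of_rat \<rho>)"
    by (rule puiseux_leading)
  then obtain c C where c: "c > 0" "\<forall>\<^sub>F y in at_right 0. c * y powr of_rat \<rho> \<le>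
      norm (puiseux_eval (\<lambda>q. \<phi> q - \<psi> q) y) \<and>
      norm (puiseux_eval (\<lambda>q. \<phi> q - \<psi> q) y) \<le> C * y powr of_rat \<rho>"
    by (rule puiseux_asymptotics[OF diff]) blast
  from c(2) eventually_puiseux_eval_diff[OF assms(1,2)] eventually_at_right_less[of 0]
  show ?thesis
  proof eventually_elim
    case (elim y)
    hence "c * y powr of_rat \<rho> > 0" using c(1) by simp
    thus ?case using elim by auto
  qed
qed

text \<open>All exponents being at least 1 is what makes this true. The series is y g(t) with t =
  y^(1/N), and although t is not Lipschitz in y at 0, the factor y compensates for the steep growth
  of t.\<close>

lemma puiseux_Lipschitz:
  assumes "puiseux \<phi>"
  obtains K \<epsilon> where "K > 0" "\<epsilon> > 0"
    "\<And>y y'. 0 < y \<Longrightarrow> y < \<epsilon> \<Longrightarrow> 0 < y' \<Longrightarrow> y' < \<epsilon> \<Longrightarrow>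
       norm (puiseux_eval \<phi> y - puiseux_eval \<phi> y') \<le> K * \<bar>y - y'\<bar>"
    "\<And>y. 0 < y \<Longrightarrow> y < \<epsilon> \<Longrightarrow> norm (puiseux_eval \<phi> y) \<le> K * y"
proof -
  obtain N where N: "puiseux_denom N \<phi>" using assms by (auto simp: puiseux_iff_denom)
  have N0: "N > 0" using N by (simp add: puiseux_denom_def)
  define f where "f = puiseux_fps N \<phi>"
  have f_low: "fps_nth f n = 0" if "n < N" for n
  proof (rule ccontr)
    assume "fps_nth f n \<noteq> 0"
    then obtain k where "k \<ge> N" "of_nat n / of_nat N = (of_nat k / of_nat N :: rat)"
      using N by (auto simp: puiseux_denom_def f_def puiseux_fps_def)
    thus False using N0 that by simp
  qed
  define g where "g = fps_shift N f"
  have rad: "fps_conv_radius f > 0" using N by (simp add: f_def puiseux_denom_def puiseux_fps_def)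
  hence radg: "fps_conv_radius g > 0" by (simp add: g_def)
  \<comment> \<open>Exponents n/N \<ge> 1 mean that f is divisible by t^N, and t^N = y.\<close>
  have fg: "f = g * fps_X ^ N"
    using f_low by (auto simp: g_def fps_eq_iff fps_X_power_mult_right_nth)
  obtain r where r: "r > 0" "ereal r < fps_conv_radius f"
    using rad by (metis ereal_dense2 ereal_less(2) less_ereal.simps(1) zero_ereal_def)
  have rg: "ereal r < fps_conv_radius g" using r by (simp add: g_def)
  have "continuous_on (cball 0 r) (eval_fps (fps_deriv g))"
    by (intro continuous_on_eval_fps') (use rg less_le_trans[OF _ fps_conv_radius_deriv[of g]] in
      \<open>auto intro: le_less_trans[of _ "ereal r"] simp: eball_def\<close>)
  hence "bounded (eval_fps (fps_deriv g) ` cball 0 r)"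
    by (intro compact_imp_bounded compact_continuous_image) auto
  then obtain L where L: "\<And>z. z \<in> cball 0 r \<Longrightarrow> norm (eval_fps (fps_deriv g) z) \<le> L"
    unfolding bounded_iff by blast
  have "continuous_on (cball 0 r) (eval_fps g)"
    by (intro continuous_on_eval_fps') (use rg in
      \<open>auto intro: le_less_trans[of _ "ereal r"] simp: eball_def\<close>)
  hence "bounded (eval_fps g ` cball 0 r)"
    by (intro compact_imp_bounded compact_continuous_image) auto
  then obtain M where M: "\<And>z. z \<in> cball 0 r \<Longrightarrow> norm (eval_fps g z) \<le> M"
    unfolding bounded_iff by blast
  have L0: "L \<ge> 0" using L[of 0] r(1) by (simp add: order_trans[OF norm_ge_zero])
  have M0: "M \<ge> 0" using M[of 0] r(1) by (simp add: order_trans[OF norm_ge_zero])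
  have Lip: "norm (eval_fps g z - eval_fps g w) \<le> L * norm (z - w)"
      if "z \<in> cball 0 r" "w \<in> cball 0 r" for z w
  proof (rule field_differentiable_bound[OF convex_cball _ _ that,
      where f' = "eval_fps (fps_deriv g)"])
    fix u :: complex assume "u \<in> cball 0 r"
    hence "norm u < fps_conv_radius g" using rg by (auto intro: le_less_trans[of _ "ereal r"])
    thus "(eval_fps g has_field_derivative eval_fps (fps_deriv g) u) (at u within cball 0 r)"
      by (rule has_field_derivative_eval_fps)
  qed (use L in blast)
  let ?t = "\<lambda>y::real. y powr (1 / of_nat N)"
  define \<epsilon> where "\<epsilon> = r ^ N"
  have ev: "puiseux_eval \<phi> y = eval_fps g (of_real (?t y)) * of_real y"
    and tN: "?t y ^ N = y" and tr: "?t y \<le> r" if "0 < y" "y < \<epsilon>" for y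
  proof -
    show tN: "?t y ^ N = y" using that N0 by (simp add: powr_power)
    have "?t y ^ N < r ^ N" unfolding tN \<epsilon>_def[symmetric] by (rule that)
    hence "?t y < r" by (rule power_less_imp_less_base) (use r in simp)
    thus "?t y \<le> r" by simp
    have *: "norm (of_real (?t y) :: complex) < fps_conv_radius f"
      by (rule less_trans[OF _ r(2)]) (use \<open>?t y < r\<close> in simp)
    have "puiseux_eval \<phi> y = eval_fps f (of_real (?t y))"
      unfolding f_def using * by (intro puiseux_eval_eq N that) (simp add: f_def)
    also have "\<dots> = eval_fps g (of_real (?t y)) * of_real (?t y) ^ N"
      unfolding fg using * by (subst eval_fps_mult) (auto simp: g_def)
    also have "of_real (?t y) ^ N = complex_of_real y" unfolding of_real_power[symmetric] tN ..
    finally show "puiseux_eval \<phi> y = eval_fps g (of_real (?t y)) * of_real y" .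
  qed
  have main: "norm (puiseux_eval \<phi> y - puiseux_eval \<phi> y') \<le> (M + L * r) * \<bar>y - y'\<bar>"
    if y: "0 < y'" "y' \<le> y" "y < \<epsilon>" for y y'
  proof -
    define t t' where "t = ?t y" and "t' = ?t y'"
    have t: "0 < t'" "t' \<le> t" "t \<le> r" "t ^ N = y" "t' ^ N = y'"
      using y tr[of y] tN[of y] tN[of y'] by (auto simp: t_def t'_def intro!: powr_mono2)
    \<comment> \<open>A lower bound for t^N - t'^N = y - y'. Multiplying it by t' \<le> r turns t'
      t'^(N-1) into y' and gives (t - t') y' \<le> r (y - y'), the control on the change of t that
      is needed.\<close>
    have "(t - t') * t ^ (N - 1) \<le> t ^ N - t' ^ N"
    proof -
      have "t' * t' ^ (N - 1) \<le> t' * t ^ (N - 1)" using t by (intro mult_left_mono power_mono) auto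
      moreover have "t ^ N = t * t ^ (N - 1)" "t' ^ N = t' * t' ^ (N - 1)"
        using power_minus_mult[OF N0, of t] power_minus_mult[OF N0, of t']
            by (simp_all only: mult.commute)
      ultimately show ?thesis by (simp only: left_diff_distrib)
    qed
    moreover have "t' ^ (N - 1) \<le> t ^ (N - 1)" using t by (intro power_mono) auto
    ultimately have "(t - t') * t' ^ (N - 1) \<le> y - y'"
      using mult_left_mono[of "t' ^ (N - 1)" "t ^ (N - 1)" "t - t'"] t by auto
    hence "t' * ((t - t') * t' ^ (N - 1)) \<le> r * (y - y')"
      using t y r by (intro mult_mono) auto
    moreover have "t' * ((t - t') * t' ^ (N - 1)) = (t - t') * y'"
      unfolding t(5)[symmetric] power_minus_mult[OF N0, of t', symmetric] by (simp only: mult_ac)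
    ultimately have key: "(t - t') * y' \<le> r * (y - y')" by (simp only:)
    have "puiseux_eval \<phi> y - puiseux_eval \<phi> y' =
       eval_fps g (of_real t) * of_real (y - y') + (eval_fps g (of_real t) - eval_fps g (of_real
           t')) * of_real y'"
      using y by (simp add: ev t_def t'_def algebra_simps)
    also have "norm \<dots> \<le> norm (eval_fps g (of_real t)) * \<bar>y - y'\<bar> + norm (eval_fps g (of_real t) -
        eval_fps g (of_real t')) * y'"
      using y by (intro order_trans[OF norm_triangle_ineq]) (simp add: norm_mult del: of_real_diff)
    also have "\<dots> \<le> M * \<bar>y - y'\<bar> + L * norm (of_real t - of_real t' :: complex) * y'"
      using t y by (intro add_mono mult_right_mono M Lip) auto
    also have "norm (of_real t - of_real t' :: complex) = t - t'"
      using t by (simp flip: of_real_diff)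
    also have "L * (t - t') * y' \<le> L * (r * \<bar>y - y'\<bar>)"
      using key L0 y unfolding mult.assoc by (intro mult_left_mono) auto
    finally show ?thesis by (simp add: algebra_simps)
  qed
  show ?thesis
  \<comment> \<open>M bounds g and L bounds its derivative on the disc of radius r; the summand 1
    makes the constant positive when both are 0.\<close>
  proof (rule that[of "M + L * r + 1" \<epsilon>])
    show "M + L * r + 1 > 0" using M0 L0 r by (simp add: add_nonneg_pos)
    show "\<epsilon> > 0" using r by (simp add: \<epsilon>_def)
    fix y y' assume y: "0 < y" "y < \<epsilon>" "0 < y'" "y' < \<epsilon>"
    have "norm (puiseux_eval \<phi> y - puiseux_eval \<phi> y') \<le> (M + L * r) * \<bar>y - y'\<bar>"
    proof (cases "y' \<le> y")
      case False
      thus ?thesis using main[of y y'] y by (simp add: norm_minus_commute abs_minus_commute)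
    qed (use main[of y' y] y in auto)
    thus "norm (puiseux_eval \<phi> y - puiseux_eval \<phi> y') \<le> (M + L * r + 1) * \<bar>y - y'\<bar>"
      by (rule order_trans) (intro mult_right_mono, auto)
  next
    fix y assume y: "0 < y" "y < \<epsilon>"
    have "norm (puiseux_eval \<phi> y) \<le> M * y"
      using ev[OF y] M[of "of_real (?t y)"] tr[OF y] y by (simp add: norm_mult mult_right_mono)
    also have "\<dots> \<le> (M + L * r + 1) * y" using y L0 r by (intro mult_right_mono) auto
    finally show "norm (puiseux_eval \<phi> y) \<le> (M + L * r + 1) * y" .
  qed
qed

section \<open>Newton--Puiseux roots\<close>

lemma puiseux_arc_tendsto:
  assumes "puiseux \<phi>"
  shows "((\<lambda>y. (puiseux_eval \<phi> y, complex_of_real y)) \<longlongrightarrow> (0, 0)) (at_right 0)"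
proof -
  obtain K \<epsilon> where K: "K > 0" "\<epsilon> > 0" "\<And>y. 0 < y \<Longrightarrow> y < \<epsilon> \<Longrightarrow> norm (puiseux_eval \<phi> y) \<le> K * y"
    by (rule puiseux_Lipschitz[OF assms]) blast
  have "\<forall>\<^sub>F y in at_right 0. norm (puiseux_eval \<phi> y) \<le> K * y"
    using eventually_at_right_real[OF K(2)] by eventually_elim (rule K(3), auto)
  moreover have "((\<lambda>y. K * y) \<longlongrightarrow> K * 0) (at_right 0)" by (intro tendsto_intros)
  hence "((\<lambda>y. K * y) \<longlongrightarrow> 0) (at_right 0)" unfolding mult_zero_right .
  ultimately have "((\<lambda>y. puiseux_eval \<phi> y) \<longlongrightarrow> 0) (at_right 0)"
    by (rule Lim_null_comparison)
  moreover have "((\<lambda>y. complex_of_real y) \<longlongrightarrow> of_real 0) (at_right 0)"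
    by (rule tendsto_of_real[OF tendsto_ident_at])
  ultimately show ?thesis unfolding of_real_0 by (rule tendsto_Pair)
qed

text \<open>Arcs of order at least 1 run into the origin, so an identity of germs can be read along
  an arc without keeping track of radii.\<close>

lemma eventually_arc:
  assumes "puiseux \<phi>" "\<forall>\<^sub>F (x, y) in nhds (0, 0). P x y"
  shows "\<forall>\<^sub>F y in at_right 0. P (puiseux_eval \<phi> y) (complex_of_real y)"
  using eventually_compose_filterlim[OF assms(2) puiseux_arc_tendsto[OF assms(1)]] by simp

definition vanishing_ideal :: "(rat \<Rightarrow> complex) \<Rightarrow> cps2 set" where
  "vanishing_ideal \<phi> = {A. \<forall>\<^sub>F y in at_right 0. eval2 A (puiseux_eval \<phi> y) (of_real y) = 0}"

lemma np_root_iff: "np_root F \<phi> \<longleftrightarrow> puiseux \<phi> \<and> F \<in> vanishing_ideal \<phi>"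
  by (simp add: np_root_def vanishing_ideal_def)

lemma vanishing_ideal_mult:
  assumes "puiseux \<phi>" "A \<in> vanishing_ideal \<phi>"
  shows "B * A \<in> vanishing_ideal \<phi>"
proof -
  have "\<forall>\<^sub>F y in at_right 0. eval2 (B * A) (puiseux_eval \<phi> y) (of_real y) =
      eval2 B (puiseux_eval \<phi> y) (of_real y) * eval2 A (puiseux_eval \<phi> y) (of_real y)"
    by (rule eventually_arc[OF assms(1) eventually_eval2_mult])
  with assms(2) show ?thesis unfolding vanishing_ideal_def mem_Collect_eq
    by eventually_elim simp
qed

text \<open>Saturation holds because the coordinate y is positive along the arc and can be cancelled
  from a vanishing product.\<close>

lemma y_saturated_vanishing_ideal:
  assumes "puiseux \<phi>"
  shows "y_saturated_ideal (vanishing_ideal \<phi>)"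
  unfolding y_saturated_ideal_def
proof (intro conjI ballI allI impI)
  fix A B assume AB: "A \<in> vanishing_ideal \<phi>" "B \<in> vanishing_ideal \<phi>"
  have "\<forall>\<^sub>F y in at_right 0. conv2 A (puiseux_eval \<phi> y) (complex_of_real y)"
    "\<forall>\<^sub>F y in at_right 0. conv2 B (puiseux_eval \<phi> y) (complex_of_real y)"
    by (rule eventually_arc[OF assms eventually_conv2])+
  with AB show "A - B \<in> vanishing_ideal \<phi>" unfolding vanishing_ideal_def mem_Collect_eq
    by eventually_elim (simp add: eval2_diff)
next
  show "B * A \<in> vanishing_ideal \<phi>" if "A \<in> vanishing_ideal \<phi>" for A B
    using assms that by (rule vanishing_ideal_mult)
next
  fix A assume *: "Y2 * A \<in> vanishing_ideal \<phi>"
  have "\<forall>\<^sub>F y in at_right 0. eval2 (Y2 * A) (puiseux_eval \<phi> y) (of_real y) =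
      eval2 Y2 (puiseux_eval \<phi> y) (of_real y) * eval2 A (puiseux_eval \<phi> y) (of_real y)"
    by (rule eventually_arc[OF assms eventually_eval2_mult])
  with * eventually_at_right_less[of 0] show "A \<in> vanishing_ideal \<phi>"
    unfolding vanishing_ideal_def mem_Collect_eq
    by eventually_elim (simp add: eval2_Y2)
qed

lemma np_root_dvd: "F dvd G \<Longrightarrow> np_root F \<phi> \<Longrightarrow> np_root G \<phi>"
  using vanishing_ideal_mult[of \<phi> F] by (auto simp: np_root_iff dvd_def mult.commute[of F])

text \<open>The chosen \<open>gcd2\<close> is known only through divisibility. The divisor H
  produced by the Euclidean algorithm divides it, and H vanishes along every arc on which F and G
  both vanish; hence so does \<open>gcd2\<close>.\<close>

lemma np_root_gcd2_iff:
  assumes "x_regular G n"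
  shows "np_root (gcd2 F G) \<phi> \<longleftrightarrow> np_root F \<phi> \<and> np_root G \<phi>"
proof -
  let ?P = "\<lambda>H. H dvd F \<and> H dvd G \<and> (\<forall>D. D dvd F \<longrightarrow> D dvd G \<longrightarrow> D dvd H)"
  obtain H where H: "?P H" and I: "\<forall>I. y_saturated_ideal I \<longrightarrow> F \<in> I \<longrightarrow> G \<in> I \<longrightarrow> H \<in> I"
    using gcd2_exists[OF assms, of F] by blast
  from H have *: "?P (gcd2 F G)" unfolding gcd2_def by (rule someI)
  have dvd: "H dvd gcd2 F G" using conjunct2[OF conjunct2[OF *]] H by simp
  show ?thesis
  proof
    assume "np_root (gcd2 F G) \<phi>"
    thus "np_root F \<phi> \<and> np_root G \<phi>"
        using np_root_dvd[OF conjunct1[OF *]] np_root_dvd[OF conjunct1[OF conjunct2[OF *]]] by simp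
  next
    assume R: "np_root F \<phi> \<and> np_root G \<phi>"
    hence \<phi>: "puiseux \<phi>" by (simp add: np_root_iff)
    have "H \<in> vanishing_ideal \<phi>"
      using I y_saturated_vanishing_ideal[OF \<phi>] R by (simp add: np_root_iff)
    hence "np_root H \<phi>" using \<phi> by (simp add: np_root_iff)
    thus "np_root (gcd2 F G) \<phi>" by (rule np_root_dvd[OF dvd])
  qed
qed

lemma real_np_roots_gcd2:
  assumes "x_regular G n"
  shows "real_np_roots (gcd2 F G) = real_np_roots F \<inter> real_np_roots G"
  unfolding real_np_roots_def using np_root_gcd2_iff[OF assms] by auto

section \<open>Finiteness of the set of Newton-Puiseux roots\<close>

lemma card_monic_poly_roots_le:
  fixes a :: "nat \<Rightarrow> 'a::field"
  assumes "finite S" "\<And>x. x \<in> S \<Longrightarrow> x ^ m + (\<Sum>i<m. a i * x ^ i) = 0"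
  shows "card S \<le> m"
proof -
  define p where "p = monom 1 m + (\<Sum>i<m. monom (a i) i)"
  have c: "coeff p m = 1" by (auto simp: p_def coeff_sum intro!: sum.neutral)
  hence "p \<noteq> 0" by auto
  have "degree p \<le> m"
    unfolding p_def by (intro degree_add_le degree_sum_le degree_monom_le) (auto intro:
        order_trans[OF degree_monom_le])
  have "S \<subseteq> {x. poly p x = 0}" using assms(2) by (auto simp: p_def poly_monom poly_sum)
  hence "card S \<le> card {x. poly p x = 0}" using poly_roots_finite[OF \<open>p \<noteq> 0\<close>]
      by (rule card_mono[rotated])
  also have "\<dots> \<le> degree p" using \<open>p \<noteq> 0\<close> by (rule card_poly_roots_bound)
  finally show ?thesis using \<open>degree p \<le> m\<close> by simp
qed

lemma eventually_eval2_monic: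
  assumes "\<And>i j. i > m \<Longrightarrow> coeff2 P i j = 0" "\<And>j. coeff2 P m j = (if j = 0 then 1 else 0)"
  shows "\<forall>\<^sub>F (x, y) in nhds (0::'a::{banach, real_normed_field}, 0).
    eval2 P x y = x ^ m + (\<Sum>i<m. eval_fps (x_coeff P i) y * x ^ i)"
proof -
  have "x_coeff P m = (1 :: 'a fps)" by (auto simp: x_coeff_def fps_eq_iff assms(2))
  moreover have "coeff2 P i j = 0" if "i \<ge> Suc m" for i j using that assms(1) by simp
  hence "\<forall>\<^sub>F (x, y) in nhds (0::'a, 0). eval2 P x y = (\<Sum>i<Suc m. eval_fps (x_coeff P i) y * x ^ i)"
    by (rule eventually_eval2_eq_sum)
  ultimately show ?thesis by (simp add: add.commute)
qed

text \<open>Distinct Puiseux series take distinct values for small y > 0. More than m roots would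
  thus give, at one such y, more than m zeros of the monic Weierstrass polynomial of degree
  m.\<close>

lemma finite_np_roots:
  assumes "x_regular F m"
  shows "finite {\<phi>. np_root F \<phi>}"
proof (rule ccontr)
  assume "infinite {\<phi>. np_root F \<phi>}"
  then obtain S where S: "S \<subseteq> {\<phi>. np_root F \<phi>}" "finite S" "card S = Suc m"
    using infinite_arbitrarily_large by blast
  obtain U V P where U: "U * V = 1" "U * F = P" and
    P: "\<And>i j. i > m \<Longrightarrow> coeff2 P i j = 0" "\<And>j. coeff2 P m j = (if j = 0 then 1 else 0)"
    by (rule weierstrass_preparation[OF assms]) blast
  have "\<forall>\<^sub>F y in at_right 0. (puiseux_eval \<phi> y) ^ m + (\<Sum>i<m. eval_fps (x_coeff P i) (of_real y) *
      (puiseux_eval \<phi> y) ^ i) = 0"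
    if "\<phi> \<in> S" for \<phi>
  proof -
    have \<phi>: "puiseux \<phi>" "F \<in> vanishing_ideal \<phi>" using that S by (auto simp: np_root_iff)
    hence "P \<in> vanishing_ideal \<phi>" unfolding U(2)[symmetric] by (rule vanishing_ideal_mult)
    moreover have "\<forall>\<^sub>F (x, y) in nhds (0::complex, 0). eval2 P x y =
        x ^ m + (\<Sum>i<m. eval_fps (x_coeff P i) y * x ^ i)"
      using P by (rule eventually_eval2_monic)
    note eventually_arc[OF \<phi>(1) this]
    ultimately show ?thesis
      unfolding vanishing_ideal_def mem_Collect_eq by eventually_elim simp
  qed
  hence "\<forall>\<^sub>F y in at_right 0. \<forall>\<phi>\<in>S. (puiseux_eval \<phi> y) ^ m + (\<Sum>i<m. eval_fps (x_coeff P i) (of_real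
      y) * (puiseux_eval \<phi> y) ^ i) = 0"
    using S(2) by (simp add: eventually_ball_finite_distrib)
  moreover have "\<forall>\<^sub>F y in at_right 0. \<forall>\<phi>\<in>S. \<forall>\<psi>\<in>S. \<phi> \<noteq> \<psi> \<longrightarrow> puiseux_eval \<phi> y \<noteq> puiseux_eval \<psi> y"
  proof (intro eventually_ball_finite S(2) ballI)
    fix \<phi> \<psi> assume "\<phi> \<in> S" "\<psi> \<in> S"
    hence "puiseux \<phi>" "puiseux \<psi>" using S(1) by (auto simp: np_root_iff)
    thus "\<forall>\<^sub>F y in at_right 0. \<phi> \<noteq> \<psi> \<longrightarrow> puiseux_eval \<phi> y \<noteq> puiseux_eval \<psi> y"
      using eventually_puiseux_eval_neq by (cases "\<phi> = \<psi>") auto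
  qed
  ultimately have "\<forall>\<^sub>F y in at_right (0::real). False"
  proof eventually_elim
    case (elim y)
    have "inj_on (\<lambda>\<phi>. puiseux_eval \<phi> y) S" using elim(2) by (auto simp: inj_on_def)
    hence "card ((\<lambda>\<phi>. puiseux_eval \<phi> y) ` S) = Suc m" using S(3) by (simp add: card_image)
    moreover have "card ((\<lambda>\<phi>. puiseux_eval \<phi> y) ` S) \<le> m"
      using S(2) elim(1) by (intro card_monic_poly_roots_le[where a =
          "\<lambda>i. eval_fps (x_coeff P i) (of_real y)"]) auto
    ultimately show False by simp
  qed
  thus False by simp
qed

section \<open>Real Puiseux series\<close>

definition real_arc :: "(rat \<Rightarrow> complex) \<Rightarrow> real \<Rightarrow> real" where
  "real_arc \<phi> y = Re (puiseux_eval \<phi> y)"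

lemma puiseux_eval_real:
  assumes "puiseux_real \<phi>"
  shows "puiseux_eval \<phi> y = of_real (real_arc \<phi> y)"
proof -
  have "infsum (\<lambda>q. \<phi> q * of_real (y powr of_rat q)) UNIV \<in> \<real>"
  proof (cases "(\<lambda>q. \<phi> q * of_real (y powr of_rat q)) summable_on UNIV")
    case True
    have "((\<lambda>q. Im (\<phi> q * of_real (y powr of_rat q))) has_sum Im (infsum (\<lambda>q. \<phi> q * of_real (y powr
        of_rat q)) UNIV)) UNIV"
      using has_sum_bounded_linear[OF bounded_linear_Im has_sum_infsum[OF True]]
          by (simp add: o_def)
    moreover have "Im (\<phi> q * of_real (y powr of_rat q)) = 0" for q
      using assms by (simp add: puiseux_real_def complex_is_Real_iff)
    ultimately have "((\<lambda>q::rat. 0) has_sum Im (infsum (\<lambda>q. \<phi> q * of_real (y powr of_rat q)) UNIV))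
        UNIV"
      by (simp only:)
    hence "Im (infsum (\<lambda>q. \<phi> q * of_real (y powr of_rat q)) UNIV) = 0"
      by (metis has_sum_0 has_sum_unique)
    thus ?thesis by (simp add: complex_is_Real_iff)
  qed (simp add: infsum_not_exists)
  thus ?thesis by (simp add: puiseux_eval_def real_arc_def complex_is_Real_iff complex_eq_iff)
qed

lemma real_arc_tendsto:
  assumes "puiseux \<phi>"
  shows "((\<lambda>y. (real_arc \<phi> y, y)) \<longlongrightarrow> (0, 0)) (at_right 0)"
  using tendsto_Re[OF tendsto_fst[OF puiseux_arc_tendsto[OF assms]]] tendsto_ident_at[of 0 "{0<..}"]
  by (auto simp: real_arc_def intro: tendsto_Pair)

lemma eventually_real_arc:
  assumes "puiseux \<phi>" "\<forall>\<^sub>F (x, y) in nhds (0, 0). P x y"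
  shows "\<forall>\<^sub>F y in at_right 0. P (real_arc \<phi> y) y"
  using eventually_compose_filterlim[OF assms(2) real_arc_tendsto[OF assms(1)]] by simp

lemma np_root_real_iff:
  assumes "puiseux \<phi>" "puiseux_real \<phi>"
  shows "np_root F \<phi> \<longleftrightarrow> (\<forall>\<^sub>F y in at_right 0. eval2 F (real_arc \<phi> y) y = 0)"
proof -
  have "\<forall>\<^sub>F y in at_right 0. conv2 F (real_arc \<phi> y) y"
    by (rule eventually_real_arc[OF assms(1) eventually_conv2])
  hence "\<forall>\<^sub>F y in at_right 0. eval2 F (puiseux_eval \<phi> y) (of_real y) = 0 \<longleftrightarrow>
      eval2 F (real_arc \<phi> y) y = 0"
    by eventually_elim (simp add: puiseux_eval_real[OF assms(2)] eval2_of_real)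
  hence "(\<forall>\<^sub>F y in at_right 0. eval2 F (puiseux_eval \<phi> y) (of_real y) = 0) \<longleftrightarrow>
    (\<forall>\<^sub>F y in at_right 0. eval2 F (real_arc \<phi> y) y = 0)"
    by (rule eventually_subst)
  thus ?thesis using assms(1) by (simp add: np_root_def)
qed

lemma real_arc_asymptotics:
  assumes "puiseux \<phi>" "puiseux \<psi>" "puiseux_real \<phi>" "puiseux_real \<psi>"
    "puiseux_ord (\<lambda>q. \<phi> q - \<psi> q) = ereal (of_rat \<rho>)"
  obtains c C where "c > 0" "C > 0"
    "\<forall>\<^sub>F y in at_right 0. c * y powr of_rat \<rho> \<le> \<bar>real_arc \<phi> y - real_arc \<psi> y\<bar> \<and>
       \<bar>real_arc \<phi> y - real_arc \<psi> y\<bar> \<le> C * y powr of_rat \<rho>"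
proof -
  have diff: "puiseux (\<lambda>q. \<phi> q - \<psi> q)" by (rule puiseux_diff[OF assms(1,2)])
  obtain c C where cC: "c > 0" "C > 0" "\<forall>\<^sub>F y in at_right 0. c * y powr of_rat \<rho> \<le>
      norm (puiseux_eval (\<lambda>q. \<phi> q - \<psi> q) y) \<and>
      norm (puiseux_eval (\<lambda>q. \<phi> q - \<psi> q) y) \<le> C * y powr of_rat \<rho>"
    by (rule puiseux_asymptotics[OF diff assms(5)]) blast
  from cC(3) eventually_puiseux_eval_diff[OF assms(1,2)]
  have "\<forall>\<^sub>F y in at_right 0. c * y powr of_rat \<rho> \<le> \<bar>real_arc \<phi> y - real_arc \<psi> y\<bar> \<and>
       \<bar>real_arc \<phi> y - real_arc \<psi> y\<bar> \<le> C * y powr of_rat \<rho>"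
    by eventually_elim (simp add: puiseux_eval_real assms(3,4) flip: of_real_diff)
  with cC(1,2) show ?thesis by (rule that)
qed

lemma real_arc_Lipschitz:
  assumes "puiseux \<phi>"
  obtains K \<epsilon> where "K > 0" "\<epsilon> > 0"
    "\<And>y y'. 0 < y \<Longrightarrow> y < \<epsilon> \<Longrightarrow> 0 < y' \<Longrightarrow> y' < \<epsilon> \<Longrightarrow>
       \<bar>real_arc \<phi> y - real_arc \<phi> y'\<bar> \<le> K * \<bar>y - y'\<bar>"
    "\<And>y. 0 < y \<Longrightarrow> y < \<epsilon> \<Longrightarrow> \<bar>real_arc \<phi> y\<bar> \<le> K * y"
proof -
  obtain K \<epsilon> where *: "K > 0" "\<epsilon> > 0"
    "\<And>y y'. 0 < y \<Longrightarrow> y < \<epsilon> \<Longrightarrow> 0 < y' \<Longrightarrow> y' < \<epsilon> \<Longrightarrow>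
       norm (puiseux_eval \<phi> y - puiseux_eval \<phi> y') \<le> K * \<bar>y - y'\<bar>"
    "\<And>y. 0 < y \<Longrightarrow> y < \<epsilon> \<Longrightarrow> norm (puiseux_eval \<phi> y) \<le> K * y"
    by (rule puiseux_Lipschitz[OF assms]) blast
  show ?thesis
  proof (rule that[OF *(1,2)])
    show "\<bar>real_arc \<phi> y - real_arc \<phi> y'\<bar> \<le> K * \<bar>y - y'\<bar>" if "0 < y" "y < \<epsilon>" "0 < y'" "y' < \<epsilon>"
        for y y'
      using *(3)[OF that] abs_Re_le_cmod[of "puiseux_eval \<phi> y - puiseux_eval \<phi> y'"]
      by (simp add: real_arc_def)
    show "\<bar>real_arc \<phi> y\<bar> \<le> K * y" if "0 < y" "y < \<epsilon>" for y
      using *(4)[OF that] abs_Re_le_cmod[of "puiseux_eval \<phi> y"] by (simp add: real_arc_def)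
  qed
qed

section \<open>Real zeros lie on finitely many Puiseux arcs\<close>

text \<open>Analytic germs in one variable are kept as functions, for which sums, products and
  substitutions are immediate. An expansion is chosen only where an order of vanishing
  matters.\<close>

definition germ1 :: "(real \<Rightarrow> real) \<Rightarrow> bool" where
  "germ1 f \<longleftrightarrow> (\<exists>A. f has_fps_expansion A)"

lemma germ1_const [simp]: "germ1 (\<lambda>_. c)"
  unfolding germ1_def using has_fps_expansion_const by blast

lemma germ1_power_id [simp]: "germ1 (\<lambda>t. t ^ n)"
  unfolding germ1_def using has_fps_expansion_fps_X_power by blast

lemma germ1_add: "germ1 f \<Longrightarrow> germ1 g \<Longrightarrow> germ1 (\<lambda>t. f t + g t)"
  unfolding germ1_def using has_fps_expansion_add by blast

lemma germ1_mult: "germ1 f \<Longrightarrow> germ1 g \<Longrightarrow> germ1 (\<lambda>t. f t * g t)"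
  unfolding germ1_def using has_fps_expansion_mult by blast

lemma germ1_power: "germ1 f \<Longrightarrow> germ1 (\<lambda>t. f t ^ n)"
  by (induction n) (simp_all add: germ1_mult)

lemma germ1_sum: "(\<And>i. i \<in> I \<Longrightarrow> germ1 (f i)) \<Longrightarrow> germ1 (\<lambda>t. \<Sum>i\<in>I. f i t)"
  by (induction I rule: infinite_finite_induct) (simp_all add: germ1_add)

lemma has_fps_expansion_compose_power:
  fixes f :: "real \<Rightarrow> real"
  assumes f: "f has_fps_expansion A" and q: "q > 0"
  defines "B \<equiv> Abs_fps (\<lambda>n. if q dvd n then fps_nth A (n div q) else 0)"
  shows "(\<lambda>t. f (t ^ q)) has_fps_expansion B"
proof -
  have A: "fps_conv_radius A > 0" "\<forall>\<^sub>F t in nhds 0. eval_fps A t = f t"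
    using f by (auto simp: has_fps_expansion_def)
  obtain C R where CR: "R > 0" "\<And>n. norm (fps_nth A n) \<le> C * R ^ n"
    using A(1) unfolding fps_conv_radius_pos_iff by blast
  have C: "C \<ge> 0" using CR(2)[of 0] by (simp add: order_trans[OF norm_ge_zero])
  \<comment> \<open>The coefficient of index k moves to q k, so a base of at least 1 keeps the
    geometric bound.\<close>
  define S where "S = max 1 R"
  have "norm (fps_nth B n) \<le> C * S ^ n" for n
  proof (cases "q dvd n")
    case True
    have "norm (fps_nth B n) \<le> C * R ^ (n div q)" using True CR(2) by (simp add: B_def)
    also have "\<dots> \<le> C * S ^ (n div q)" using C CR
        by (intro mult_left_mono power_mono) (auto simp: S_def)
    also have "\<dots> \<le> C * S ^ n" using C by (intro mult_left_mono power_increasing) (auto simp: S_def)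
    finally show ?thesis .
  qed (use C in \<open>simp add: B_def S_def\<close>)
  hence B: "fps_conv_radius B > 0"
    unfolding fps_conv_radius_pos_iff by (intro exI[of _ C] exI[of _ S]) (auto simp: S_def)
  have near: "\<forall>\<^sub>F t in nhds (0::real). ereal (norm t) < fps_conv_radius D"
      if D: "fps_conv_radius D > 0" for D :: "real fps"
  proof -
    have "open (eball 0 (fps_conv_radius D) :: real set)" "0 \<in> eball (0::real) (fps_conv_radius D)"
      using D by (auto simp: zero_ereal_def)
    from eventually_nhds_in_open[OF this] show ?thesis by eventually_elim (simp add: dist_norm)
  qed
  have lim: "filterlim (\<lambda>t::real. t ^ q) (nhds 0) (nhds 0)"
  proof -
    have "((\<lambda>t::real. t ^ q) \<longlongrightarrow> 0 ^ q) (nhds 0)" by (intro tendsto_power filterlim_ident)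
    moreover have "(0::real) ^ q = 0" using q by simp
    ultimately show ?thesis by (simp only:)
  qed
  from near[OF B] eventually_compose_filterlim[OF near[OF A(1)] lim] eventually_compose_filterlim[OF
      A(2) lim]
  have "\<forall>\<^sub>F t in nhds 0. eval_fps B t = f (t ^ q)"
  proof eventually_elim
    case (elim t)
    have inj: "inj (\<lambda>n::nat. q * n)" using q by (auto simp: inj_on_def)
    have "((\<lambda>n. fps_nth B n * t ^ n) has_sum eval_fps B t) UNIV"
      by (rule has_sum_eval_fps) (use elim in simp)
    also have "?this \<longleftrightarrow> ((\<lambda>n. fps_nth B n * t ^ n) has_sum eval_fps B t) (range (\<lambda>n. q * n))"
      by (rule has_sum_cong_neutral) (auto simp: B_def elim!: dvdE)
    also have "\<dots> \<longleftrightarrow> ((\<lambda>n. fps_nth A n * (t ^ q) ^ n) has_sum eval_fps B t) UNIV"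
      using q by (subst has_sum_reindex[OF inj]) (simp add: o_def B_def power_mult)
    finally have "((\<lambda>n. fps_nth A n * (t ^ q) ^ n) has_sum eval_fps B t) UNIV" .
    moreover have "((\<lambda>n. fps_nth A n * (t ^ q) ^ n) has_sum eval_fps A (t ^ q)) UNIV"
      by (rule has_sum_eval_fps) (use elim in simp)
    ultimately have "eval_fps B t = eval_fps A (t ^ q)" by (rule has_sum_unique)
    thus ?case using elim by simp
  qed
  thus ?thesis using B by (simp add: has_fps_expansion_def)
qed

lemma germ1_compose_power: "germ1 f \<Longrightarrow> q > 0 \<Longrightarrow> germ1 (\<lambda>t. f (t ^ q))"
  unfolding germ1_def using has_fps_expansion_compose_power by blast

text \<open>Only containment is demanded: the arcs may leave the zero set, and they need be neither
  distinct nor pass through the origin. This keeps the notion monotone and stable under finite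
  unions, which the compactness argument below relies on.\<close>

definition puiseux_cover :: "(real \<Rightarrow> real \<Rightarrow> bool) \<Rightarrow> bool" where
  "puiseux_cover Z \<longleftrightarrow> (\<exists>S. finite S \<and> (\<forall>(N, s)\<in>S. N > 0 \<and> germ1 s) \<and>
     (\<forall>\<^sub>F t in at_right 0. \<forall>x. Z t x \<longrightarrow> (\<exists>(N, s)\<in>S. x = s (t powr (1 / real N)))))"

lemma puiseux_cover_mono:
  assumes "puiseux_cover Z'" "\<forall>\<^sub>F t in at_right 0. \<forall>x. Z t x \<longrightarrow> Z' t x"
  shows "puiseux_cover Z"
proof -
  obtain S where S: "finite S" "\<forall>(N, s)\<in>S. N > 0 \<and> germ1 s"
    "\<forall>\<^sub>F t in at_right 0. \<forall>x. Z' t x \<longrightarrow> (\<exists>(N, s)\<in>S. x = s (t powr (1 / real N)))"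
    using assms(1) unfolding puiseux_cover_def by blast
  have "\<forall>\<^sub>F t in at_right 0. \<forall>x. Z t x \<longrightarrow> (\<exists>(N, s)\<in>S. x = s (t powr (1 / real N)))"
    using S(3) assms(2) by eventually_elim blast
  thus ?thesis using S unfolding puiseux_cover_def by blast
qed

lemma puiseux_cover_False: "puiseux_cover (\<lambda>t x. False)"
  unfolding puiseux_cover_def by (rule exI[of _ "{}"]) auto

lemma puiseux_cover_disj:
  assumes "puiseux_cover Z" "puiseux_cover Z'"
  shows "puiseux_cover (\<lambda>t x. Z t x \<or> Z' t x)"
proof -
  obtain S where S: "finite S" "\<forall>(N, s)\<in>S. N > 0 \<and> germ1 s"
    "\<forall>\<^sub>F t in at_right 0. \<forall>x. Z t x \<longrightarrow> (\<exists>(N, s)\<in>S. x = s (t powr (1 / real N)))"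
    using assms(1) unfolding puiseux_cover_def by blast
  obtain S' where S': "finite S'" "\<forall>(N, s)\<in>S'. N > 0 \<and> germ1 s"
    "\<forall>\<^sub>F t in at_right 0. \<forall>x. Z' t x \<longrightarrow> (\<exists>(N, s)\<in>S'. x = s (t powr (1 / real N)))"
    using assms(2) unfolding puiseux_cover_def by blast
  have "\<forall>\<^sub>F t in at_right 0. \<forall>x. Z t x \<or> Z' t x \<longrightarrow> (\<exists>(N, s)\<in>S \<union> S'. x = s (t powr (1 / real N)))"
    using S(3) S'(3) by eventually_elim blast
  moreover have "finite (S \<union> S')" "\<forall>(N, s)\<in>S \<union> S'. N > 0 \<and> germ1 s" using S S' by auto
  ultimately show ?thesis unfolding puiseux_cover_def by blast
qed

lemma puiseux_cover_Bex:
  assumes "finite I" "\<And>i. i \<in> I \<Longrightarrow> puiseux_cover (Z i)"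
  shows "puiseux_cover (\<lambda>t x. \<exists>i\<in>I. Z i t x)"
  using assms
proof (induction I rule: finite_induct)
  case empty
  thus ?case using puiseux_cover_False by simp
next
  case (insert i I)
  hence "puiseux_cover (\<lambda>t x. Z i t x \<or> (\<exists>i\<in>I. Z i t x))" by (intro puiseux_cover_disj) auto
  thus ?case by simp
qed

lemma root_at_right_0:
  assumes "q > 0"
  shows "filterlim (\<lambda>t::real. t powr (1 / real q)) (at_right 0) (at_right 0)"
proof -
  have "\<forall>\<^sub>F t in at_right (0::real). t powr (1 / real q) > 0"
    using eventually_at_right_less[of 0] by eventually_elim simp
  thus ?thesis using root_tendsto_0[OF assms]
    by (auto simp: filterlim_at elim: eventually_mono)
qed

text \<open>
  Substituting \<open>x = c(t) + \<tau>^p x'\<close> with \<open>t = \<tau>^q\<close>: an arc \<open>x' = s(\<tau>^(1/N))\<close>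
  becomes an arc in \<open>u = t^(1/(q N))\<close>.
\<close>

lemma puiseux_cover_transform:
  assumes cover: "puiseux_cover Z'" and c: "germ1 c" and q: "q > 0"
    and Z: "\<forall>\<^sub>F t in at_right 0. \<forall>x. Z t x \<longrightarrow>
      (\<exists>x'. Z' (t powr (1 / real q)) x' \<and> x = c t + (t powr (1 / real q)) ^ p * x')"
  shows "puiseux_cover Z"
proof -
  obtain S where S: "finite S" "\<forall>(N, s)\<in>S. N > 0 \<and> germ1 s"
    "\<forall>\<^sub>F t in at_right 0. \<forall>x. Z' t x \<longrightarrow> (\<exists>(N, s)\<in>S. x = s (t powr (1 / real N)))"
    using cover unfolding puiseux_cover_def by blast
  define h where "h = (\<lambda>(N, s). (q * N, \<lambda>u::real. c (u ^ (q * N)) + u ^ (N * p) * s u))"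
  have "finite (h ` S)" using S(1) by simp
  moreover have "\<forall>(N, s)\<in>h ` S. N > 0 \<and> germ1 s"
  proof
    fix z assume "z \<in> h ` S"
    then obtain N s where Ns: "(N, s) \<in> S" "z = h (N, s)" by auto
    hence "N > 0" "germ1 s" using S(2) by auto
    moreover from this have "germ1 (\<lambda>u. c (u ^ (q * N)) + u ^ (N * p) * s u)"
      using q by (intro germ1_add germ1_mult germ1_compose_power[OF c]) auto
    ultimately show "case z of (N, s) \<Rightarrow> N > 0 \<and> germ1 s" using q Ns(2) by (simp add: h_def)
  qed
  moreover have "\<forall>\<^sub>F t in at_right 0. \<forall>x. Z t x \<longrightarrow> (\<exists>(N, s)\<in>h ` S. x = s (t powr (1 / real N)))"
    using Z eventually_compose_filterlim[OF S(3) root_at_right_0[OF q]] eventually_at_right_less[of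
        0]
  proof eventually_elim
    case (elim t)
    show ?case
    proof (intro allI impI)
      fix x assume "Z t x"
      then obtain x' where x': "Z' (t powr (1 / real q)) x'" "x =
          c t + (t powr (1 / real q)) ^ p * x'"
        using elim(1) by blast
      then obtain N s where Ns: "(N, s) \<in> S" "x' = s ((t powr (1 / real q)) powr (1 / real N))"
        using elim(2) by blast
      have N: "N > 0" using Ns(1) S(2) by auto
      define u where "u = t powr (1 / real (q * N))"
      have E1: "(t powr (1 / real q)) powr (1 / real N) = u" by (simp add: u_def powr_powr)
      have E2: "u ^ (q * N) = t" using elim(3) q N by (simp add: u_def powr_power)
      have E3: "u ^ (N * p) = (t powr (1 / real q)) ^ p"
        using elim(3) q N by (simp add: u_def powr_power)
      have "x = c (u ^ (q * N)) + u ^ (N * p) * s u" unfolding E2 E3 x'(2) Ns(2) E1 ..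
      moreover have "h (N, s) = (q * N, \<lambda>u. c (u ^ (q * N)) + u ^ (N * p) * s u)"
        unfolding h_def prod.case ..
      ultimately have "case h (N, s) of (N, s) \<Rightarrow> x = s (t powr (1 / real N))"
        unfolding u_def by (simp only: prod.case)
      thus "\<exists>(N, s)\<in>h ` S. x = s (t powr (1 / real N))"
        using imageI[OF Ns(1)] by (rule bexI)
    qed
  qed
  ultimately show ?thesis unfolding puiseux_cover_def by blast
qed

text \<open>A polynomial in x with analytic coefficients in t, re-expanded about any point of the
  line t = 0, becomes an element of R{x,t}, so Weierstrass preparation applies there.\<close>

lemma cps2_of_germs:
  assumes "\<And>j. j \<le> n \<Longrightarrow> germ1 (e j)"
  obtains F where "\<And>j. j \<le> n \<Longrightarrow> coeff2 F j 0 = e j 0"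
    "\<forall>\<^sub>F (x, t) in nhds (0, 0). eval2 F x t = (\<Sum>j\<le>n. e j t * x ^ j)"
proof -
  define E where "E j = (SOME A. e j has_fps_expansion A)" for j
  have E: "e j has_fps_expansion E j" if "j \<le> n" for j
    using assms[OF that] unfolding germ1_def E_def by (rule someI_ex)
  have "\<forall>j. \<exists>C R. j \<le> n \<longrightarrow> R > 0 \<and> (\<forall>i. norm (fps_nth (E j) i) \<le> C * R ^ i)"
  proof
    fix j
    show "\<exists>C R. j \<le> n \<longrightarrow> R > 0 \<and> (\<forall>i. norm (fps_nth (E j) i) \<le> C * R ^ i)"
    proof (cases "j \<le> n")
      case True
      hence "fps_conv_radius (E j) > 0" using E by (simp add: has_fps_expansion_def)
      thus ?thesis unfolding fps_conv_radius_pos_iff using True by simp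
    qed simp
  qed
  then obtain C where "\<forall>j. \<exists>R. j \<le> n \<longrightarrow> R > 0 \<and> (\<forall>i. norm (fps_nth (E j) i) \<le> C j * R ^ i)"
    by (rule choice[THEN exE])
  then obtain R where "\<forall>j. j \<le> n \<longrightarrow> R j > 0 \<and> (\<forall>i. norm (fps_nth (E j) i) \<le> C j * R j ^ i)"
    by (rule choice[THEN exE])
  hence CR: "\<And>j. j \<le> n \<Longrightarrow> R j > 0" "\<And>j i. j \<le> n \<Longrightarrow> norm (fps_nth (E j) i) \<le> C j * R j ^ i"
    by simp_all
  \<comment> \<open>The finitely many coefficient germs have separate geometric bounds; D and T
    dominate all of them at once, and T \<ge> 1 absorbs the extra power T^j.\<close>
  define D where "D = (\<Sum>j\<le>n. \<bar>C j\<bar>)"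
  define T where "T = 1 + (\<Sum>j\<le>n. R j)"
  have "(\<Sum>j\<le>n. R j) \<ge> 0" using CR(1) by (intro sum_nonneg) (simp add: less_imp_le)
  hence T: "T \<ge> 1" by (simp add: T_def)
  have D: "D \<ge> 0" by (auto simp: D_def)
  define a where "a = (\<lambda>j i. if j \<le> n then fps_nth (E j) i else 0)"
  have "\<bar>a j i\<bar> \<le> D * T ^ (j + i)" for j i
  proof (cases "j \<le> n")
    case True
    have "R j \<le> (\<Sum>j\<le>n. R j)" using True CR(1) by (intro member_le_sum) (auto intro: less_imp_le)
    moreover have "\<bar>C j\<bar> \<le> D" unfolding D_def using True by (intro member_le_sum) auto
    ultimately have "R j \<le> T" "C j \<le> D" by (auto simp: T_def)
    have "\<bar>a j i\<bar> \<le> C j * R j ^ i" using True CR(2)[of j i] by (simp add: a_def)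
    also have "\<dots> \<le> D * T ^ i"
      using \<open>R j \<le> T\<close> \<open>C j \<le> D\<close> CR(1)[OF True] D by (intro mult_mono power_mono) auto
    also have "\<dots> \<le> D * T ^ (j + i)" using D T by (intro mult_left_mono power_increasing) auto
    finally show ?thesis .
  qed (use D T in \<open>simp add: a_def\<close>)
  then obtain F where F: "\<And>j i. coeff2 F j i = a j i"
    by (rule cps2_of_coeffs[of a D T]) (use T in auto)
  show ?thesis
  proof (rule that)
    show "coeff2 F j 0 = e j 0" if "j \<le> n" for j
    proof -
      have "eval_fps (E j) 0 = e j 0"
        using E[OF that] eventually_nhds_x_imp_x[of "\<lambda>z. eval_fps (E j) z = e j z"]
        by (simp add: has_fps_expansion_def)
      thus ?thesis using that by (simp add: F a_def eval_fps_at_0)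
    qed
    have "coeff2 F j i = 0" if "j \<ge> Suc n" for j i using that by (simp add: F a_def)
    hence "\<forall>\<^sub>F (x::real, t) in nhds (0, 0). eval2 F x t =
        (\<Sum>j<Suc n. eval_fps (x_coeff F j) t * x ^ j)"
      by (rule eventually_eval2_eq_sum)
    moreover have "\<forall>\<^sub>F t in nhds 0. \<forall>j\<in>{..n}. eval_fps (x_coeff F j) t = e j t"
    proof (rule eventually_ball_finite)
      show "\<forall>j\<in>{..n}. \<forall>\<^sub>F t in nhds 0. eval_fps (x_coeff F j) t = e j t"
      proof
        fix j assume j: "j \<in> {..n}"
        have "x_coeff F j = E j" using j by (simp add: x_coeff_def F a_def fps_eq_iff)
        thus "\<forall>\<^sub>F t in nhds 0. eval_fps (x_coeff F j) t = e j t"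
          using E[of j] j by (simp add: has_fps_expansion_def)
      qed
    qed auto
    moreover have lim: "filterlim snd (nhds 0) (nhds (0::real, 0::real))"
      using tendsto_snd[OF filterlim_ident[of "nhds (0::real, 0::real)"]] by simp
    ultimately have "\<forall>\<^sub>F (x::real, t) in nhds (0, 0). eval2 F x t =
        (\<Sum>j<Suc n. eval_fps (x_coeff F j) t * x ^ j)"
      and "\<forall>\<^sub>F p in nhds (0::real, 0). \<forall>j\<in>{..n}. eval_fps (x_coeff F j) (snd p) = e j (snd p)"
      using eventually_compose_filterlim[OF _ lim] by simp_all
    thus "\<forall>\<^sub>F (x, t) in nhds (0, 0). eval2 F x t = (\<Sum>j\<le>n. e j t * x ^ j)"
      by eventually_elim (auto simp: lessThan_Suc_atMost)
  qed
qed

text \<open>By preparation the zeros of F near the origin are zeros of a monic polynomial of degree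
  k, to which the induction hypothesis applies. The bound on |x| records the neighbourhood on which
  the two agree; it does not shrink with t.\<close>

lemma puiseux_cover_x_regular:
  assumes F: "x_regular F k"
    and IH: "\<And>a. (\<And>i. i < k \<Longrightarrow> germ1 (a i)) \<Longrightarrow> puiseux_cover (\<lambda>t x. x ^ k + (\<Sum>i<k. a i t * x ^ i) =
        0)"
  obtains \<delta> where "\<delta> > 0" "puiseux_cover (\<lambda>t x. \<bar>x\<bar> < \<delta> \<and> eval2 F x t = 0)"
proof -
  obtain U V P where U: "U * V = 1" "U * F = P" and
    P: "\<And>i j. i > k \<Longrightarrow> coeff2 P i j = 0" "\<And>j. coeff2 P k j = (if j = 0 then 1 else 0)"
    by (rule weierstrass_preparation[OF F]) blast
  have "germ1 (eval_fps (x_coeff P i))" for i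
    unfolding germ1_def using eval_fps_has_fps_expansion[OF fps_conv_radius_x_coeff] by blast
  hence cover: "puiseux_cover (\<lambda>t x. x ^ k + (\<Sum>i<k. eval_fps (x_coeff P i) t * x ^ i) = 0)"
      by (intro IH)
  have "\<forall>\<^sub>F (x::real, y) in nhds (0, 0). eval2 P x y =
      x ^ k + (\<Sum>i<k. eval_fps (x_coeff P i) y * x ^ i)"
    using P by (rule eventually_eval2_monic)
  with eventually_eval2_mult[of U F]
  have "\<forall>\<^sub>F (x::real, y) in nhds (0, 0). eval2 F x y = 0 \<longrightarrow>
      x ^ k + (\<Sum>i<k. eval_fps (x_coeff P i) y * x ^ i) = 0"
    by eventually_elim (auto simp: U(2))
  then obtain \<delta> where \<delta>: "\<delta> > 0" "\<And>x y :: real. \<bar>x\<bar> < \<delta> \<Longrightarrow> \<bar>y\<bar> < \<delta> \<Longrightarrow> eval2 F x y = 0 \<Longrightarrow>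
      x ^ k + (\<Sum>i<k. eval_fps (x_coeff P i) y * x ^ i) = 0"
    unfolding eventually_nhds_00_iff real_norm_def by blast
  have "\<forall>\<^sub>F t in at_right 0. \<forall>x. \<bar>x\<bar> < \<delta> \<and> eval2 F x t = 0 \<longrightarrow>
      x ^ k + (\<Sum>i<k. eval_fps (x_coeff P i) t * x ^ i) = 0"
    using eventually_at_right_real[OF \<delta>(1)] by eventually_elim (use \<delta>(2) in auto)
  from puiseux_cover_mono[OF cover this] \<delta>(1) show ?thesis using that by blast
qed

lemma sum_shift_binomial:
  fixes A :: "nat \<Rightarrow> 'a::comm_ring_1"
  shows "(\<Sum>i\<le>n. A i * (c + x) ^ i) = (\<Sum>j\<le>n. (\<Sum>i=j..n. A i * of_nat (i choose j) * c ^ (i - j)) * x ^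
      j)"
proof -
  have "(\<Sum>i\<le>n. A i * (c + x) ^ i) = (\<Sum>i\<le>n. \<Sum>j\<in>{j\<in>{..n}. j \<le>
      i}. A i * of_nat (i choose j) * c ^ (i - j) * x ^ j)"
  proof (intro sum.cong refl)
    fix i assume "i \<in> {..n}"
    hence "{j\<in>{..n}. j \<le> i} = {..i}" by auto
    moreover have "(c + x) ^ i = (\<Sum>j\<le>i. of_nat (i choose j) * x ^ j * c ^ (i - j))"
      by (subst add.commute) (rule binomial_ring)
    ultimately show "A i * (c + x) ^ i = (\<Sum>j\<in>{j\<in>{..n}. j \<le>
        i}. A i * of_nat (i choose j) * c ^ (i - j) * x ^ j)"
      by (simp add: sum_distrib_left mult_ac)
  qed
  also have "\<dots> = (\<Sum>j\<le>n. \<Sum>i\<in>{i\<in>{..n}. j \<le> i}. A i * of_nat (i choose j) * c ^ (i - j) * x ^ j)"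
    by (rule sum.swap_restrict) auto
  also have "\<dots> = (\<Sum>j\<le>n. (\<Sum>i=j..n. A i * of_nat (i choose j) * c ^ (i - j)) * x ^ j)"
    by (intro sum.cong refl) (auto simp: sum_distrib_right intro!: sum.cong)
  finally show ?thesis .
qed

lemma germ1_imp_isCont: "germ1 f \<Longrightarrow> isCont f 0"
  unfolding germ1_def using has_fps_expansion_imp_continuous by auto

text \<open>Cauchy's bound for the roots of a monic polynomial, uniform in t because each
  coefficient eventually stays within 1 of its size at t = 0.\<close>

lemma monic_roots_bounded:
  fixes b :: "nat \<Rightarrow> real \<Rightarrow> real"
  assumes "\<And>i. i < m \<Longrightarrow> isCont (b i) 0"
  obtains M where "\<forall>\<^sub>F t in at_right 0. \<forall>x. x ^ m + (\<Sum>i<m. b i t * x ^ i) = 0 \<longrightarrow> \<bar>x\<bar> \<le> M"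
proof -
  define M where "M = 1 + (\<Sum>i<m. \<bar>b i 0\<bar> + 1)"
  have M: "M \<ge> 1" unfolding M_def by (simp add: sum_nonneg)
  have "\<forall>\<^sub>F t in at_right 0. \<forall>i\<in>{..<m}. \<bar>b i t\<bar> < \<bar>b i 0\<bar> + 1"
  proof (rule eventually_ball_finite)
    show "\<forall>i\<in>{..<m}. \<forall>\<^sub>F t in at_right 0. \<bar>b i t\<bar> < \<bar>b i 0\<bar> + 1"
    proof
      fix i assume "i \<in> {..<m}"
      hence "(b i \<longlongrightarrow> b i 0) (at 0)" using assms by (simp add: isCont_def)
      hence "((\<lambda>t. \<bar>b i t\<bar>) \<longlongrightarrow> \<bar>b i 0\<bar>) (at_right 0)"
        by (intro tendsto_rabs) (auto intro: tendsto_mono[OF at_le])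
      thus "\<forall>\<^sub>F t in at_right 0. \<bar>b i t\<bar> < \<bar>b i 0\<bar> + 1" by (rule order_tendstoD) simp
    qed
  qed auto
  hence "\<forall>\<^sub>F t in at_right 0. \<forall>x. x ^ m + (\<Sum>i<m. b i t * x ^ i) = 0 \<longrightarrow> \<bar>x\<bar> \<le> M"
  proof eventually_elim
    case (elim t)
    show ?case
    proof (intro allI impI, rule ccontr)
      fix x assume x: "x ^ m + (\<Sum>i<m. b i t * x ^ i) = 0" and "\<not> \<bar>x\<bar> \<le> M"
      hence xM: "\<bar>x\<bar> > M" "\<bar>x\<bar> \<ge> 1" using M by auto
      have "m > 0" using x by (cases m) auto
      have "\<bar>x\<bar> ^ m = \<bar>\<Sum>i<m. b i t * x ^ i\<bar>"
        using x by (metis abs_minus_cancel add_eq_0_iff power_abs)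
      also have "\<dots> \<le> (\<Sum>i<m. \<bar>b i t\<bar> * \<bar>x\<bar> ^ i)"
        by (rule order_trans[OF sum_abs]) (simp add: abs_mult power_abs)
      also have "\<dots> \<le> (\<Sum>i<m. (\<bar>b i 0\<bar> + 1) * \<bar>x\<bar> ^ (m - 1))"
        using elim xM by (intro sum_mono mult_mono power_increasing) (auto intro: less_imp_le)
      also have "\<dots> = (M - 1) * \<bar>x\<bar> ^ (m - 1)"
        unfolding sum_distrib_right[symmetric] by (simp add: M_def)
      also have "\<dots> < \<bar>x\<bar> * \<bar>x\<bar> ^ (m - 1)" using xM by (intro mult_strict_right_mono) auto
      also have "\<dots> = \<bar>x\<bar> ^ m" using power_minus_mult[OF \<open>m > 0\<close>, of "\<bar>x\<bar>"]
          by (simp only: mult.commute)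
      finally show False by simp
    qed
  qed
  thus ?thesis by (rule that)
qed

text \<open>
  By the Tschirnhaus normalisation (the coefficient of \<open>x^(m-1)\<close> is zero) no point is an
  \<open>m\<close>-fold root at \<open>t = 0\<close>, so near each point the zeros are those of a polynomial of
  smaller degree.
\<close>

lemma puiseux_cover_reduced:
  assumes germ: "\<And>i. i < m \<Longrightarrow> germ1 (b i)" and top: "b (m - 1) 0 = 0"
    and i0: "i0 < m" "b i0 0 \<noteq> 0"
    and IH: "\<And>k a. k < m \<Longrightarrow> (\<And>i. i < k \<Longrightarrow> germ1 (a i)) \<Longrightarrow>
       puiseux_cover (\<lambda>t x. x ^ k + (\<Sum>i<k. a i t * x ^ i) = 0)"
  shows "puiseux_cover (\<lambda>t x. x ^ m + (\<Sum>i<m. b i t * x ^ i) = 0)"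
proof -
  define Q where "Q = (\<lambda>t x. x ^ m + (\<Sum>i<m. b i t * x ^ i))"
  define B where "B = (\<lambda>i. if i = m then (\<lambda>_. 1) else b i)"
  define e where "e = (\<lambda>\<xi> j t. \<Sum>i=j..m. B i t * of_nat (i choose j) * \<xi> ^ (i - j))"
  have Q: "Q t x = (\<Sum>i\<le>m. B i t * x ^ i)" for t x
    unfolding Q_def lessThan_Suc_atMost[symmetric] sum.lessThan_Suc by (simp add: B_def add.commute)
  have Qe: "Q t (\<xi> + x) = (\<Sum>j\<le>m. e \<xi> j t * x ^ j)" for t \<xi> x
    unfolding Q e_def by (rule sum_shift_binomial)
  have germB: "germ1 (B i)" if "i \<le> m" for i using germ that by (simp add: B_def)
  have germe: "germ1 (e \<xi> j)" for \<xi> j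
    unfolding e_def by (intro germ1_sum germ1_mult germB germ1_const) auto
  \<comment> \<open>If \<xi> were an m-fold root at t = 0, the coefficient b(m-1) + m \<xi> of the
    shifted polynomial would vanish, so \<xi> = 0 by \<open>top\<close>. Then all b i would vanish
    at 0, contradicting the choice of i0.\<close>
  have nz: "\<exists>j<m. e \<xi> j 0 \<noteq> 0" for \<xi>
  proof (rule ccontr)
    assume "\<not> ?thesis"
    hence z: "e \<xi> j 0 = 0" if "j < m" for j using that by blast
    have "{m - 1..m} = {m - 1, m}" using i0 by auto
    hence "e \<xi> (m - 1) 0 = b (m - 1) 0 + real m * \<xi>"
      using i0 binomial_symmetric[of 1 m] by (auto simp: e_def B_def)
    hence "\<xi> = 0" using z[of "m - 1"] i0 top by simp
    have "e 0 i0 0 = (\<Sum>i\<in>{i0}. B i 0 * of_nat (i choose i0) * 0 ^ (i - i0))"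
      unfolding e_def using i0 by (intro sum.mono_neutral_right) auto
    also have "\<dots> = b i0 0" using i0 by (simp add: B_def)
    finally show False using z[OF i0(1)] i0(2) \<open>\<xi> = 0\<close> by simp
  qed
  have "\<exists>\<delta>>0. puiseux_cover (\<lambda>t x. \<bar>x - \<xi>\<bar> < \<delta> \<and> Q t x = 0)" for \<xi>
  proof -
    obtain F where F: "\<And>j. j \<le> m \<Longrightarrow> coeff2 F j 0 = e \<xi> j 0"
      "\<forall>\<^sub>F (x, t) in nhds (0, 0). eval2 F x t = (\<Sum>j\<le>m. e \<xi> j t * x ^ j)"
      by (rule cps2_of_germs[of m "e \<xi>", OF germe]) blast
    define k where "k = (LEAST j. e \<xi> j 0 \<noteq> 0)"
    obtain j where j: "j < m" "e \<xi> j 0 \<noteq> 0" using nz[of \<xi>] by blast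
    have k: "e \<xi> k 0 \<noteq> 0" "k \<le> j" unfolding k_def using j(2) by (rule LeastI, rule Least_le)
    have "k < m" using k j by simp
    have "x_regular F k"
      unfolding x_regular_def
    proof (intro conjI allI impI)
      fix i assume "i < k"
      hence "e \<xi> i 0 = 0" using not_less_Least[of i "\<lambda>j. e \<xi> j 0 \<noteq> 0"] unfolding k_def by simp
      thus "coeff2 F i 0 = 0" using F(1) \<open>i < k\<close> \<open>k < m\<close> by simp
    next
      show "coeff2 F k 0 \<noteq> 0" using F(1)[of k] k(1) \<open>k < m\<close> by simp
    qed
    then obtain \<delta> where \<delta>: "\<delta> > 0" "puiseux_cover (\<lambda>t x. \<bar>x\<bar> < \<delta> \<and> eval2 F x t = 0)"
      using IH[OF \<open>k < m\<close>] by (rule puiseux_cover_x_regular)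
    from F(2) obtain r where r: "r > 0" "\<And>x t. \<bar>x\<bar> < r \<Longrightarrow> \<bar>t\<bar> < r \<Longrightarrow> eval2 F x t =
        (\<Sum>j\<le>m. e \<xi> j t * x ^ j)"
      unfolding eventually_nhds_00_iff real_norm_def by auto
    have "puiseux_cover (\<lambda>t x. \<bar>x - \<xi>\<bar> < min \<delta> r \<and> Q t x = 0)"
    \<comment> \<open>The transformation with q = 1 and p = 0 is the translation by \<xi>.\<close>
    proof (rule puiseux_cover_transform[OF \<delta>(2), of "\<lambda>_. \<xi>" 1 _ 0])
      show "\<forall>\<^sub>F t in at_right 0. \<forall>x. \<bar>x - \<xi>\<bar> < min \<delta> r \<and> Q t x = 0 \<longrightarrow>
        (\<exists>x'. (\<bar>x'\<bar> < \<delta> \<and> eval2 F x' (t powr (1 / real 1)) = 0) \<and> x =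
            \<xi> + (t powr (1 / real 1)) ^ 0 * x')"
        using eventually_at_right_real[OF r(1)]
      proof eventually_elim
        case (elim t)
        show ?case
        proof (intro allI impI)
          fix x assume x: "\<bar>x - \<xi>\<bar> < min \<delta> r \<and> Q t x = 0"
          have "eval2 F (x - \<xi>) t = Q t (\<xi> + (x - \<xi>))"
            unfolding Qe using x elim by (intro r(2)) auto
          hence "eval2 F (x - \<xi>) (t powr (1 / real 1)) = 0" using x elim by simp
          thus "\<exists>x'. (\<bar>x'\<bar> < \<delta> \<and> eval2 F x' (t powr (1 / real 1)) = 0) \<and> x =
              \<xi> + (t powr (1 / real 1)) ^ 0 * x'"
            using x by (intro exI[of _ "x - \<xi>"]) simp
        qed
      qed
    qed simp_all
    moreover have "min \<delta> r > 0" using \<delta>(1) r(1) by simp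
    ultimately show ?thesis by blast
  qed
  hence "\<forall>\<xi>. \<exists>\<delta>. \<delta> > 0 \<and> puiseux_cover (\<lambda>t x. \<bar>x - \<xi>\<bar> < \<delta> \<and> Q t x = 0)" by simp
  then obtain \<delta> where "\<forall>\<xi>. \<delta> \<xi> > 0 \<and> puiseux_cover (\<lambda>t x. \<bar>x - \<xi>\<bar> < \<delta> \<xi> \<and> Q t x = 0)"
    by (rule choice[THEN exE])
  hence \<delta>: "\<delta> \<xi> > 0" "puiseux_cover (\<lambda>t x. \<bar>x - \<xi>\<bar> < \<delta> \<xi> \<and> Q t x = 0)" for \<xi> by simp_all
  have "isCont (b i) 0" if "i < m" for i using germ[OF that] by (rule germ1_imp_isCont)
  then obtain M where M: "\<forall>\<^sub>F t in at_right 0. \<forall>x. Q t x = 0 \<longrightarrow> \<bar>x\<bar> \<le> M"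
    unfolding Q_def by (rule monic_roots_bounded)
  \<comment> \<open>All zeros lie in a fixed compact interval for small t, so finitely many of the
    local coverings suffice.\<close>
  have "{-M..M} \<subseteq> (\<Union>\<xi>\<in>{-M..M}. ball \<xi> (\<delta> \<xi>))"
  proof
    fix x assume "x \<in> {-M..M}"
    moreover have "x \<in> ball x (\<delta> x)" using \<delta>(1) by simp
    ultimately show "x \<in> (\<Union>\<xi>\<in>{-M..M}. ball \<xi> (\<delta> \<xi>))" by (rule UN_I)
  qed
  then obtain I where I: "I \<subseteq> {-M..M}" "finite I" "{-M..M} \<subseteq> (\<Union>\<xi>\<in>I. ball \<xi> (\<delta> \<xi>))"
    by (rule compactE_image[OF compact_Icc, rotated]) auto
  have cover: "puiseux_cover (\<lambda>t x. \<exists>\<xi>\<in>I. \<bar>x - \<xi>\<bar> < \<delta> \<xi> \<and> Q t x = 0)"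
    by (rule puiseux_cover_Bex[OF I(2) \<delta>(2)])
  have "\<forall>\<^sub>F t in at_right 0. \<forall>x. Q t x = 0 \<longrightarrow> (\<exists>\<xi>\<in>I. \<bar>x - \<xi>\<bar> < \<delta> \<xi> \<and> Q t x = 0)"
    using M
  proof eventually_elim
    case (elim t)
    show ?case
    proof (intro allI impI)
      fix x assume x: "Q t x = 0"
      hence "\<bar>x\<bar> \<le> M" using elim by simp
      hence "x \<in> {-M..M}" by auto
      then obtain \<xi> where "\<xi> \<in> I" "x \<in> ball \<xi> (\<delta> \<xi>)" using I(3) by blast
      hence "\<xi> \<in> I" "\<bar>x - \<xi>\<bar> < \<delta> \<xi>" by (simp_all add: dist_real_def abs_minus_commute)
      thus "\<exists>\<xi>\<in>I. \<bar>x - \<xi>\<bar> < \<delta> \<xi> \<and> Q t x = 0" using x by (intro bexI[of _ \<xi>] conjI)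
    qed
  qed
  with cover have "puiseux_cover (\<lambda>t x. Q t x = 0)" by (rule puiseux_cover_mono)
  thus ?thesis unfolding Q_def .
qed

lemma ex_min_ratio:
  fixes f :: "nat \<Rightarrow> real"
  assumes "finite I" "I \<noteq> {}"
  obtains i0 where "i0 \<in> I" "\<And>i. i \<in> I \<Longrightarrow> f i0 \<le> f i"
proof -
  have "Min (f ` I) \<in> f ` I" using assms by (intro Min_in) auto
  then obtain i0 where "i0 \<in> I" "f i0 = Min (f ` I)" by auto
  thus ?thesis using assms by (intro that[of i0]) auto
qed

text \<open>
  The exponents \<open>p\<close> and \<open>q\<close> are read off the first edge of the Newton polygon:
  \<open>p / q\<close> is the smallest of the slopes \<open>ord a\<^sub>i / (m - i)\<close>.
\<close>

lemma puiseux_cover_centered: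
  assumes germ: "\<And>i. i < m \<Longrightarrow> germ1 (a i)" and m: "m > 0" and top: "\<And>t. a (m - 1) t = 0"
    and IH: "\<And>k a. k < m \<Longrightarrow> (\<And>i. i < k \<Longrightarrow> germ1 (a i)) \<Longrightarrow>
       puiseux_cover (\<lambda>t x. x ^ k + (\<Sum>i<k. a i t * x ^ i) = 0)"
  shows "puiseux_cover (\<lambda>t x. x ^ m + (\<Sum>i<m. a i t * x ^ i) = 0)"
proof -
  \<comment> \<open>The vanishing coefficient m - 1 gets the zero series explicitly; this keeps m -
    1 out of the index set I and makes its rescaled coefficient zero.\<close>
  define A where "A i = (if i = m - 1 then 0 else SOME A. a i has_fps_expansion A)" for i
  have A: "a i has_fps_expansion A i" if "i < m" for i
  proof (cases "i = m - 1")
    case True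
    have "a i = (\<lambda>_. 0)" using top True by auto
    thus ?thesis using True by (simp add: A_def)
  next
    case False
    have "\<exists>A. a i has_fps_expansion A" using germ[OF that] unfolding germ1_def .
    from someI_ex[OF this] show ?thesis using False by (simp add: A_def)
  qed
  define I where "I = {i. i < m \<and> A i \<noteq> 0}"
  have finI: "finite I" by (simp add: I_def)
  show ?thesis
  proof (cases "I = {}")
    \<comment> \<open>With no nonzero lower coefficient the equation is x^m = 0 for small t, and the
      zero arc covers it.\<close>
    case True
    have "\<forall>\<^sub>F t in at_right 0. \<forall>i\<in>{..<m}. a i t = 0"
    proof (rule eventually_ball_finite)
      show "\<forall>i\<in>{..<m}. \<forall>\<^sub>F t in at_right 0. a i t = 0"
      proof
        fix i assume "i \<in> {..<m}"
        hence "a i has_fps_expansion 0" using A[of i] True by (simp add: I_def)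
        hence "\<forall>\<^sub>F t in nhds 0. eval_fps 0 t = a i t" unfolding has_fps_expansion_def ..
        thus "\<forall>\<^sub>F t in at_right 0. a i t = 0" unfolding eventually_at_filter
            by (rule eventually_mono) simp
      qed
    qed auto
    hence "\<forall>\<^sub>F t in at_right 0. \<forall>x. x ^ m + (\<Sum>i<m. a i t * x ^ i) = 0 \<longrightarrow> x = 0"
      by eventually_elim simp
    moreover have "puiseux_cover (\<lambda>t x. x = 0)"
      unfolding puiseux_cover_def by (rule exI[of _ "{(1, \<lambda>_. 0)}"]) simp
    ultimately show ?thesis by (rule puiseux_cover_mono[rotated])
  next
    case False
    define d where "d i = subdegree (A i)" for i
    obtain i0 where i0: "i0 \<in> I" and min: "\<And>i. i \<in> I \<Longrightarrow> real (d i0) / real (m - i0) \<le>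
        real (d i) / real (m - i)"
      by (rule ex_min_ratio[OF finI False, of "\<lambda>i. real (d i) / real (m - i)"]) blast
    have i0m: "i0 < m" "A i0 \<noteq> 0" using i0 by (auto simp: I_def)
    define p where "p = d i0"
    define q where "q = m - i0"
    have q: "q > 0" using i0m by (simp add: q_def)
    have slope: "p * (m - i) \<le> d i * q" if "i \<in> I" for i
    proof -
      have "real p / real q \<le> real (d i) / real (m - i)" using min[OF that]
          by (simp add: p_def q_def)
      moreover have "m - i > 0" using that by (simp add: I_def)
      ultimately have "real p * real (m - i) \<le> real (d i) * real q" using q
          by (simp add: field_simps)
      thus ?thesis by (simp only: of_nat_mult[symmetric] of_nat_le_iff)
    qed
    \<comment> \<open>The rescaled coefficient b(tau) = a i (tau^q) / tau^(p (m-i)). By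
      \<open>slope\<close> the numerator has order at least p (m - i), so b is analytic. At i0 the
      orders agree, and b(0) is the leading coefficient of \<open>A i0\<close>, hence nonzero as the
      reduced case demands.\<close>
    let ?B = "\<lambda>i b. i < m \<longrightarrow> germ1 b \<and> (\<forall>\<^sub>F \<tau> in at_right 0. a i (\<tau> ^ q) = \<tau> ^ (p * (m - i)) * b \<tau>) \<and>
       (i = i0 \<longrightarrow> b 0 \<noteq> 0) \<and> (i = m - 1 \<longrightarrow> b 0 = 0)"
    have "\<forall>i. \<exists>b. ?B i b"
    proof
      fix i
      show "\<exists>b. ?B i b"
      proof (cases "i < m")
        case im: True
        define B where "B = Abs_fps (\<lambda>n. if q dvd n then fps_nth (A i) (n div q) else 0)"
        define s where "s = (if A i = 0 then 0 else p * (m - i))"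
        have B: "(\<lambda>\<tau>. a i (\<tau> ^ q)) has_fps_expansion B"
          unfolding B_def by (rule has_fps_expansion_compose_power[OF A[OF im] q])
        have s: "s \<le> subdegree B"
        proof (cases "A i = 0")
          case False
          hence iI: "i \<in> I" using im by (simp add: I_def)
          have "fps_nth B (q * d i) \<noteq> 0" using False q by (simp add: B_def d_def)
          hence "B \<noteq> 0" by auto
          thus ?thesis
          proof (rule subdegree_geI)
            fix n assume "n < s"
            hence n: "n < d i * q" using slope[OF iI] by (simp add: s_def False)
            show "fps_nth B n = 0"
            proof (cases "q dvd n")
              case True
              hence "n div q < d i" using n q by (simp add: div_less_iff_less_mult)
              hence "fps_nth (A i) (n div q) = 0" unfolding d_def by (rule nth_less_subdegree_zero)
              thus ?thesis by (simp add: B_def)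
            qed (simp add: B_def)
          qed
        qed (simp add: s_def)
        define b where "b = (\<lambda>\<tau>. if \<tau> = 0 then fps_nth B s else a i (\<tau> ^ q) / \<tau> ^ s)"
        have "b has_fps_expansion fps_shift s B"
          unfolding b_def using has_fps_expansion_shift[OF B s refl] .
        hence gb: "germ1 b" unfolding germ1_def by blast
        show ?thesis
        proof (cases "A i = 0")
          case True
          have "i \<noteq> i0" using True i0m by auto
          have "B = 0" using True by (simp add: B_def fps_eq_iff)
          with B have "(\<lambda>\<tau>. a i (\<tau> ^ q)) has_fps_expansion 0" by simp
          hence "\<forall>\<^sub>F \<tau> in nhds 0. eval_fps 0 \<tau> = a i (\<tau> ^ q)" unfolding has_fps_expansion_def ..
          hence "\<forall>\<^sub>F \<tau> in at_right 0. a i (\<tau> ^ q) = 0" unfolding eventually_at_filter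
              by (rule eventually_mono) simp
          thus ?thesis using \<open>i \<noteq> i0\<close> by (intro exI[of _ "\<lambda>_. 0"]) simp
        next
          case False
          hence im1: "i \<noteq> m - 1" by (auto simp: A_def)
          have "b 0 \<noteq> 0" if "i = i0"
          proof -
            have "s = q * d i0" using False that by (simp add: s_def p_def q_def mult.commute)
            hence "b 0 = fps_nth (A i0) (subdegree (A i0))" using q that
                by (simp add: b_def B_def d_def)
            thus ?thesis using i0m by simp
          qed
          moreover have "\<forall>\<^sub>F \<tau> in at_right 0. a i (\<tau> ^ q) = \<tau> ^ (p * (m - i)) * b \<tau>"
            using eventually_at_right_less[of 0] by eventually_elim (simp add: False b_def s_def)
          ultimately show ?thesis using gb im1 by (intro exI[of _ b]) simp
        qed
      qed simp
    qed
    then obtain b where bb: "\<forall>i. ?B i (b i)"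
      by (rule choice[THEN exE])
    have b: "\<And>i. i < m \<Longrightarrow> germ1 (b i)"
      "\<And>i. i < m \<Longrightarrow> \<forall>\<^sub>F \<tau> in at_right 0. a i (\<tau> ^ q) = \<tau> ^ (p * (m - i)) * b i \<tau>"
      "b i0 0 \<noteq> 0" "b (m - 1) 0 = 0"
      using bb i0m(1) bb[rule_format, of "m - 1"] m by simp_all
    have cover: "puiseux_cover (\<lambda>\<tau> x. x ^ m + (\<Sum>i<m. b i \<tau> * x ^ i) = 0)"
      using b(1,4) i0m(1) b(3) IH by (rule puiseux_cover_reduced)
    have "\<forall>\<^sub>F \<tau> in at_right 0. \<forall>i\<in>{..<m}. a i (\<tau> ^ q) = \<tau> ^ (p * (m - i)) * b i \<tau>"
      using b(2) by (intro eventually_ball_finite) auto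
    from eventually_compose_filterlim[OF this root_at_right_0[OF q]] eventually_at_right_less[of 0]
    have "\<forall>\<^sub>F t in at_right 0. \<forall>x. x ^ m + (\<Sum>i<m. a i t * x ^ i) = 0 \<longrightarrow>
      (\<exists>x'. x' ^ m + (\<Sum>i<m. b i (t powr (1 / real q)) * x' ^ i) = 0 \<and> x =
          0 + (t powr (1 / real q)) ^ p * x')"
    proof eventually_elim
      case (elim t)
      define \<tau> where "\<tau> = t powr (1 / real q)"
      have \<tau>: "\<tau> > 0" using elim(2) by (simp add: \<tau>_def)
      have \<tau>q: "\<tau> ^ q = t" using elim(2) q by (simp add: \<tau>_def powr_power)
      have ab: "a i t = \<tau> ^ (p * (m - i)) * b i \<tau>" if "i < m" for i
        using elim(1) that unfolding \<tau>_def[symmetric] \<tau>q by simp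
      show ?case unfolding \<tau>_def[symmetric]
      proof (intro allI impI)
        fix x assume x: "x ^ m + (\<Sum>i<m. a i t * x ^ i) = 0"
        \<comment> \<open>With x = tau^p x' every term a i t x^i carries the common factor tau^(p
          m), which is then cancelled.\<close>
        define x' where "x' = x / \<tau> ^ p"
        have xx': "x = \<tau> ^ p * x'" using \<tau> by (simp add: x'_def)
        have "a i t * x ^ i = \<tau> ^ (p * m) * (b i \<tau> * x' ^ i)" if "i < m" for i
        proof -
          have "a i t * x ^ i = (\<tau> ^ (p * (m - i)) * \<tau> ^ (p * i)) * (b i \<tau> * x' ^ i)"
            unfolding ab[OF that] xx' power_mult_distrib power_mult[symmetric]
                by (simp only: mult_ac)
          also have "\<tau> ^ (p * (m - i)) * \<tau> ^ (p * i) = \<tau> ^ (p * m)"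
            using that unfolding power_add[symmetric] distrib_left[symmetric] by simp
          finally show ?thesis .
        qed
        hence "(\<Sum>i<m. a i t * x ^ i) = \<tau> ^ (p * m) * (\<Sum>i<m. b i \<tau> * x' ^ i)"
          unfolding sum_distrib_left by (intro sum.cong) auto
        moreover have "x ^ m = \<tau> ^ (p * m) * x' ^ m"
          unfolding xx' power_mult_distrib power_mult[symmetric] ..
        ultimately have "\<tau> ^ (p * m) * (x' ^ m + (\<Sum>i<m. b i \<tau> * x' ^ i)) = 0"
          using x by (simp only: distrib_left)
        hence "x' ^ m + (\<Sum>i<m. b i \<tau> * x' ^ i) = 0" using \<tau> by simp
        thus "\<exists>x'. x' ^ m + (\<Sum>i<m. b i \<tau> * x' ^ i) = 0 \<and> x = 0 + \<tau> ^ p * x'"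
          using xx' by (intro exI[of _ x'] conjI) simp_all
      qed
    qed
    thus ?thesis by (rule puiseux_cover_transform[OF cover germ1_const q])
  qed
qed

theorem puiseux_cover_monic:
  assumes "\<And>i. i < m \<Longrightarrow> germ1 (a i)"
  shows "puiseux_cover (\<lambda>t x. x ^ m + (\<Sum>i<m. a i t * x ^ i) = 0)"
  using assms
proof (induction m arbitrary: a rule: less_induct)
  case (less m)
  show ?case
  proof (cases "m = 0")
    case True
    thus ?thesis using puiseux_cover_False by simp
  next
    case False
    \<comment> \<open>The Tschirnhaus shift: replacing x by x - a(m-1)/m removes the coefficient of
      x^(m-1).\<close>
    define c where "c = (\<lambda>t. - (1 / real m) * a (m - 1) t)"
    define A where "A = (\<lambda>i. if i = m then (\<lambda>_. 1) else a i)"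
    define e where "e = (\<lambda>j t. \<Sum>i=j..m. A i t * of_nat (i choose j) * c t ^ (i - j))"
    have germA: "germ1 (A i)" if "i \<le> m" for i using less.prems that by (simp add: A_def)
    have germc: "germ1 c" unfolding c_def using less.prems False by (intro germ1_mult) auto
    have germe: "germ1 (e j)" for j
      unfolding e_def by (intro germ1_sum germ1_mult germA germ1_const germ1_power germc) auto
    have "{m - 1..m} = {m - 1, m}" using False by auto
    hence top: "e (m - 1) t = 0" for t
      using False binomial_symmetric[of 1 m] by (auto simp: e_def A_def c_def)
    have em: "e m t = 1" for t by (simp add: e_def A_def)
    have cover: "puiseux_cover (\<lambda>t x. x ^ m + (\<Sum>i<m. e i t * x ^ i) = 0)"
      using germe _ top less.IH by (rule puiseux_cover_centered) (use False in auto)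
    have eq: "(c t + x) ^ m + (\<Sum>i<m. a i t * (c t + x) ^ i) = x ^ m + (\<Sum>i<m. e i t * x ^ i)" for t x
    proof -
      have "(c t + x) ^ m + (\<Sum>i<m. a i t * (c t + x) ^ i) = (\<Sum>i\<le>m. A i t * (c t + x) ^ i)"
        unfolding lessThan_Suc_atMost[symmetric] sum.lessThan_Suc by (simp add: A_def add.commute)
      also have "\<dots> = (\<Sum>j\<le>m. e j t * x ^ j)" unfolding e_def by (rule sum_shift_binomial)
      also have "\<dots> = x ^ m + (\<Sum>i<m. e i t * x ^ i)"
        unfolding lessThan_Suc_atMost[symmetric] sum.lessThan_Suc em by simp
      finally show ?thesis .
    qed
    have "\<forall>\<^sub>F t in at_right 0. \<forall>x. x ^ m + (\<Sum>i<m. a i t * x ^ i) = 0 \<longrightarrow>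
      (\<exists>x'. x' ^ m + (\<Sum>i<m. e i (t powr (1 / real 1)) * x' ^ i) = 0 \<and> x =
          c t + (t powr (1 / real 1)) ^ 0 * x')"
      using eventually_at_right_less[of 0]
    proof eventually_elim
      case (elim t)
      show ?case
      proof (intro allI impI)
        fix x assume "x ^ m + (\<Sum>i<m. a i t * x ^ i) = 0"
        hence "(x - c t) ^ m + (\<Sum>i<m. e i t * (x - c t) ^ i) = 0" using eq[of t "x - c t"] by simp
        thus "\<exists>x'. x' ^ m + (\<Sum>i<m. e i (t powr (1 / real 1)) * x' ^ i) = 0 \<and> x =
            c t + (t powr (1 / real 1)) ^ 0 * x'"
          using elim by (intro exI[of _ "x - c t"] conjI) simp_all
      qed
    qed
    thus ?thesis by (rule puiseux_cover_transform[OF cover germc zero_less_one])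
  qed
qed

corollary puiseux_cover_eval2:
  assumes "x_regular F m"
  obtains \<delta> where "\<delta> > 0" "puiseux_cover (\<lambda>y x. \<bar>x\<bar> < \<delta> \<and> eval2 F x y = 0)"
  using assms puiseux_cover_monic by (rule puiseux_cover_x_regular)

section \<open>The real zero set of a mini-regular series\<close>

lemma mini_regular_coeff_less:
  assumes "mini_regular F m" "i + j < m"
  shows "coeff2 F i j = 0"
proof -
  define k where "k = i + j"
  have "(\<Sum>i\<le>k. coeff2 F i (k - i) * x ^ i) = 0" for x
  proof -
    have "hom_component F k x 1 = 0" using assms by (simp add: mini_regular_def k_def)
    thus ?thesis by (simp add: hom_component_def)
  qed
  hence "\<forall>i\<le>k. coeff2 F i (k - i) = 0" using polyfun_eq_0[of "\<lambda>i. coeff2 F i (k - i)" k] by blast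
  from spec[OF this, of i] show ?thesis by (simp add: k_def)
qed

lemma mini_regular_coeff_m0:
  assumes "mini_regular F m"
  shows "coeff2 F m 0 \<noteq> 0"
proof -
  have "hom_component F m 1 0 = (\<Sum>i\<in>{m}. coeff2 F i (m - i) * 1 ^ i * 0 ^ (m - i))"
    unfolding hom_component_def by (rule sum.mono_neutral_right) auto
  thus ?thesis using assms by (simp add: mini_regular_def)
qed

lemma mini_regular_imp_x_regular: "mini_regular F m \<Longrightarrow> x_regular F m"
  by (simp add: x_regular_def mini_regular_coeff_less mini_regular_coeff_m0)

text \<open>
  In the blow-up chart \<open>y = x z\<close> the series becomes \<open>x^m\<close> times a unit, as no zero is tangent
  to the \<open>x\<close>-axis.
\<close>

lemma mini_regular_cone:
  assumes "mini_regular F m"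
  obtains K \<epsilon> where "K > 0" "\<epsilon> > 0"
    "\<And>x y :: real. \<bar>x\<bar> < \<epsilon> \<Longrightarrow> \<bar>y\<bar> < \<epsilon> \<Longrightarrow> eval2 F x y = 0 \<Longrightarrow> \<bar>x\<bar> \<le> K * \<bar>y\<bar>"
proof -
  obtain C R where CR: "C \<ge> 0" "R \<ge> 1" "\<And>i j. \<bar>coeff2 F i j\<bar> \<le> C * R ^ (i + j)"
    by (rule coeff2_bound[of F]) blast
  \<comment> \<open>For y = x z the monomial x^a y^j becomes x^(a+j) z^j, so after removal of x^m
    the coefficient at x^i z^j comes from a = i + m - j. Mini-regularity ensures a + j \<ge> m for
    all terms present and makes the constant term nonzero.\<close>
  define g where "g = (\<lambda>i j. if j \<le> i + m then coeff2 F (i + m - j) j else 0)"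
  have "\<bar>g i j\<bar> \<le> (C * R ^ m) * R ^ (i + j)" for i j
  proof (cases "j \<le> i + m")
    case True
    have "\<bar>g i j\<bar> \<le> C * R ^ (i + m)" using CR(3)[of "i + m - j" j] True by (simp add: g_def)
    also have "\<dots> \<le> C * R ^ (m + (i + j))" using CR by (intro mult_left_mono power_increasing) auto
    finally show ?thesis by (simp add: power_add mult.assoc)
  qed (use CR in \<open>simp add: g_def\<close>)
  moreover have "R > 0" using CR by simp
  ultimately obtain G where G: "\<And>i j. coeff2 G i j = g i j"
    by (rule cps2_of_coeffs) blast
  have FG: "eval2 F x (x * z) = x ^ m * eval2 G x z" for x z :: real
  proof -
    let ?S = "{(a, j). m \<le> a + j}" and ?T = "{(i, j). j \<le> i + m}"
    have "eval2 F x (x * z) = infsum (term2 F x (x * z)) ?S"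
      unfolding eval2_eq
      by (rule infsum_cong_neutral) (auto simp: term2_def not_le mini_regular_coeff_less[OF assms])
    also have "\<dots> = infsum (\<lambda>p. x ^ m * term2 G x z p) ?T"
    proof (rule infsum_reindex_bij_witness[of _ "\<lambda>(i, j). (i + m - j, j)"
        "\<lambda>(a, j). (a + j - m, j)"])
      fix p assume "p \<in> ?S"
      then obtain a j where p: "p = (a, j)" "m \<le> a + j" by auto
      have "x ^ m * x ^ (a + j - m) = x ^ a * x ^ j" using p(2) unfolding power_add[symmetric]
          by simp
      thus "x ^ m * term2 G x z (case p of (a, j) \<Rightarrow> (a + j - m, j)) = term2 F x (x * z) p"
        using p by (simp add: term2_def G g_def power_mult_distrib mult_ac)
    qed auto
    also have "\<dots> = x ^ m * infsum (term2 G x z) ?T" by (rule infsum_cmult_right')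
    also have "infsum (term2 G x z) ?T = eval2 G x z"
      unfolding eval2_eq by (rule infsum_cong_neutral) (auto simp: term2_def G g_def)
    finally show ?thesis .
  qed
  have "x_regular G 0" using mini_regular_coeff_m0[OF assms] by (simp add: x_regular_def G g_def)
  then obtain V where "V * G = 1" by (rule x_regular_0_unit)
  with eventually_eval2_mult[of V G, where 'a = real]
  have "\<forall>\<^sub>F (x::real, y) in nhds (0, 0). eval2 V x y * eval2 G x y = 1"
      by (simp add: eq_commute[of 1])
  hence "\<forall>\<^sub>F (x::real, y) in nhds (0, 0). eval2 G x y \<noteq> 0"
    by eventually_elim auto
  then obtain r where r: "r > 0" "\<And>x y :: real. \<bar>x\<bar> < r \<Longrightarrow> \<bar>y\<bar> < r \<Longrightarrow> eval2 G x y \<noteq> 0"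
    unfolding eventually_nhds_00_iff real_norm_def by auto
  show ?thesis
  \<comment> \<open>On the square of side r the blown-up series has no zero, so a zero of F with x
    nonzero has |y/x| \<ge> r.\<close>
  proof (rule that[of "1 / r" r])
    fix x y :: real assume xy: "\<bar>x\<bar> < r" "\<bar>y\<bar> < r" "eval2 F x y = 0"
    show "\<bar>x\<bar> \<le> 1 / r * \<bar>y\<bar>"
    proof (cases "x = 0")
      case False
      have "x ^ m * eval2 G x (y / x) = 0" using FG[of x "y / x"] False xy(3) by simp
      hence "\<not> \<bar>y / x\<bar> < r" using r(2)[OF xy(1), of "y / x"] False by auto
      thus ?thesis using r(1) False by (simp add: field_simps abs_divide)
    qed (use r in simp)
  qed (use r in auto)
qed

section \<open>Turning covering arcs into real Newton-Puiseux roots\<close>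

lemma fps_expansion_leading:
  fixes f :: "real \<Rightarrow> real"
  assumes f: "f has_fps_expansion A" and A: "A \<noteq> 0"
  shows "((\<lambda>u. f u / u ^ subdegree A) \<longlongrightarrow> fps_nth A (subdegree A)) (at_right 0)"
proof -
  define d where "d = subdegree A"
  define g where "g = (\<lambda>u. if u = 0 then fps_nth A d else f u / u ^ d)"
  have "g has_fps_expansion fps_shift d A"
    unfolding g_def using f by (rule has_fps_expansion_shift) (simp_all add: d_def)
  hence "isCont g 0" by (rule has_fps_expansion_imp_continuous)
  hence "(g \<longlongrightarrow> g 0) (at 0)" by (simp add: isCont_def)
  hence "(g \<longlongrightarrow> fps_nth A d) (at_right 0)"
    unfolding g_def by (auto intro: tendsto_mono[OF at_le])
  moreover have "\<forall>\<^sub>F u in at_right 0. g u = f u / u ^ d"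
    using eventually_at_right_less[of 0] by eventually_elim (simp add: g_def)
  ultimately show ?thesis unfolding d_def[symmetric] by (rule Lim_transform_eventually)
qed

lemma fps_expansion_eventually_zero:
  assumes "f has_fps_expansion (0 :: real fps)"
  shows "\<forall>\<^sub>F u in at_right 0. f u = 0"
proof -
  have "\<forall>\<^sub>F u in nhds 0. eval_fps 0 u = f u" using assms unfolding has_fps_expansion_def ..
  thus ?thesis unfolding eventually_at_filter by (rule eventually_mono) simp
qed

text \<open>A germ with nonzero expansion behaves like its leading monomial on u > 0. Applied to F
  along a covering arc, this decides whether the arc lies in the zero set or eventually avoids
  it.\<close>

lemma germ1_dichotomy:
  assumes "germ1 f"
  shows "(\<forall>\<^sub>F u in at_right 0. f u = 0) \<or> (\<forall>\<^sub>F u in at_right 0. f u \<noteq> 0)"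
proof -
  obtain A where A: "f has_fps_expansion A" using assms unfolding germ1_def ..
  show ?thesis
  proof (cases "A = 0")
    case True
    thus ?thesis using A fps_expansion_eventually_zero by simp
  next
    case False
    have "\<forall>\<^sub>F u in at_right 0. f u / u ^ subdegree A \<noteq> 0"
      by (rule tendsto_imp_eventually_ne[OF fps_expansion_leading[OF A False]]) (use False in simp)
    hence "\<forall>\<^sub>F u in at_right 0. f u \<noteq> 0" by (rule eventually_mono) auto
    thus ?thesis ..
  qed
qed

lemma real_puiseux_of_fps:
  fixes A :: "real fps"
  assumes N: "N > 0" and rad: "fps_conv_radius A > 0" and low: "\<And>n. n < N \<Longrightarrow> fps_nth A n = 0"
  obtains \<beta> where "puiseux \<beta>" "puiseux_real \<beta>"
    "\<forall>\<^sub>F y in at_right 0. real_arc \<beta> y = eval_fps A (y powr (1 / real N))"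
proof -
  \<comment> \<open>The coefficient function on all rationals is rebuilt from the series in y^(1/N);
    the index n is recovered from the exponent n/N by \<open>THE\<close>.\<close>
  define \<beta> :: "rat \<Rightarrow> complex" where "\<beta> = (\<lambda>q. if \<exists>n::nat. q = of_nat n / of_nat N
    then of_real (fps_nth A (THE n. q = of_nat n / of_nat N)) else 0)"
  have \<beta>: "\<beta> (of_nat n / of_nat N) = of_real (fps_nth A n)" for n
  proof -
    have "(THE k. of_nat n / of_nat N = (of_nat k / of_nat N :: rat)) = n"
      using N by (intro the_equality) auto
    moreover have "\<exists>k::nat. of_nat n / of_nat N = (of_nat k / of_nat N :: rat)" by blast
    ultimately show ?thesis by (simp only: \<beta>_def if_True)
  qed
  have real: "puiseux_real \<beta>" by (simp add: puiseux_real_def \<beta>_def)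
  have "{q. \<beta> q \<noteq> 0} \<subseteq> {of_nat n / of_nat N | n. N \<le> n}"
  proof
    fix q assume q: "q \<in> {q. \<beta> q \<noteq> 0}"
    hence "\<exists>n::nat. q = of_nat n / of_nat N" by (auto simp: \<beta>_def split: if_splits)
    then obtain n where n: "q = of_nat n / of_nat N" ..
    hence "fps_nth A n \<noteq> 0" using q \<beta>[of n] by auto
    hence "N \<le> n" using low[of n] by (cases "N \<le> n") auto
    thus "q \<in> {of_nat n / of_nat N | n. N \<le> n}" using n by blast
  qed
  moreover have radc: "fps_conv_radius (Abs_fps (\<lambda>n. \<beta> (of_nat n / of_nat N))) > 0"
    using rad unfolding fps_conv_radius_pos_iff by (simp add: \<beta>)
  ultimately have den: "puiseux_denom N \<beta>" using N by (simp add: puiseux_denom_def)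
  have radc': "fps_conv_radius (puiseux_fps N \<beta>) > 0" using radc by (simp add: puiseux_fps_def)
  obtain r where r: "r > 0" "ereal r < fps_conv_radius A"
    using rad by (metis ereal_dense2 ereal_less(2) less_ereal.simps(1) zero_ereal_def)
  have small: "\<forall>\<^sub>F y in at_right 0. y powr (1 / real N) < r"
    using root_tendsto_0[OF N] r(1) by (rule order_tendstoD)
  have "\<forall>\<^sub>F y in at_right 0. real_arc \<beta> y = eval_fps A (y powr (1 / real N))"
    using eventually_puiseux_eval[OF den] eventually_powr_less_radius[OF radc' N] small
        eventually_at_right_less[of 0]
  proof eventually_elim
    case (elim y)
    define u where "u = y powr (1 / real N)"
    have u: "norm u < fps_conv_radius A"
      by (rule less_trans[OF _ r(2)]) (use elim(3) in \<open>simp add: u_def\<close>)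
    have "((\<lambda>n. complex_of_real (fps_nth A n * u ^ n)) has_sum of_real (eval_fps A u)) UNIV"
      using has_sum_eval_fps[OF u] by (rule has_sum_of_real)
    moreover have "((\<lambda>n. complex_of_real (fps_nth A n * u ^ n)) has_sum eval_fps (puiseux_fps N \<beta>)
        (of_real u)) UNIV"
      using has_sum_eval_fps[OF elim(2)] by (simp add: puiseux_fps_def \<beta> u_def)
    ultimately have "eval_fps (puiseux_fps N \<beta>) (of_real u) = of_real (eval_fps A u)"
        by (rule has_sum_unique[symmetric])
    thus ?case using elim(1) by (simp add: real_arc_def u_def)
  qed
  moreover have "puiseux \<beta>" using den unfolding puiseux_iff_denom ..
  ultimately show ?thesis using real that by blast
qed

text \<open>This converts the cone estimate |x| \<le> K y, read as |s(u)| \<le> K u^N, into the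
  condition that a Puiseux series has no exponent below 1.\<close>

lemma eventually_le_power_imp_subdegree:
  fixes s :: "real \<Rightarrow> real"
  assumes s: "s has_fps_expansion A" and K: "\<forall>\<^sub>F u in at_right 0. \<bar>s u\<bar> \<le> K * u ^ N" and n: "n < N"
  shows "fps_nth A n = 0"
proof (rule ccontr)
  assume nz: "fps_nth A n \<noteq> 0"
  hence A: "A \<noteq> 0" by auto
  define d where "d = subdegree A"
  have "d < N" using nz n subdegree_leI[of A n] by (simp add: d_def)
  have "((\<lambda>u. K * u ^ (N - d)) \<longlongrightarrow> K * 0 ^ (N - d)) (at_right (0::real))"
    by (intro tendsto_intros tendsto_ident_at)
  hence "((\<lambda>u. K * u ^ (N - d)) \<longlongrightarrow> 0) (at_right (0::real))" using \<open>d < N\<close> by (simp add: power_0_left)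
  moreover have "\<forall>\<^sub>F u in at_right 0. norm (s u / u ^ d) \<le> K * u ^ (N - d)"
    using K eventually_at_right_less[of 0]
  proof eventually_elim
    case (elim u)
    have "\<bar>s u\<bar> \<le> K * u ^ (N - d) * u ^ d"
      using elim(1) \<open>d < N\<close> by (simp add: mult.assoc flip: power_add)
    thus ?case using elim(2) by (simp add: field_simps)
  qed
  ultimately have "((\<lambda>u. s u / u ^ d) \<longlongrightarrow> 0) (at_right 0)" by (rule Lim_null_comparison[rotated])
  moreover have "((\<lambda>u. s u / u ^ d) \<longlongrightarrow> fps_nth A d) (at_right 0)"
    unfolding d_def by (rule fps_expansion_leading[OF s A])
  ultimately have "0 = fps_nth A d" by (rule tendsto_unique[rotated]) simp
  thus False using A by (simp add: d_def)
qed

text \<open>Each arc of the covering either eventually misses the zeros or consists of zeros. In the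
  second case it passes through the origin and stays in the cone around the y-axis, so it is a real
  Puiseux series and hence one of the real roots.\<close>

theorem mini_regular_real_zeros:
  assumes F: "mini_regular F m" and m: "m > 0"
  obtains \<delta> where "\<delta> > 0" "\<forall>\<^sub>F y in at_right 0. \<forall>x. \<bar>x\<bar> < \<delta> \<longrightarrow>
     (eval2 F x y = 0 \<longleftrightarrow> (\<exists>\<beta>\<in>real_np_roots F. x = real_arc \<beta> y))"
proof -
  note xreg = mini_regular_imp_x_regular[OF F]
  obtain U V P where UV: "U * V = 1" "U * F = P" and
    P: "\<And>i j. i > m \<Longrightarrow> coeff2 P i j = 0" "\<And>j. coeff2 P m j = (if j = 0 then 1 else 0)"
    and Plow: "\<And>i. i < m \<Longrightarrow> coeff2 P i 0 = 0"
    by (rule weierstrass_preparation[OF xreg]) blast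
  define p where "p = (\<lambda>(x::real) y. x ^ m + (\<Sum>i<m. eval_fps (x_coeff P i) y * x ^ i))"
  have "\<forall>\<^sub>F (x::real, y) in nhds (0, 0). eval2 P x y = p x y"
    unfolding p_def using P by (rule eventually_eval2_monic)
  with eventually_eval2_unit_mult[OF UV(1), of F]
  have "\<forall>\<^sub>F (x::real, y) in nhds (0, 0). eval2 F x y = 0 \<longleftrightarrow> p x y = 0"
    by eventually_elim (auto simp: UV(2))
  then obtain r where r: "r > 0" "\<And>x y :: real. \<bar>x\<bar> < r \<Longrightarrow> \<bar>y\<bar> < r \<Longrightarrow> eval2 F x y = 0 \<longleftrightarrow> p x y = 0"
    unfolding eventually_nhds_00_iff real_norm_def by auto
  obtain K \<epsilon> where cone: "K > 0" "\<epsilon> > 0"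
    "\<And>x y :: real. \<bar>x\<bar> < \<epsilon> \<Longrightarrow> \<bar>y\<bar> < \<epsilon> \<Longrightarrow> eval2 F x y = 0 \<Longrightarrow> \<bar>x\<bar> \<le> K * \<bar>y\<bar>"
    by (rule mini_regular_cone[OF F]) blast
  obtain \<delta>0 where \<delta>0: "\<delta>0 > 0" "puiseux_cover (\<lambda>y x. \<bar>x\<bar> < \<delta>0 \<and> eval2 F x y = 0)"
    using xreg by (rule puiseux_cover_eval2)
  obtain S where S: "finite S" "\<forall>(N, s)\<in>S. N > 0 \<and> germ1 s"
    "\<forall>\<^sub>F y in at_right 0. \<forall>x. \<bar>x\<bar> < \<delta>0 \<and> eval2 F x y = 0 \<longrightarrow> (\<exists>(N, s)\<in>S. x = s (y powr (1 / real N)))"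
    using \<delta>0(2) unfolding puiseux_cover_def by (elim exE conjE)
  define \<delta> where "\<delta> = min \<delta>0 r"
  have \<delta>: "\<delta> > 0" "\<delta> \<le> r" "\<delta> \<le> \<delta>0" using \<delta>0(1) r(1) by (auto simp: \<delta>_def)
  have germp: "germ1 (eval_fps (x_coeff P i))" for i
    unfolding germ1_def using eval_fps_has_fps_expansion[OF fps_conv_radius_x_coeff] ..
  have arc: "\<forall>\<^sub>F y in at_right 0. \<bar>s (y powr (1 / real N))\<bar> < \<delta> \<and>
      eval2 F (s (y powr (1 / real N))) y = 0 \<longrightarrow>
      (\<exists>\<beta>\<in>real_np_roots F. s (y powr (1 / real N)) = real_arc \<beta> y)"
    if Ns: "(N, s) \<in> S" for N s
  proof -
    have N: "N > 0" and gs: "germ1 s" using S(2) Ns by auto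
    \<comment> \<open>Using the Weierstrass polynomial instead of F makes the composite with the arc
      visibly a one-variable germ, to which the dichotomy applies.\<close>
    define h where "h = (\<lambda>u. p (s u) (u ^ N))"
    have gh: "germ1 h" unfolding h_def p_def
      by (intro germ1_add germ1_sum germ1_mult germ1_power gs germ1_compose_power[OF germp N])
    have yN: "(y powr (1 / real N)) ^ N = y" if "y > 0" for y
      using that N by (simp add: powr_power)
    from germ1_dichotomy[OF gh] show ?thesis
    proof
      assume "\<forall>\<^sub>F u in at_right 0. h u \<noteq> 0"
      from eventually_compose_filterlim[OF this root_at_right_0[OF N]] eventually_at_right_real[OF
          r(1)]
      show ?thesis
      proof eventually_elim
        case (elim y)
        have "h (y powr (1 / real N)) = p (s (y powr (1 / real N))) y"
          using elim(2) by (simp add: h_def yN)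
        hence pn: "p (s (y powr (1 / real N))) y \<noteq> 0" using elim(1) by simp
        show ?case
        proof
          assume z: "\<bar>s (y powr (1 / real N))\<bar> < \<delta> \<and> eval2 F (s (y powr (1 / real N))) y = 0"
          hence "p (s (y powr (1 / real N))) y = 0"
            using r(2)[of "s (y powr (1 / real N))" y] elim(2) \<delta>(2) by simp
          with pn show "\<exists>\<beta>\<in>real_np_roots F. s (y powr (1 / real N)) = real_arc \<beta> y" ..
        qed
      qed
    next
      assume h0: "\<forall>\<^sub>F u in at_right 0. h u = 0"
      obtain A where A: "s has_fps_expansion A" using gs unfolding germ1_def ..
      have cont: "(f \<longlongrightarrow> f 0) (at_right 0)" if "germ1 f" for f
      proof -
        have "(f \<longlongrightarrow> f 0) (at 0)" using germ1_imp_isCont[OF that] by (simp add: isCont_def)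
        thus ?thesis by (rule tendsto_mono[OF at_le, rotated]) simp
      qed
      have "(h \<longlongrightarrow> 0) (at_right 0)" using h0 by (rule tendsto_eventually)
      hence "0 = h 0" using cont[OF gh] by (rule tendsto_unique[rotated]) simp
      \<comment> \<open>The lower coefficients of a Weierstrass polynomial vanish at y = 0, so only
        x^m survives; as m > 0 this forces the arc through the origin.\<close>
      moreover have "h 0 = s 0 ^ m"
        using N Plow by (simp add: h_def p_def eval_fps_at_0 x_coeff_def power_0_left)
      ultimately have "s 0 = 0" by simp
      hence slim: "(s \<longlongrightarrow> 0) (at_right 0)" using cont[OF gs] by simp
      have "((\<lambda>u::real. u ^ N) \<longlongrightarrow> 0 ^ N) (at_right 0)" by (intro tendsto_intros tendsto_ident_at)
      hence uN: "((\<lambda>u::real. u ^ N) \<longlongrightarrow> 0) (at_right 0)" using N by (simp add: power_0_left)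
      have sF: "\<forall>\<^sub>F u in at_right 0. eval2 F (s u) (u ^ N) = 0 \<and> \<bar>s u\<bar> \<le> K * u ^ N"
        using h0 order_tendstoD(2)[OF tendsto_rabs_zero[OF slim] r(1)] order_tendstoD(2)[OF
            tendsto_rabs_zero[OF slim] cone(2)]
          order_tendstoD(2)[OF uN r(1)] order_tendstoD(2)[OF uN cone(2)] eventually_at_right_less[of
              0]
      proof eventually_elim
        case (elim u)
        have "eval2 F (s u) (u ^ N) = 0"
          using r(2)[of "s u" "u ^ N"] elim by (simp add: h_def)
        moreover from this have "\<bar>s u\<bar> \<le> K * \<bar>u ^ N\<bar>" by (intro cone(3)) (use elim in auto)
        ultimately show ?case using elim by simp
      qed
      have "\<forall>\<^sub>F u in at_right 0. \<bar>s u\<bar> \<le> K * u ^ N" using sF by (rule eventually_mono) simp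
      hence low: "fps_nth A n = 0" if "n < N" for n
        using eventually_le_power_imp_subdegree[OF A _ that] by simp
      have "fps_conv_radius A > 0" using A by (simp add: has_fps_expansion_def)
      from real_puiseux_of_fps[OF N this low] obtain \<beta> where \<beta>: "puiseux \<beta>" "puiseux_real \<beta>"
        "\<forall>\<^sub>F y in at_right 0. real_arc \<beta> y = eval_fps A (y powr (1 / real N))" by auto
      have "\<forall>\<^sub>F u in nhds 0. eval_fps A u = s u" using A by (simp add: has_fps_expansion_def)
      hence sA: "\<forall>\<^sub>F u in at_right 0. eval_fps A u = s u"
        unfolding eventually_at_filter by (rule eventually_mono) simp
      have arc: "\<forall>\<^sub>F y in at_right 0. s (y powr (1 / real N)) = real_arc \<beta> y"
        using \<beta>(3) eventually_compose_filterlim[OF sA root_at_right_0[OF N]]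
        by eventually_elim simp
      have "\<forall>\<^sub>F y in at_right 0. eval2 F (real_arc \<beta> y) y = 0"
        using arc eventually_compose_filterlim[OF sF root_at_right_0[OF N]]
            eventually_at_right_less[of 0]
        by eventually_elim (simp add: yN)
      hence "np_root F \<beta>" using np_root_real_iff[OF \<beta>(1,2)] by simp
      hence "\<beta> \<in> real_np_roots F" using \<beta>(2) by (simp add: real_np_roots_def)
      thus ?thesis using arc by (auto elim!: eventually_mono)
    qed
  qed
  have fin: "finite (real_np_roots F)"
    by (rule finite_subset[OF _ finite_np_roots[OF xreg]]) (auto simp: real_np_roots_def)
  have zero: "\<forall>\<^sub>F y in at_right 0. \<forall>\<beta>\<in>real_np_roots F. eval2 F (real_arc \<beta> y) y = 0"
  proof (rule eventually_ball_finite[OF fin], rule ballI)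
    fix \<beta> assume "\<beta> \<in> real_np_roots F"
    thus "\<forall>\<^sub>F y in at_right 0. eval2 F (real_arc \<beta> y) y = 0"
      using np_root_real_iff[of \<beta> F] by (simp add: real_np_roots_def np_root_iff)
  qed
  have "\<forall>\<^sub>F y in at_right 0. \<forall>z\<in>S. case z of (N, s) \<Rightarrow> \<bar>s (y powr (1 / real N))\<bar> < \<delta> \<and>
      eval2 F (s (y powr (1 / real N))) y = 0 \<longrightarrow>
      (\<exists>\<beta>\<in>real_np_roots F. s (y powr (1 / real N)) = real_arc \<beta> y)"
    by (rule eventually_ball_finite[OF S(1)]) (use arc in auto)
  with S(3) zero have "\<forall>\<^sub>F y in at_right 0. \<forall>x. \<bar>x\<bar> < \<delta> \<longrightarrow>
     (eval2 F x y = 0 \<longleftrightarrow> (\<exists>\<beta>\<in>real_np_roots F. x = real_arc \<beta> y))"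
  proof eventually_elim
    case (elim y)
    show ?case
    proof (intro allI impI iffI)
      fix x assume x: "\<bar>x\<bar> < \<delta>" "eval2 F x y = 0"
      hence "\<bar>x\<bar> < \<delta>0 \<and> eval2 F x y = 0" using \<delta>(3) by simp
      hence "\<exists>(N, s)\<in>S. x = s (y powr (1 / real N))" using elim(1) by simp
      then obtain z where z: "z \<in> S" "case z of (N, s) \<Rightarrow> x = s (y powr (1 / real N))" ..
      obtain N s where Ns: "z = (N, s)" by (cases z)
      show "\<exists>\<beta>\<in>real_np_roots F. x = real_arc \<beta> y"
        using bspec[OF elim(3) z(1)] z(2) x unfolding Ns prod.case by simp
    next
      fix x assume "\<exists>\<beta>\<in>real_np_roots F. x = real_arc \<beta> y"
      then obtain \<beta> where "\<beta> \<in> real_np_roots F" "x = real_arc \<beta> y" ..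
      thus "eval2 F x y = 0" using elim(2) by simp
    qed
  qed
  with \<delta>(1) show ?thesis by (rule that)
qed

section \<open>Distance to a finite union of arcs\<close>

text \<open>Near the origin and over y > 0, A is a finite union of Lipschitz graphs inside a cone.
  Nothing is said about A in y \<le> 0 beyond the presence of the origin.\<close>

definition branches :: "(real \<times> real) set \<Rightarrow> 'i set \<Rightarrow> ('i \<Rightarrow> real \<Rightarrow> real) \<Rightarrow> bool" where
  "branches A I f \<longleftrightarrow> (0, 0) \<in> A \<and> finite I \<and> (\<exists>K>0. \<exists>\<epsilon>>0.
     (\<forall>i\<in>I. \<forall>y y'. 0 < y \<longrightarrow> y < \<epsilon> \<longrightarrow> 0 < y' \<longrightarrow> y' < \<epsilon> \<longrightarrow> \<bar>f i y - f i y'\<bar> \<le> K * \<bar>y - y'\<bar>) \<and>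
     (\<forall>i\<in>I. \<forall>y. 0 < y \<longrightarrow> y < \<epsilon> \<longrightarrow> \<bar>f i y\<bar> \<le> K * y) \<and>
     (\<forall>x y. \<bar>x\<bar> < \<epsilon> \<longrightarrow> 0 < y \<longrightarrow> y < \<epsilon> \<longrightarrow> ((x, y) \<in> A \<longleftrightarrow> (\<exists>i\<in>I. x = f i y))))"

text \<open>Distances are measured horizontally, which is harmless for Lipschitz graphs. The entry y
  stands for the distance to the origin; without branches it gives order 1, in accordance with the
  convention in \<open>ord_dist\<close>.\<close>

definition branch_dist :: "'i set \<Rightarrow> ('i \<Rightarrow> real \<Rightarrow> real) \<Rightarrow> real \<Rightarrow> real \<Rightarrow> real" where
  "branch_dist I f x y = Min (insert y ((\<lambda>i. \<bar>x - f i y\<bar>) ` I))"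

abbreviation root_dist :: "cps2 \<Rightarrow> real \<Rightarrow> real \<Rightarrow> real" where
  "root_dist F \<equiv> branch_dist (real_np_roots F) real_arc"

lemma branch_dist_le:
  assumes "finite I"
  shows "branch_dist I f x y \<le> y" "i \<in> I \<Longrightarrow> branch_dist I f x y \<le> \<bar>x - f i y\<bar>"
  using assms by (auto simp: branch_dist_def)

lemma branch_dist_cases:
  assumes "finite I"
  obtains "branch_dist I f x y = y" | i where "i \<in> I" "branch_dist I f x y = \<bar>x - f i y\<bar>"
proof -
  have "branch_dist I f x y \<in> insert y ((\<lambda>i. \<bar>x - f i y\<bar>) ` I)"
    unfolding branch_dist_def using assms by (intro Min_in) auto
  thus ?thesis using that by (elim insertE imageE)
qed

lemma branch_dist_nonneg: "finite I \<Longrightarrow> 0 \<le> y \<Longrightarrow> 0 \<le> branch_dist I f x y"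
  by (rule branch_dist_cases[of I f x y]) auto

lemma branch_dist_Lipschitz:
  assumes "finite I"
  shows "branch_dist I f x y \<le> branch_dist I f x' y + \<bar>x - x'\<bar>"
proof (rule branch_dist_cases[OF assms, of f x' y])
  assume "branch_dist I f x' y = y"
  thus ?thesis using branch_dist_le(1)[OF assms, of f x y] by simp
next
  fix i assume "i \<in> I" "branch_dist I f x' y = \<bar>x' - f i y\<bar>"
  thus ?thesis using branch_dist_le(2)[OF assms, of i f x y] by simp
qed

lemma abs_le_norm_Pair:
  fixes x y :: real
  shows "\<bar>x\<bar> \<le> norm (x, y)" "\<bar>y\<bar> \<le> norm (x, y)"
  using norm_fst_le[of x y] norm_snd_le[of y x] by simp_all

lemma norm_Pair_le_abs: "norm (x::real, y::real) \<le> \<bar>x\<bar> + \<bar>y\<bar>"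
  using norm_Pair_le[of x y] by simp

lemma le_infdistI:
  assumes "A \<noteq> {}" "\<And>q. q \<in> A \<Longrightarrow> d \<le> dist p q"
  shows "d \<le> infdist p A"
  using assms unfolding infdist_notempty[OF assms(1)] by (rule cINF_greatest)

text \<open>Two kinds of points of A witness the bound: the origin, at distance at most (1 + K') y
  inside the cone, and the points of the branches at the same height.\<close>

lemma infdist_le_branch_dist:
  assumes "branches A I f" "K' \<ge> 0"
  obtains r where "r > 0"
    "\<And>x y. 0 < y \<Longrightarrow> y < r \<Longrightarrow> \<bar>x\<bar> \<le> K' * y \<Longrightarrow> infdist (x, y) A \<le> (1 + K') * branch_dist I f x y"
proof -
  obtain K \<epsilon> where K: "K > 0" "\<epsilon> > 0" "\<And>i y. i \<in> I \<Longrightarrow> 0 < y \<Longrightarrow> y < \<epsilon> \<Longrightarrow> \<bar>f i y\<bar> \<le> K * y"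
    "\<And>x y. \<bar>x\<bar> < \<epsilon> \<Longrightarrow> 0 < y \<Longrightarrow> y < \<epsilon> \<Longrightarrow> (x, y) \<in> A \<longleftrightarrow> (\<exists>i\<in>I. x = f i y)"
    and A0: "(0, 0) \<in> A" and fin: "finite I"
    using assms(1) unfolding branches_def by (elim conjE exE) metis
  show ?thesis
  proof (rule that[of "min \<epsilon> (\<epsilon> / K)"])
    show "min \<epsilon> (\<epsilon> / K) > 0" using K by simp
    fix x y assume y: "0 < y" "y < min \<epsilon> (\<epsilon> / K)" and x: "\<bar>x\<bar> \<le> K' * y"
    show "infdist (x, y) A \<le> (1 + K') * branch_dist I f x y"
    proof (rule branch_dist_cases[OF fin, of f x y])
      assume "branch_dist I f x y = y"
      moreover have "infdist (x, y) A \<le> norm (x, y)" using infdist_le[OF A0, of "(x, y)"]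
          by (simp add: dist_norm)
      moreover have "norm (x, y) \<le> \<bar>x\<bar> + \<bar>y\<bar>" by (rule norm_Pair_le_abs)
      ultimately show ?thesis using x y by (simp add: algebra_simps)
    next
      fix i assume i: "i \<in> I" "branch_dist I f x y = \<bar>x - f i y\<bar>"
      have "K * y < \<epsilon>" using y K by (simp add: field_simps)
      hence "\<bar>f i y\<bar> < \<epsilon>" using K(3)[OF i(1), of y] y by simp
      hence "(f i y, y) \<in> A" using K(4)[of "f i y" y] y i(1) by auto
      from infdist_le[OF this, of "(x, y)"] have "infdist (x, y) A \<le> \<bar>x - f i y\<bar>"
        by (simp add: dist_Pair_Pair dist_real_def)
      also have "\<dots> \<le> (1 + K') * \<bar>x - f i y\<bar>" using assms(2) by (simp add: algebra_simps)
      finally show ?thesis using i(2) by simp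
    qed
  qed
qed

text \<open>A competitor q in A that is on no branch lies outside the \<epsilon>-square or in the
  closed lower half-plane, and is then at distance at least y. If it is on a branch, the Lipschitz
  bound moves it to height y at the cost of a factor 1 + K.\<close>

lemma infdist_ge_branch_dist:
  assumes "branches A I f"
  obtains c r where "c > 0" "r > 0"
    "\<And>x y. 0 < y \<Longrightarrow> norm (x, y) < r \<Longrightarrow> c * branch_dist I f x y \<le> infdist (x, y) A"
proof -
  obtain K \<epsilon> where K: "K > 0" "\<epsilon> > 0"
    "\<And>i y y'. i \<in> I \<Longrightarrow> 0 < y \<Longrightarrow> y < \<epsilon> \<Longrightarrow> 0 < y' \<Longrightarrow> y' < \<epsilon> \<Longrightarrow> \<bar>f i y - f i y'\<bar> \<le> K * \<bar>y - y'\<bar>"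
    "\<And>x y. \<bar>x\<bar> < \<epsilon> \<Longrightarrow> 0 < y \<Longrightarrow> y < \<epsilon> \<Longrightarrow> (x, y) \<in> A \<longleftrightarrow> (\<exists>i\<in>I. x = f i y)"
    and A0: "(0, 0) \<in> A" and fin: "finite I"
    using assms(1) unfolding branches_def by (elim conjE exE) metis
  show ?thesis
  proof (rule that[of "1 / (1 + K)" "\<epsilon> / 2"])
    show "1 / (1 + K) > 0" "\<epsilon> / 2 > 0" using K by auto
    fix x y :: real assume y: "0 < y" and p: "norm (x, y) < \<epsilon> / 2"
    have main: "branch_dist I f x y \<le> (1 + K) * dist (x, y) q" if q: "q \<in> A" for q
    proof -
      obtain x' y' where q': "q = (x', y')" by (cases q)
      have xy: "\<bar>x - x'\<bar> \<le> dist (x, y) q" "\<bar>y - y'\<bar> \<le> dist (x, y) q"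
        using abs_le_norm_Pair(1)[of "x - x'" "y - y'"] abs_le_norm_Pair(2)[of "y - y'" "x - x'"]
            by (simp_all add: q' dist_norm)
      have far: ?thesis if "y \<le> dist (x, y) q"
      proof -
        have "branch_dist I f x y \<le> y" by (rule branch_dist_le[OF fin])
        also have "y \<le> 1 * dist (x, y) q" using that by simp
        also have "\<dots> \<le> (1 + K) * dist (x, y) q" using K by (intro mult_right_mono) auto
        finally show ?thesis .
      qed
      consider "\<bar>x'\<bar> \<ge> \<epsilon> \<or> y' \<ge> \<epsilon>" | "y' \<le> 0" | "\<bar>x'\<bar> < \<epsilon>" "0 < y'" "y' < \<epsilon>" by linarith
      thus ?thesis
      proof cases
        case 1
        have "\<epsilon> \<le> norm q" using 1 abs_le_norm_Pair(1)[of x' y'] abs_le_norm_Pair(2)[of y' x']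
            by (auto simp: q')
        moreover have "norm q \<le> norm (x, y) + dist (x, y) q"
          using norm_triangle_sub[of q "(x, y)"] by (simp add: dist_norm norm_minus_commute)
        moreover have "y \<le> norm (x, y)" using abs_le_norm_Pair(2)[of y x] y by simp
        ultimately show ?thesis using p by (intro far) linarith
      next
        case 2
        thus ?thesis using xy(2) by (intro far) linarith
      next
        case 3
        then obtain i where i: "i \<in> I" "x' = f i y'" using K(4)[of x' y'] q q' by auto
        have "y < \<epsilon>" using abs_le_norm_Pair(2)[of y x] p K(2) by linarith
        hence "\<bar>f i y - f i y'\<bar> \<le> K * \<bar>y - y'\<bar>" using 3 y by (intro K(3) i)
        also have "\<dots> \<le> K * dist (x, y) q" using xy(2) K(1) by (intro mult_left_mono) auto
        finally have "\<bar>x - f i y\<bar> \<le> (1 + K) * dist (x, y) q"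
          using xy(1) i(2) by (simp add: algebra_simps)
        thus ?thesis using branch_dist_le(2)[OF fin i(1), of f x y] by linarith
      qed
    qed
    show "1 / (1 + K) * branch_dist I f x y \<le> infdist (x, y) A"
    proof (rule le_infdistI)
      show "1 / (1 + K) * branch_dist I f x y \<le> dist (x, y) q" if "q \<in> A" for q
        using main[OF that] K(1) by (simp add: field_simps)
    qed (use A0 in auto)
  qed
qed

text \<open>A point outside the doubled cone cannot be close to a set inside the cone: moving by d
  changes |x| by at most d and K|y| by at most K d, while |x| - K|y| is at least |x| / 2.\<close>

lemma infdist_outside_cone:
  fixes A :: "(real \<times> real) set" and K \<epsilon> :: real
  assumes A0: "(0, 0) \<in> A" and K: "K > 0" and \<epsilon>: "\<epsilon> > 0"
    and cone: "\<And>x y. (x, y) \<in> A \<Longrightarrow> \<bar>x\<bar> < \<epsilon> \<Longrightarrow> \<bar>y\<bar> < \<epsilon> \<Longrightarrow> \<bar>x\<bar> \<le> K * \<bar>y\<bar>"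
  obtains c r where "c > 0" "r > 0"
    "\<And>x y. norm (x, y) < r \<Longrightarrow> 2 * K * \<bar>y\<bar> \<le> \<bar>x\<bar> \<Longrightarrow> c * norm (x, y) \<le> infdist (x, y) A"
proof -
  \<comment> \<open>The factor 2(1 + K) bounds |x| by the distance, and 1 + 1/(2K) bounds the norm
    by |x|.\<close>
  define c where "c = 1 / (2 * (1 + K) * (1 + 1 / (2 * K)))"
  have c: "c > 0" "c \<le> 1"
  proof -
    have "1 * 1 \<le> (2 * (1 + K)) * (1 + 1 / (2 * K))" using K by (intro mult_mono) auto
    thus "c > 0" "c \<le> 1" using K unfolding c_def
        by (auto simp: divide_le_eq_1 intro!: divide_pos_pos mult_pos_pos add_pos_pos)
  qed
  show ?thesis
  proof (rule that[OF c(1), of "\<epsilon> / 2"])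
    fix x y :: real assume p: "norm (x, y) < \<epsilon> / 2" and xy: "2 * K * \<bar>y\<bar> \<le> \<bar>x\<bar>"
    have main: "c * norm (x, y) \<le> dist (x, y) q" if q: "q \<in> A" for q
    proof -
      obtain x' y' where q': "q = (x', y')" by (cases q)
      have d: "\<bar>x - x'\<bar> \<le> dist (x, y) q" "\<bar>y - y'\<bar> \<le> dist (x, y) q"
        using abs_le_norm_Pair(1)[of "x - x'" "y - y'"] abs_le_norm_Pair(2)[of "y - y'" "x - x'"]
            by (simp_all add: q' dist_norm)
      show ?thesis
      proof (cases "\<bar>x'\<bar> < \<epsilon> \<and> \<bar>y'\<bar> < \<epsilon>")
        case False
        have "\<epsilon> \<le> norm q" using False abs_le_norm_Pair(1)[of x' y'] abs_le_norm_Pair(2)[of y' x']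
            by (auto simp: q')
        moreover have "norm q \<le> norm (x, y) + dist (x, y) q"
          using norm_triangle_sub[of q "(x, y)"] by (simp add: dist_norm norm_minus_commute)
        ultimately have "norm (x, y) \<le> dist (x, y) q" using p by linarith
        moreover have "c * norm (x, y) \<le> 1 * norm (x, y)" using c by (intro mult_right_mono) auto
        ultimately show ?thesis by linarith
      next
        case True
        hence "\<bar>x'\<bar> \<le> K * \<bar>y'\<bar>" using cone[of x' y'] q q' by simp
        also have "\<dots> \<le> K * (\<bar>y\<bar> + dist (x, y) q)" using d(2) K by (intro mult_left_mono) auto
        finally have "\<bar>x\<bar> - K * \<bar>y\<bar> \<le> (1 + K) * dist (x, y) q"
          using d(1) by (simp add: algebra_simps)
        hence 1: "\<bar>x\<bar> \<le> 2 * (1 + K) * dist (x, y) q" using xy by (simp add: algebra_simps)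
        have "\<bar>y\<bar> \<le> 1 / (2 * K) * \<bar>x\<bar>" using xy K by (simp add: field_simps)
        hence "norm (x, y) \<le> (1 + 1 / (2 * K)) * \<bar>x\<bar>"
          using norm_Pair_le_abs[of x y] by (simp add: algebra_simps)
        also have "\<dots> \<le> (1 + 1 / (2 * K)) * (2 * (1 + K) * dist (x, y) q)"
          using 1 K by (intro mult_left_mono) auto
        finally have 2: "norm (x, y) \<le> (2 * (1 + K) * (1 + 1 / (2 * K))) * dist (x, y) q"
          by (simp only: mult_ac)
        have "2 * (1 + K) * (1 + 1 / (2 * K)) > 0" using K by (intro mult_pos_pos add_pos_pos) auto
        thus ?thesis using 2 unfolding c_def by (simp add: pos_divide_le_eq mult.commute)
      qed
    qed
    show "c * norm (x, y) \<le> infdist (x, y) A"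
      by (rule le_infdistI[OF _ main]) (use A0 in auto)
  qed (use \<epsilon> in simp)
qed

section \<open>Zero sets of germs\<close>

definition zero_germ :: "(real \<times> real) set \<Rightarrow> cps2 \<Rightarrow> bool" where
  "zero_germ A F \<longleftrightarrow> (\<exists>r>0. \<forall>x y. \<bar>x\<bar> < r \<longrightarrow> \<bar>y\<bar> < r \<longrightarrow> ((x, y) \<in> A \<longleftrightarrow> eval2 F x y = 0))"

lemma real_np_roots_puiseux:
  assumes "\<beta> \<in> real_np_roots F"
  shows "puiseux \<beta>" "puiseux_real \<beta>"
  using assms by (simp_all add: real_np_roots_def np_root_def)

lemma finite_real_np_roots: "x_regular F m \<Longrightarrow> finite (real_np_roots F)"
  by (rule finite_subset[OF _ finite_np_roots]) (auto simp: real_np_roots_def)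

lemma branchesI:
  assumes A0: "(0, 0) \<in> A" and fin: "finite I" and pui: "\<And>\<beta>. \<beta> \<in> I \<Longrightarrow> puiseux \<beta>"
    and \<delta>: "\<delta> > 0" and A: "\<forall>\<^sub>F y in at_right 0. \<forall>x. \<bar>x\<bar> < \<delta> \<longrightarrow> ((x, y) \<in> A \<longleftrightarrow> (\<exists>\<beta>\<in>I. x =
        real_arc \<beta> y))"
  shows "branches A I real_arc"
proof -
  let ?P = "\<lambda>\<beta> K \<epsilon>. \<beta> \<in> I \<longrightarrow> K > 0 \<and> \<epsilon> > 0 \<and>
    (\<forall>y y'. 0 < y \<longrightarrow> y < \<epsilon> \<longrightarrow> 0 < y' \<longrightarrow> y' < \<epsilon> \<longrightarrow> \<bar>real_arc \<beta> y - real_arc \<beta> y'\<bar> \<le> K * \<bar>y - y'\<bar>) \<and>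
    (\<forall>y. 0 < y \<longrightarrow> y < \<epsilon> \<longrightarrow> \<bar>real_arc \<beta> y\<bar> \<le> K * y)"
  have "\<forall>\<beta>. \<exists>K. \<exists>\<epsilon>. ?P \<beta> K \<epsilon>"
  proof
    fix \<beta>
    show "\<exists>K. \<exists>\<epsilon>. ?P \<beta> K \<epsilon>"
    proof (cases "\<beta> \<in> I")
      case True
      obtain K \<epsilon> where "K > 0" "\<epsilon> > 0"
        "\<And>y y'. 0 < y \<Longrightarrow> y < \<epsilon> \<Longrightarrow> 0 < y' \<Longrightarrow> y' < \<epsilon> \<Longrightarrow>
       \<bar>real_arc \<beta> y - real_arc \<beta> y'\<bar> \<le> K * \<bar>y - y'\<bar>"
    "\<And>y. 0 < y \<Longrightarrow> y < \<epsilon> \<Longrightarrow> \<bar>real_arc \<beta> y\<bar> \<le> K * y"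
        by (rule real_arc_Lipschitz[OF pui[OF True]]) blast
      thus ?thesis by (intro exI[of _ K] exI[of _ \<epsilon>] impI conjI allI) auto
    qed simp
  qed
  then obtain K where "\<forall>\<beta>. \<exists>\<epsilon>. ?P \<beta> (K \<beta>) \<epsilon>"
    by (rule choice[THEN exE])
  then obtain \<epsilon> where *: "\<forall>\<beta>. ?P \<beta> (K \<beta>) (\<epsilon> \<beta>)"
    by (rule choice[THEN exE])
  have pos: "K \<beta> > 0" "\<epsilon> \<beta> > 0" if "\<beta> \<in> I" for \<beta> using spec[OF *, of \<beta>] that by simp_all
  have Lip: "\<bar>real_arc \<beta> y - real_arc \<beta> y'\<bar> \<le> K \<beta> * \<bar>y - y'\<bar>"
    if "\<beta> \<in> I" "0 < y" "y < \<epsilon> \<beta>" "0 < y'" "y' < \<epsilon> \<beta>" for \<beta> y y' using spec[OF *, of \<beta>] that by simp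
  have bnd: "\<bar>real_arc \<beta> y\<bar> \<le> K \<beta> * y" if "\<beta> \<in> I" "0 < y" "y < \<epsilon> \<beta>" for \<beta> y
      using spec[OF *, of \<beta>] that by simp
  obtain e where e: "e > 0" "\<And>y x. 0 < y \<Longrightarrow> y < e \<Longrightarrow> \<bar>x\<bar> < \<delta> \<Longrightarrow> ((x, y) \<in> A \<longleftrightarrow> (\<exists>\<beta>\<in>I. x =
      real_arc \<beta> y))"
    using A unfolding eventually_at_right_field by auto
  \<comment> \<open>A common bound for all the constants; the summand 1 keeps it positive when there
    are no branches.\<close>
  define M where "M = 1 + (\<Sum>\<beta>\<in>I. K \<beta>)"
  define d where "d = Min (insert \<delta> (insert e (\<epsilon> ` I)))"
  have d: "d \<le> z" if "z \<in> insert \<delta> (insert e (\<epsilon> ` I))" for z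
    unfolding d_def using fin that by (intro Min_le) auto
  have "d \<in> insert \<delta> (insert e (\<epsilon> ` I))" unfolding d_def using fin by (intro Min_in) auto
  hence d0: "d > 0" using \<delta> e(1) pos by auto
  have d: "d > 0" "d \<le> \<delta>" "d \<le> e" "\<And>\<beta>. \<beta> \<in> I \<Longrightarrow> d \<le> \<epsilon> \<beta>"
    using d0 d by auto
  have KM: "K \<beta> \<le> M" if "\<beta> \<in> I" for \<beta>
    using member_le_sum[of \<beta> I K] that fin pos by (simp add: M_def less_imp_le)
  have "(\<Sum>\<beta>\<in>I. K \<beta>) \<ge> 0" using pos by (intro sum_nonneg) (simp add: less_imp_le)
  hence M: "M > 0" by (simp add: M_def)
  show ?thesis unfolding branches_def
  proof (intro conjI A0 fin, rule exI[of _ M], intro conjI M, rule exI[of _ d], intro conjI d(1)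
      ballI allI impI)
    fix \<beta> y y' assume "\<beta> \<in> I" "0 < y" "y < d" "0 < y'" "y' < d"
    hence "\<bar>real_arc \<beta> y - real_arc \<beta> y'\<bar> \<le> K \<beta> * \<bar>y - y'\<bar>"
      using d(4)[of \<beta>] by (intro Lip) auto
    also have "\<dots> \<le> M * \<bar>y - y'\<bar>" using KM \<open>\<beta> \<in> I\<close> by (intro mult_right_mono) auto
    finally show "\<bar>real_arc \<beta> y - real_arc \<beta> y'\<bar> \<le> M * \<bar>y - y'\<bar>" .
  next
    fix \<beta> y assume "\<beta> \<in> I" "0 < y" "y < d"
    hence "\<bar>real_arc \<beta> y\<bar> \<le> K \<beta> * y" using d(4)[of \<beta>] by (intro bnd) auto
    also have "\<dots> \<le> M * y" using KM \<open>\<beta> \<in> I\<close> \<open>0 < y\<close> by (intro mult_right_mono) auto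
    finally show "\<bar>real_arc \<beta> y\<bar> \<le> M * y" .
  next
    fix x y assume "\<bar>x\<bar> < d" "0 < y" "y < d"
    thus "(x, y) \<in> A \<longleftrightarrow> (\<exists>\<beta>\<in>I. x = real_arc \<beta> y)" using d(2,3) by (intro e(2)) auto
  qed
qed

lemma zero_germ_eventually:
  assumes "zero_germ A F" "mini_regular F m" "m > 0"
  obtains \<delta> where "\<delta> > 0" "\<forall>\<^sub>F y in at_right 0. \<forall>x. \<bar>x\<bar> < \<delta> \<longrightarrow>
    ((x, y) \<in> A \<longleftrightarrow> (\<exists>\<beta>\<in>real_np_roots F. x = real_arc \<beta> y))"
proof -
  obtain r where r: "r > 0" "\<And>x y. \<bar>x\<bar> < r \<Longrightarrow> \<bar>y\<bar> < r \<Longrightarrow> (x, y) \<in> A \<longleftrightarrow> eval2 F x y = 0"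
    using assms(1) unfolding zero_germ_def by auto
  obtain \<delta> where \<delta>: "\<delta> > 0" "\<forall>\<^sub>F y in at_right 0. \<forall>x. \<bar>x\<bar> < \<delta> \<longrightarrow>
     (eval2 F x y = 0 \<longleftrightarrow> (\<exists>\<beta>\<in>real_np_roots F. x = real_arc \<beta> y))"
    by (rule mini_regular_real_zeros[OF assms(2,3)])
  show ?thesis
  proof (rule that[of "min r \<delta>"])
    show "\<forall>\<^sub>F y in at_right 0. \<forall>x. \<bar>x\<bar> < min r \<delta> \<longrightarrow>
      ((x, y) \<in> A \<longleftrightarrow> (\<exists>\<beta>\<in>real_np_roots F. x = real_arc \<beta> y))"
      using \<delta>(2) eventually_at_right_real[OF r(1)] by eventually_elim (use r(2) in auto)
  qed (use \<delta> r in auto)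
qed

lemma zero_germ_branches:
  assumes "(0, 0) \<in> A" "zero_germ A F" "mini_regular F m" "m > 0"
  shows "branches A (real_np_roots F) real_arc"
proof -
  obtain \<delta> where \<delta>: "\<delta> > 0" "\<forall>\<^sub>F y in at_right 0. \<forall>x. \<bar>x\<bar> < \<delta> \<longrightarrow>
    ((x, y) \<in> A \<longleftrightarrow> (\<exists>\<beta>\<in>real_np_roots F. x = real_arc \<beta> y))"
    by (rule zero_germ_eventually[OF assms(2-4)])
  show ?thesis
    by (rule branchesI[OF assms(1) finite_real_np_roots[OF mini_regular_imp_x_regular[OF assms(3)]]
        _ \<delta>])
       (rule real_np_roots_puiseux)
qed

lemma real_arc_neq:
  assumes "puiseux \<phi>" "puiseux \<psi>" "puiseux_real \<phi>" "puiseux_real \<psi>" "\<phi> \<noteq> \<psi>"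
  shows "\<forall>\<^sub>F y in at_right 0. real_arc \<phi> y \<noteq> real_arc \<psi> y"
  using eventually_puiseux_eval_neq[OF assms(1,2,5)]
  by (rule eventually_mono) (simp add: puiseux_eval_real assms(3,4))

text \<open>Distinct real roots have disjoint arcs for small y > 0, so a common zero lies on an arc
  that is a root of both series.\<close>

lemma zero_germ_branches_Int:
  assumes A: "(0, 0) \<in> A" "zero_germ A F" "mini_regular F m" "m > 0"
    and B: "(0, 0) \<in> B" "zero_germ B G" "mini_regular G n" "n > 0"
  shows "branches (A \<inter> B) (real_np_roots F \<inter> real_np_roots G) real_arc"
proof -
  obtain \<delta> where \<delta>: "\<delta> > 0" "\<forall>\<^sub>F y in at_right 0. \<forall>x. \<bar>x\<bar> < \<delta> \<longrightarrow>
    ((x, y) \<in> A \<longleftrightarrow> (\<exists>\<beta>\<in>real_np_roots F. x = real_arc \<beta> y))"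
    by (rule zero_germ_eventually[OF A(2-4)])
  obtain \<delta>' where \<delta>': "\<delta>' > 0" "\<forall>\<^sub>F y in at_right 0. \<forall>x. \<bar>x\<bar> < \<delta>' \<longrightarrow>
    ((x, y) \<in> B \<longleftrightarrow> (\<exists>\<beta>\<in>real_np_roots G. x = real_arc \<beta> y))"
    by (rule zero_germ_eventually[OF B(2-4)])
  have fin: "finite (real_np_roots F)" "finite (real_np_roots G)"
    using A(3) B(3) by (auto intro: finite_real_np_roots mini_regular_imp_x_regular)
  have "\<forall>\<^sub>F y in at_right 0. \<forall>\<beta>\<in>real_np_roots F. \<forall>\<gamma>\<in>real_np_roots G. \<beta> =
      \<gamma> \<or> real_arc \<beta> y \<noteq> real_arc \<gamma> y"
  proof (intro eventually_ball_finite fin ballI)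
    fix \<beta> \<gamma> assume "\<beta> \<in> real_np_roots F" "\<gamma> \<in> real_np_roots G"
    thus "\<forall>\<^sub>F y in at_right 0. \<beta> = \<gamma> \<or> real_arc \<beta> y \<noteq> real_arc \<gamma> y"
      using real_arc_neq[of \<beta> \<gamma>] real_np_roots_puiseux[of \<beta> F] real_np_roots_puiseux[of \<gamma> G]
      by (cases "\<beta> = \<gamma>") auto
  qed
  with \<delta>(2) \<delta>'(2) have "\<forall>\<^sub>F y in at_right 0. \<forall>x. \<bar>x\<bar> < min \<delta> \<delta>' \<longrightarrow>
    ((x, y) \<in> A \<inter> B \<longleftrightarrow> (\<exists>\<beta>\<in>real_np_roots F \<inter> real_np_roots G. x = real_arc \<beta> y))"
  proof eventually_elim
    case (elim y)
    show ?case
    proof (intro allI impI)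
      fix x assume "\<bar>x\<bar> < min \<delta> \<delta>'"
      hence "(x, y) \<in> A \<inter> B \<longleftrightarrow> (\<exists>\<beta>\<in>real_np_roots F. x = real_arc \<beta> y) \<and> (\<exists>\<beta>\<in>real_np_roots G. x =
          real_arc \<beta> y)"
        using elim(1,2) by simp
      also have "\<dots> \<longleftrightarrow> (\<exists>\<beta>\<in>real_np_roots F \<inter> real_np_roots G. x = real_arc \<beta> y)"
      proof
        assume "(\<exists>\<beta>\<in>real_np_roots F. x = real_arc \<beta> y) \<and> (\<exists>\<beta>\<in>real_np_roots G. x = real_arc \<beta> y)"
        then obtain \<beta> \<gamma> where *: "\<beta> \<in> real_np_roots F" "x = real_arc \<beta> y" "\<gamma> \<in> real_np_roots G" "x =
            real_arc \<gamma> y"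
          by (elim conjE bexE)
        have "\<beta> = \<gamma>" using bspec[OF bspec[OF elim(3) *(1)] *(3)] *(2,4) by simp
        thus "\<exists>\<beta>\<in>real_np_roots F \<inter> real_np_roots G. x = real_arc \<beta> y"
          using * by (intro bexI[of _ \<beta>]) auto
      qed auto
      finally show "(x, y) \<in> A \<inter> B \<longleftrightarrow> (\<exists>\<beta>\<in>real_np_roots F \<inter> real_np_roots G. x = real_arc \<beta> y)" .
    qed
  qed
  moreover have "min \<delta> \<delta>' > 0" using \<delta> \<delta>' by simp
  ultimately show ?thesis
    using A(1) B(1) fin real_np_roots_puiseux(1) by (intro branchesI[of _ _ "min \<delta> \<delta>'"]) auto
qed

section \<open>Contact orders\<close>

lemma puiseux_ordD:
  assumes "puiseux \<psi>" "puiseux_ord \<psi> = ereal (of_rat \<rho>)"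
  shows "\<rho> \<ge> 1" "\<psi> \<rho> \<noteq> 0" "\<And>q. q < \<rho> \<Longrightarrow> \<psi> q = 0"
proof -
  have "\<psi> \<noteq> (\<lambda>_. 0)" using assms(2) by (auto simp: puiseux_ord_def)
  then obtain \<rho>' where \<rho>': "\<rho>' \<ge> 1" "\<psi> \<rho>' \<noteq> 0" "\<And>q. q < \<rho>' \<Longrightarrow> \<psi> q = 0" "puiseux_ord \<psi> =
      ereal (of_rat \<rho>')"
    using puiseux_leading[OF assms(1)] by metis
  have "\<rho>' = \<rho>" using \<rho>'(4) assms(2) by simp
  thus "\<rho> \<ge> 1" "\<psi> \<rho> \<noteq> 0" "\<And>q. q < \<rho> \<Longrightarrow> \<psi> q = 0" using \<rho>'(1-3) by simp_all
qed

text \<open>The new exponent \<rho> has to lie in the lattice (1/N) Z for a common denominator N. It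
  does, because the difference of the two series has a nonzero coefficient there.\<close>

lemma puiseux_approximation:
  assumes \<phi>: "puiseux \<phi>" and \<psi>: "puiseux \<psi>"
      and ord: "puiseux_ord (\<lambda>q. \<phi> q - \<psi> q) = ereal (of_rat \<rho>)"
  shows "puiseux (approximation \<phi> \<rho> c)"
proof -
  obtain N where N: "puiseux_denom N \<phi>" "puiseux_denom N \<psi>" by (rule puiseux_denom_common[OF \<phi> \<psi>])
  have N0: "N > 0" using N by (simp add: puiseux_denom_def)
  have "\<phi> \<rho> - \<psi> \<rho> \<noteq> 0" using puiseux_ordD(2)[OF puiseux_diff[OF \<phi> \<psi>] ord] .
  hence "\<rho> \<in> {of_nat n / of_nat N | n. N \<le> n}"
    using puiseux_denom_diff[OF N] unfolding puiseux_denom_def by auto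
  moreover have "{q. approximation \<phi> \<rho> c q \<noteq> 0} \<subseteq> {q. \<phi> q \<noteq> 0} \<union> {\<rho>}"
    by (auto simp: approximation_def)
  moreover have "{q. \<phi> q \<noteq> 0} \<subseteq> {of_nat n / of_nat N | n. N \<le> n}"
    using N(1) by (simp add: puiseux_denom_def)
  ultimately have supp: "{q. approximation \<phi> \<rho> c q \<noteq> 0} \<subseteq> {of_nat n / of_nat N | n. N \<le> n}" by auto
  obtain C R where CR: "R > 0" "\<And>n. norm (\<phi> (of_nat n / of_nat N)) \<le> C * R ^ n"
    using N(1) unfolding puiseux_denom_def fps_conv_radius_pos_iff by auto
  have C: "C \<ge> 0" using CR(2)[of 0] by (simp add: order_trans[OF norm_ge_zero])
  define S where "S = max 1 R"
  have "norm (approximation \<phi> \<rho> c (of_nat n / of_nat N)) \<le> (C + \<bar>c\<bar>) * S ^ n" for n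
  proof -
    have "norm (approximation \<phi> \<rho> c q) \<le> norm (\<phi> q) + \<bar>c\<bar>" for q by (simp add: approximation_def)
    hence "norm (approximation \<phi> \<rho> c (of_nat n / of_nat N)) \<le> C * R ^ n + \<bar>c\<bar>"
      using CR(2)[of n] by (rule order_trans[OF _ add_right_mono])
    also have "\<dots> \<le> C * S ^ n + \<bar>c\<bar> * S ^ n"
    proof (rule add_mono)
      show "C * R ^ n \<le> C * S ^ n" using C CR(1)
          by (intro mult_left_mono power_mono) (auto simp: S_def)
      have "\<bar>c\<bar> * 1 \<le> \<bar>c\<bar> * S ^ n" by (intro mult_left_mono one_le_power) (auto simp: S_def)
      thus "\<bar>c\<bar> \<le> \<bar>c\<bar> * S ^ n" by simp
    qed
    finally show ?thesis by (simp add: distrib_right)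
  qed
  hence "fps_conv_radius (Abs_fps (\<lambda>n. approximation \<phi> \<rho> c (of_nat n / of_nat N))) > 0"
    unfolding fps_conv_radius_pos_iff by (intro exI[of _ "C + \<bar>c\<bar>"] exI[of _ S]) (auto simp: S_def)
  hence "puiseux_denom N (approximation \<phi> \<rho> c)" using supp N0 by (simp add: puiseux_denom_def)
  thus ?thesis unfolding puiseux_iff_denom ..
qed

text \<open>If \<phi> and \<beta> agree below \<rho>, the coefficient at \<rho> is the first
  difference, by genericity of c. If they differ earlier, the truncation leaves the first difference
  untouched.\<close>

lemma puiseux_ord_approximation:
  assumes "puiseux \<phi>" "puiseux \<beta>" "\<beta> \<rho> \<noteq> of_real c"
  shows "puiseux_ord (\<lambda>q. approximation \<phi> \<rho> c q - \<beta> q) =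
    min (puiseux_ord (\<lambda>q. \<phi> q - \<beta> q)) (ereal (of_rat \<rho>))"
proof (cases "\<forall>q<\<rho>. \<phi> q - \<beta> q = 0")
  case True
  have "puiseux_ord (\<lambda>q. approximation \<phi> \<rho> c q - \<beta> q) = ereal (of_rat \<rho>)"
    by (rule puiseux_ordI) (use assms(3) True in \<open>auto simp: approximation_def\<close>)
  moreover have "ereal (of_rat \<rho>) \<le> puiseux_ord (\<lambda>q. \<phi> q - \<beta> q)"
  proof (cases "(\<lambda>q. \<phi> q - \<beta> q) = (\<lambda>_. 0)")
    case False
    then obtain \<tau> where \<tau>: "\<phi> \<tau> - \<beta> \<tau> \<noteq> 0" "puiseux_ord (\<lambda>q. \<phi> q - \<beta> q) = ereal (of_rat \<tau>)"
      using puiseux_leading[OF puiseux_diff[OF assms(1,2)]] by metis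
    hence "\<not> \<tau> < \<rho>" using True by blast
    thus ?thesis using \<tau>(2) by (simp add: of_rat_less_eq)
  next
    case True
    hence "\<forall>q. \<phi> q - \<beta> q = 0" by metis
    thus ?thesis by (simp add: puiseux_ord_def)
  qed
  ultimately show ?thesis by (simp add: min_def)
next
  case False
  hence "(\<lambda>q. \<phi> q - \<beta> q) \<noteq> (\<lambda>_. 0)" by (auto simp: fun_eq_iff)
  then obtain \<tau> where \<tau>: "\<phi> \<tau> - \<beta> \<tau> \<noteq> 0" "\<And>q. q < \<tau> \<Longrightarrow> \<phi> q - \<beta> q = 0"
    "puiseux_ord (\<lambda>q. \<phi> q - \<beta> q) = ereal (of_rat \<tau>)"
    using puiseux_leading[OF puiseux_diff[OF assms(1,2)]] by metis
  obtain q where "q < \<rho>" "\<phi> q - \<beta> q \<noteq> 0" using False by blast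
  hence \<tau>\<rho>: "\<tau> < \<rho>" using \<tau>(2)[of q] by (meson not_less le_less_trans)
  have "puiseux_ord (\<lambda>q. approximation \<phi> \<rho> c q - \<beta> q) = ereal (of_rat \<tau>)"
    by (rule puiseux_ordI) (use \<tau>(1,2) \<tau>\<rho> in \<open>auto simp: approximation_def\<close>)
  thus ?thesis using \<tau>(3) \<tau>\<rho> by (simp add: min_def of_rat_less_eq)
qed

lemma root_approximationsE:
  assumes "\<gamma> \<in> root_approximations H"
  obtains \<phi>\<^sub>1 \<phi>\<^sub>2 \<rho> where "np_root H \<phi>\<^sub>1" "np_root H \<phi>\<^sub>2" "puiseux_ord (\<lambda>q. \<phi>\<^sub>1 q - \<phi>\<^sub>2 q) =
      ereal (of_rat \<rho>)" "\<rho> \<ge> 1"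
    "puiseux \<gamma>" "puiseux_real \<gamma>" "\<not> np_root H \<gamma>"
    "\<And>\<beta>. np_root H \<beta> \<Longrightarrow> puiseux_ord (\<lambda>q. \<gamma> q - \<beta> q) =
        min (puiseux_ord (\<lambda>q. \<phi>\<^sub>1 q - \<beta> q)) (ereal (of_rat \<rho>))"
proof -
  obtain \<phi>\<^sub>1 \<phi>\<^sub>2 \<rho> c where \<gamma>: "\<gamma> = approximation \<phi>\<^sub>1 \<rho> c" and *: "np_root H \<phi>\<^sub>1" "np_root H \<phi>\<^sub>2"
    "puiseux_ord (\<lambda>q. \<phi>\<^sub>1 q - \<phi>\<^sub>2 q) = ereal (of_rat \<rho>)" and c: "c \<notin> exceptional_values H \<rho>"
    and real: "puiseux_real (approximation \<phi>\<^sub>1 \<rho> c)"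
    using assms unfolding root_approximations_def by blast
  have p: "puiseux \<phi>\<^sub>1" "puiseux \<phi>\<^sub>2" using * by (simp_all add: np_root_def)
  have exc: "\<beta> \<rho> \<noteq> of_real c" if "np_root H \<beta>" for \<beta>
    using c that unfolding exceptional_values_def by blast
  show ?thesis
  proof (rule that[OF *])
    show "\<rho> \<ge> 1" by (rule puiseux_ordD(1)[OF puiseux_diff[OF p] *(3)])
    show "puiseux \<gamma>" unfolding \<gamma> by (rule puiseux_approximation[OF p *(3)])
    show "puiseux_real \<gamma>" unfolding \<gamma> by (rule real)
    show "\<not> np_root H \<gamma>"
    proof
      assume "np_root H \<gamma>"
      moreover have "\<gamma> \<rho> = of_real c" by (simp add: \<gamma> approximation_def)
      ultimately show False using exc by simp
    qed
    fix \<beta> assume "np_root H \<beta>"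
    thus "puiseux_ord (\<lambda>q. \<gamma> q - \<beta> q) = min (puiseux_ord (\<lambda>q. \<phi>\<^sub>1 q - \<beta> q)) (ereal (of_rat \<rho>))"
      unfolding \<gamma> by (intro puiseux_ord_approximation p exc) (simp_all add: np_root_def)
  qed
qed

text \<open>There may be infinitely many approximations, one for each generic c, but their contact
  orders with a root are minima of two contact orders between roots, hence finite in number. This
  gives \<open>Max\<close> in \<open>exponent_plus\<close> its meaning.\<close>

lemma finite_contact_ratios:
  assumes fin: "finite {\<phi>. np_root (F * G) \<phi>}"
      and gcd: "real_np_roots (gcd2 F G) = real_np_roots F \<inter> real_np_roots G"
  shows "finite (contact_ratio F G ` root_approximations (F * G))"
proof -
  let ?R = "{\<phi>. np_root (F * G) \<phi>}"
  \<comment> \<open>All values that \<open>ord_dist\<close> can take along an approximation; the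
    entry 1 is the convention for series without real roots.\<close>
  define W where "W = insert 1 ((\<lambda>(\<phi>\<^sub>1, \<phi>\<^sub>2, \<beta>). min (puiseux_ord (\<lambda>q. \<phi>\<^sub>1 q - \<beta> q)) (puiseux_ord
      (\<lambda>q. \<phi>\<^sub>1 q - \<phi>\<^sub>2 q))) ` (?R \<times> ?R \<times> ?R))"
  have finW: "finite W" unfolding W_def using fin
      by (intro finite.insertI finite_imageI finite_cartesian_product)
  have W: "ord_dist \<gamma> H \<in> W" if \<gamma>: "\<gamma> \<in> root_approximations (F * G)" and H: "real_np_roots H \<subseteq> ?R"
      for \<gamma> H
  proof (cases "real_np_roots H = {}")
    case False
    have "finite (real_np_roots H)" using H fin by (rule finite_subset)
    hence "Max ((\<lambda>\<beta>. puiseux_ord (\<lambda>q. \<gamma> q - \<beta> q)) ` real_np_roots H) \<in> (\<lambda>\<beta>. puiseux_ord (\<lambda>q. \<gamma> q - \<beta>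
        q)) ` real_np_roots H"
      using False by (intro Max_in) auto
    then obtain \<beta> where \<beta>: "\<beta> \<in> real_np_roots H" "ord_dist \<gamma> H = puiseux_ord (\<lambda>q. \<gamma> q - \<beta> q)"
      using False by (auto simp: ord_dist_def)
    have \<beta>R: "np_root (F * G) \<beta>" using \<beta>(1) H by auto
    obtain \<phi>\<^sub>1 \<phi>\<^sub>2 \<rho> where *: "np_root (F * G) \<phi>\<^sub>1" "np_root (F * G) \<phi>\<^sub>2"
        "puiseux_ord (\<lambda>q. \<phi>\<^sub>1 q - \<phi>\<^sub>2 q) = ereal (of_rat \<rho>)"
      "\<And>\<beta>. np_root (F * G) \<beta> \<Longrightarrow> puiseux_ord (\<lambda>q. \<gamma> q - \<beta> q) =
          min (puiseux_ord (\<lambda>q. \<phi>\<^sub>1 q - \<beta> q)) (ereal (of_rat \<rho>))"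
      using \<gamma> by (rule root_approximationsE) blast
    have "ord_dist \<gamma> H = (\<lambda>(\<phi>\<^sub>1, \<phi>\<^sub>2, \<beta>). min (puiseux_ord (\<lambda>q. \<phi>\<^sub>1 q - \<beta> q)) (puiseux_ord (\<lambda>q. \<phi>\<^sub>1
        q - \<phi>\<^sub>2 q))) (\<phi>\<^sub>1, \<phi>\<^sub>2, \<beta>)"
      using \<beta>(2) *(3) *(4)[OF \<beta>R] by simp
    moreover have "(\<phi>\<^sub>1, \<phi>\<^sub>2, \<beta>) \<in> ?R \<times> ?R \<times> ?R" using * \<beta>R by simp
    ultimately show ?thesis unfolding W_def by (intro insertI2 image_eqI)
  qed (simp add: ord_dist_def W_def)
  have sub: "real_np_roots F \<subseteq> ?R" "real_np_roots G \<subseteq> ?R" "real_np_roots (gcd2 F G) \<subseteq> ?R"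
    unfolding gcd by (auto simp: real_np_roots_def intro: np_root_dvd[of F "F * G"] np_root_dvd[of G
        "F * G"])
  have "contact_ratio F G ` root_approximations (F * G) \<subseteq> (\<lambda>(a, b, c). min a b / c) ` (W \<times> W \<times> W)"
  proof
    fix z assume "z \<in> contact_ratio F G ` root_approximations (F * G)"
    then obtain \<gamma> where \<gamma>: "\<gamma> \<in> root_approximations (F * G)" "z = contact_ratio F G \<gamma>" by auto
    have "(ord_dist \<gamma> F, ord_dist \<gamma> G, ord_dist \<gamma> (gcd2 F G)) \<in> W \<times> W \<times> W"
      using W[OF \<gamma>(1)] sub by simp
    thus "z \<in> (\<lambda>(a, b, c). min a b / c) ` (W \<times> W \<times> W)"
      by (rule rev_image_eqI) (simp add: \<gamma>(2) contact_ratio_def)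
  qed
  thus ?thesis by (rule finite_subset) (intro finite_imageI finite_cartesian_product finW)
qed

text \<open>Along the arc each root is at a distance comparable with y to the contact order, so the
  largest order gives the smallest distance. The entry y has exponent 1 and never undercuts it by
  more than a constant, as all contact orders are at least 1.\<close>

lemma ord_dist_asymptotics:
  assumes \<gamma>: "puiseux \<gamma>" "puiseux_real \<gamma>" "\<gamma> \<notin> real_np_roots H" and fin: "finite (real_np_roots H)"
  obtains a where "ord_dist \<gamma> H = ereal a" "a \<ge> 1"
    "\<exists>c>0. \<forall>\<^sub>F y in at_right 0. c * y powr a \<le> root_dist H (real_arc \<gamma> y) y"
    "\<exists>C>0. \<forall>\<^sub>F y in at_right 0. root_dist H (real_arc \<gamma> y) y \<le> C * y powr a"
proof -
  let ?I = "real_np_roots H"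
  let ?D = "\<lambda>y. root_dist H (real_arc \<gamma> y) y"
  have "\<forall>\<beta>\<in>?I. \<exists>\<rho>. \<rho> \<ge> 1 \<and> puiseux_ord (\<lambda>q. \<gamma> q - \<beta> q) = ereal (of_rat \<rho>)"
  proof
    fix \<beta> assume \<beta>: "\<beta> \<in> ?I"
    have "(\<lambda>q. \<gamma> q - \<beta> q) \<noteq> (\<lambda>_. 0)"
    proof
      assume "(\<lambda>q. \<gamma> q - \<beta> q) = (\<lambda>_. 0)"
      hence "\<gamma> = \<beta>" by (auto simp: fun_eq_iff)
      thus False using \<gamma>(3) \<beta> by simp
    qed
    then obtain \<rho> where "\<rho> \<ge> 1" "puiseux_ord (\<lambda>q. \<gamma> q - \<beta> q) = ereal (of_rat \<rho>)"
      by (rule puiseux_leading[OF puiseux_diff[OF \<gamma>(1) real_np_roots_puiseux(1)[OF \<beta>]]]) blast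
    thus "\<exists>\<rho>. \<rho> \<ge> 1 \<and> puiseux_ord (\<lambda>q. \<gamma> q - \<beta> q) = ereal (of_rat \<rho>)" by (intro exI conjI)
  qed
  from bchoice[OF this] obtain \<rho> where
    "\<forall>\<beta>\<in>?I. \<rho> \<beta> \<ge> 1 \<and> puiseux_ord (\<lambda>q. \<gamma> q - \<beta> q) = ereal (of_rat (\<rho> \<beta>))" ..
  hence \<rho>: "\<And>\<beta>. \<beta> \<in> ?I \<Longrightarrow> \<rho> \<beta> \<ge> 1" "\<And>\<beta>. \<beta> \<in> ?I \<Longrightarrow> puiseux_ord (\<lambda>q. \<gamma> q - \<beta> q) = ereal (of_rat (\<rho> \<beta>))"
    by simp_all
  let ?Q = "\<lambda>\<beta> c C. c > 0 \<and> C > 0 \<and> (\<forall>\<^sub>F y in at_right 0. c * y powr of_rat (\<rho> \<beta>) \<le>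
      \<bar>real_arc \<gamma> y - real_arc \<beta> y\<bar> \<and>
       \<bar>real_arc \<gamma> y - real_arc \<beta> y\<bar> \<le> C * y powr of_rat (\<rho> \<beta>))"
  have "\<forall>\<beta>\<in>?I. \<exists>c C. ?Q \<beta> c C"
  proof
    fix \<beta> assume \<beta>: "\<beta> \<in> ?I"
    show "\<exists>c C. ?Q \<beta> c C"
      by (rule real_arc_asymptotics[OF \<gamma>(1) real_np_roots_puiseux(1)[OF \<beta>] \<gamma>(2)
          real_np_roots_puiseux(2)[OF \<beta>] \<rho>(2)[OF \<beta>]])
         (intro exI conjI)
  qed
  from bchoice[OF this] obtain c where "\<forall>\<beta>\<in>?I. \<exists>C. ?Q \<beta> (c \<beta>) C" ..
  from bchoice[OF this] obtain C where "\<forall>\<beta>\<in>?I. ?Q \<beta> (c \<beta>) (C \<beta>)" ..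
  hence cC: "\<And>\<beta>. \<beta> \<in> ?I \<Longrightarrow> c \<beta> > 0" "\<And>\<beta>. \<beta> \<in> ?I \<Longrightarrow> C \<beta> > 0"
    "\<And>\<beta>. \<beta> \<in> ?I \<Longrightarrow> \<forall>\<^sub>F y in at_right 0. c \<beta> * y powr of_rat (\<rho> \<beta>) \<le> \<bar>real_arc \<gamma> y - real_arc \<beta> y\<bar> \<and>
       \<bar>real_arc \<gamma> y - real_arc \<beta> y\<bar> \<le> C \<beta> * y powr of_rat (\<rho> \<beta>)"
    by simp_all
  have rho1: "real_of_rat (\<rho> \<beta>) \<ge> 1" if "\<beta> \<in> ?I" for \<beta>
    using \<rho>(1)[OF that] by simp
  have "\<exists>a. ord_dist \<gamma> H = ereal a \<and> a \<ge> 1 \<and> (\<forall>\<beta>\<in>?I. of_rat (\<rho> \<beta>) \<le> a) \<and>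
    (\<exists>C>0. \<forall>\<^sub>F y in at_right 0. ?D y \<le> C * y powr a)"
  proof (cases "?I = {}")
    case True
    have "\<forall>\<^sub>F y in at_right 0. ?D y \<le> 1 * y powr 1"
      using eventually_at_right_less[of 0] by eventually_elim (simp add: branch_dist_def True)
    moreover have "(0::real) < 1" by simp
    ultimately have "\<exists>C>0. \<forall>\<^sub>F y in at_right 0. ?D y \<le> C * y powr 1" by blast
    thus ?thesis using True by (intro exI[of _ 1]) (simp add: ord_dist_def one_ereal_def)
  next
    case False
    have "Max ((\<lambda>\<beta>. puiseux_ord (\<lambda>q. \<gamma> q - \<beta> q)) ` ?I) \<in> (\<lambda>\<beta>. puiseux_ord (\<lambda>q. \<gamma> q - \<beta> q)) ` ?I"
      using False fin by (intro Max_in) auto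
    then obtain \<beta> where \<beta>: "\<beta> \<in> ?I" "ord_dist \<gamma> H = puiseux_ord (\<lambda>q. \<gamma> q - \<beta> q)"
      using False by (auto simp: ord_dist_def)
    have "of_rat (\<rho> \<beta>') \<le> (of_rat (\<rho> \<beta>) :: real)" if \<beta>': "\<beta>' \<in> ?I" for \<beta>'
    proof -
      have "puiseux_ord (\<lambda>q. \<gamma> q - \<beta>' q) \<le> Max ((\<lambda>\<beta>. puiseux_ord (\<lambda>q. \<gamma> q - \<beta> q)) ` ?I)"
        using fin \<beta>' by (intro Max_ge) auto
      hence "puiseux_ord (\<lambda>q. \<gamma> q - \<beta>' q) \<le> ord_dist \<gamma> H" using False by (simp add: ord_dist_def)
      thus ?thesis using \<beta>(2) \<rho>(2)[OF \<beta>'] \<rho>(2)[OF \<beta>(1)] by simp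
    qed
    moreover have "\<forall>\<^sub>F y in at_right 0. ?D y \<le> C \<beta> * y powr of_rat (\<rho> \<beta>)"
      using cC(3)[OF \<beta>(1)] by eventually_elim (use branch_dist_le(2)[OF fin \<beta>(1)] in \<open>auto intro:
          order_trans\<close>)
    ultimately show ?thesis using \<beta>(2) \<rho>(2)[OF \<beta>(1)] rho1[OF \<beta>(1)] cC(2)[OF \<beta>(1)]
      by (intro exI[of _ "real_of_rat (\<rho> \<beta>)"] conjI ballI exI[of _ "C \<beta>"]) simp_all
  qed
  then obtain a where a: "ord_dist \<gamma> H = ereal a" "a \<ge> 1" "\<And>\<beta>. \<beta> \<in> ?I \<Longrightarrow> of_rat (\<rho> \<beta>) \<le> a"
    "\<exists>C>0. \<forall>\<^sub>F y in at_right 0. ?D y \<le> C * y powr a" by blast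
  define c0 where "c0 = Min (insert 1 (c ` ?I))"
  have "c0 \<in> insert 1 (c ` ?I)" unfolding c0_def using fin by (intro Min_in) auto
  hence c0: "c0 > 0" using cC(1) by auto
  have c0_le: "c0 \<le> z" if "z \<in> insert 1 (c ` ?I)" for z
    unfolding c0_def using fin that by (intro Min_le) auto
  have "\<forall>\<^sub>F y in at_right 0. \<forall>\<beta>\<in>?I. c \<beta> * y powr of_rat (\<rho> \<beta>) \<le> \<bar>real_arc \<gamma> y - real_arc \<beta> y\<bar>"
    by (intro eventually_ball_finite fin ballI) (rule eventually_mono[OF cC(3)], assumption, erule
        conjunct1)
  with eventually_at_right_real[OF zero_less_one]
  have "\<forall>\<^sub>F y in at_right 0. c0 * y powr a \<le> ?D y"
  proof eventually_elim
    case (elim y)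
    hence y: "0 < y" "y < 1" by auto
    show ?case
    proof (rule branch_dist_cases[OF fin, of real_arc "real_arc \<gamma> y" y])
      assume "?D y = y"
      moreover have "c0 * y powr a \<le> 1 * y powr 1"
        using c0 c0_le[of 1] y a(2) by (intro mult_mono powr_mono') auto
      ultimately show ?thesis using y by simp
    next
      fix \<beta> assume \<beta>: "\<beta> \<in> ?I" "?D y = \<bar>real_arc \<gamma> y - real_arc \<beta> y\<bar>"
      have "c0 * y powr a \<le> c \<beta> * y powr of_rat (\<rho> \<beta>)"
        using c0 c0_le[of "c \<beta>"] \<beta>(1) y a(3)[OF \<beta>(1)] by (intro mult_mono powr_mono') auto
      also have "\<dots> \<le> ?D y" using elim(2) \<beta> by simp
      finally show ?thesis .
    qed
  qed
  with c0 have "\<exists>c>0. \<forall>\<^sub>F y in at_right 0. c * y powr a \<le> ?D y" by blast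
  from that[OF a(1,2) this a(4)] show ?thesis .
qed

section \<open>Separation in the upper half-plane\<close>

lemma powr_exponent_le:
  fixes a s \<mu> K :: real
  assumes a: "a > 0" and ev: "\<forall>\<^sub>F y in at_right 0. a * y powr s \<le> K * y powr \<mu>"
  shows "\<mu> \<le> s"
proof (rule ccontr)
  assume "\<not> \<mu> \<le> s"
  hence pos: "\<mu> - s > 0" by simp
  have "\<forall>\<^sub>F y in at_right (0::real). 0 \<le> y" using eventually_at_right_less[of 0]
      by eventually_elim simp
  hence "((\<lambda>y::real. y powr (\<mu> - s)) \<longlongrightarrow> 0 powr (\<mu> - s)) (at_right 0)"
    using pos by (intro tendsto_powr' tendsto_ident_at tendsto_const) auto
  hence "((\<lambda>y::real. K * y powr (\<mu> - s)) \<longlongrightarrow> K * 0 powr (\<mu> - s)) (at_right 0)"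
    by (rule tendsto_mult_left)
  hence "\<forall>\<^sub>F y in at_right 0. K * y powr (\<mu> - s) < a"
    by (rule order_tendstoD) (use a in simp)
  with ev eventually_at_right_less[of 0] have "\<forall>\<^sub>F y in at_right (0::real). False"
  proof eventually_elim
    case (elim y)
    have "K * y powr \<mu> = K * y powr (\<mu> - s) * y powr s"
      using elim(2) by (simp add: mult.assoc flip: powr_add)
    also have "\<dots> < a * y powr s" using elim by (intro mult_strict_right_mono) auto
    finally show False using elim(1) by simp
  qed
  thus False by simp
qed

lemma powr_le_self: "0 \<le> (d::real) \<Longrightarrow> d \<le> 1 \<Longrightarrow> 1 \<le> l \<Longrightarrow> d powr l \<le> d"
  using powr_mono'[of 1 l d] by simp

lemma powr_add_le:
  fixes s t l :: real
  assumes "0 \<le> s" "0 \<le> t" "0 \<le> l"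
  shows "(s + t) powr l \<le> 2 powr l * (s powr l + t powr l)"
proof -
  have "(s + t) powr l \<le> (2 * max s t) powr l" using assms by (intro powr_mono2) auto
  also have "\<dots> = 2 powr l * max s t powr l" using assms by (simp add: powr_mult)
  also have "max s t powr l \<le> s powr l + t powr l" by (simp add: max_def)
  finally show ?thesis by (simp add: mult_left_mono)
qed

lemma finite_pos_lower_bound:
  fixes S :: "real set"
  assumes "finite S" "\<forall>z\<in>S. z > 0"
  shows "\<exists>e>0. \<forall>z\<in>S. e \<le> z"
proof (intro exI[of _ "Min (insert 1 S)"] conjI ballI)
  have "Min (insert 1 S) \<in> insert 1 S" using assms(1) by (intro Min_in) auto
  thus "Min (insert 1 S) > 0" using assms(2) by (elim insertE) simp_all
  show "Min (insert 1 S) \<le> z" if "z \<in> S" for z using assms(1) that by (intro Min_le) auto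
qed

text \<open>Formulated for sets rather than functions, so that it can be instantiated a second time
  with the reflected sets and series.\<close>

locale germ_pair =
  fixes A B :: "(real \<times> real) set" and F G :: cps2 and m n :: nat
  assumes A: "(0, 0) \<in> A" "zero_germ A F" "mini_regular F m" "m > 0"
    and B: "(0, 0) \<in> B" "zero_germ B G" "mini_regular G n" "n > 0"
begin

lemma x_regular_F: "x_regular F m"
  by (rule mini_regular_imp_x_regular[OF A(3)])

lemma x_regular_G: "x_regular G n"
  by (rule mini_regular_imp_x_regular[OF B(3)])

lemma finite_roots: "finite {\<phi>. np_root (F * G) \<phi>}"
  by (rule finite_np_roots[OF x_regular_mult[OF x_regular_F x_regular_G]])

lemma real_roots_gcd: "real_np_roots (gcd2 F G) = real_np_roots F \<inter> real_np_roots G"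
  by (rule real_np_roots_gcd2[OF x_regular_G])

lemma real_roots_imp_root:
  "\<beta> \<in> real_np_roots F \<Longrightarrow> np_root (F * G) \<beta>" "\<beta> \<in> real_np_roots G \<Longrightarrow> np_root (F * G) \<beta>"
  unfolding real_np_roots_def using np_root_dvd[of F "F * G"] np_root_dvd[of G "F * G"] by simp_all

lemma finite_ratios: "finite (contact_ratio F G ` root_approximations (F * G))"
  by (rule finite_contact_ratios[OF finite_roots real_roots_gcd])

lemma finite_real_roots: "finite (real_np_roots F)" "finite (real_np_roots G)"
    "finite (real_np_roots (gcd2 F G))"
  unfolding real_roots_gcd using x_regular_F x_regular_G finite_real_np_roots by auto

lemma branches_A: "branches A (real_np_roots F) real_arc"
  by (rule zero_germ_branches[OF A])

lemma branches_B: "branches B (real_np_roots G) real_arc"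
  by (rule zero_germ_branches[OF B])

lemma branches_AB: "branches (A \<inter> B) (real_np_roots (gcd2 F G)) real_arc"
  unfolding real_roots_gcd by (rule zero_germ_branches_Int[OF A B])

lemma ord_dist_real:
  assumes "\<gamma> \<in> root_approximations (F * G)"
  obtains a b c where "ord_dist \<gamma> F = ereal a" "ord_dist \<gamma> G = ereal b" "ord_dist \<gamma> (gcd2 F G) =
      ereal c"
    "a \<ge> 1" "b \<ge> 1" "c \<ge> 1" "contact_ratio F G \<gamma> = ereal (min a b / c)"
    "\<exists>C>0. \<forall>\<^sub>F y in at_right 0. root_dist F (real_arc \<gamma> y) y \<le> C * y powr a"
    "\<exists>C>0. \<forall>\<^sub>F y in at_right 0. root_dist G (real_arc \<gamma> y) y \<le> C * y powr b"
    "\<exists>C>0. \<forall>\<^sub>F y in at_right 0. C * y powr c \<le> root_dist (gcd2 F G) (real_arc \<gamma> y) y"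
    "\<exists>C>0. \<forall>\<^sub>F y in at_right 0. root_dist (gcd2 F G) (real_arc \<gamma> y) y \<le> C * y powr c"
proof -
  have \<gamma>: "puiseux \<gamma>" "puiseux_real \<gamma>" "\<not> np_root (F * G) \<gamma>"
    using assms by (rule root_approximationsE, blast)+
  have notin: "\<gamma> \<notin> real_np_roots F" "\<gamma> \<notin> real_np_roots G" "\<gamma> \<notin> real_np_roots (gcd2 F G)"
    unfolding real_roots_gcd using \<gamma>(3) real_roots_imp_root[of \<gamma>] by auto
  obtain a where a: "ord_dist \<gamma> F = ereal a" "a \<ge> 1"
    "\<exists>C>0. \<forall>\<^sub>F y in at_right 0. root_dist F (real_arc \<gamma> y) y \<le> C * y powr a"
    by (rule ord_dist_asymptotics[OF \<gamma>(1,2) notin(1) finite_real_roots(1)])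
  obtain b where b: "ord_dist \<gamma> G = ereal b" "b \<ge> 1"
    "\<exists>C>0. \<forall>\<^sub>F y in at_right 0. root_dist G (real_arc \<gamma> y) y \<le> C * y powr b"
    by (rule ord_dist_asymptotics[OF \<gamma>(1,2) notin(2) finite_real_roots(2)])
  obtain c where c: "ord_dist \<gamma> (gcd2 F G) = ereal c" "c \<ge> 1"
    "\<exists>C>0. \<forall>\<^sub>F y in at_right 0. C * y powr c \<le> root_dist (gcd2 F G) (real_arc \<gamma> y) y"
    "\<exists>C>0. \<forall>\<^sub>F y in at_right 0. root_dist (gcd2 F G) (real_arc \<gamma> y) y \<le> C * y powr c"
    by (rule ord_dist_asymptotics[OF \<gamma>(1,2) notin(3) finite_real_roots(3)])
  have "contact_ratio F G \<gamma> = ereal (min a b / c)"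
    using c(2) by (auto simp: contact_ratio_def a(1) b(1) c(1) min_def)
  from that[OF a(1) b(1) c(1) a(2) b(2) c(2) this a(3) b(3) c(3,4)] show ?thesis .
qed

text \<open>The real roots of the greatest common divisor are among those of each series, so the
  maximum runs over fewer roots; the value 1 for no roots is the smallest possible.\<close>

lemma ord_dist_gcd_le:
  assumes "\<gamma> \<in> root_approximations (F * G)"
  shows "ord_dist \<gamma> (gcd2 F G) \<le> ord_dist \<gamma> F" "ord_dist \<gamma> (gcd2 F G) \<le> ord_dist \<gamma> G"
proof -
  obtain a b c where abc: "ord_dist \<gamma> F = ereal a" "ord_dist \<gamma> G = ereal b" "a \<ge> 1" "b \<ge> 1"
    using assms by (rule ord_dist_real)
  have *: "ord_dist \<gamma> (gcd2 F G) \<le> ord_dist \<gamma> H" if H: "real_np_roots (gcd2 F G) \<subseteq> real_np_roots H"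
    "finite (real_np_roots H)" "1 \<le> ord_dist \<gamma> H" for H
  proof (cases "real_np_roots (gcd2 F G) = {}")
    case True
    thus ?thesis using H(3) by (simp add: ord_dist_def)
  next
    case False
    hence "real_np_roots H \<noteq> {}" using H(1) by auto
    thus ?thesis using False H by (auto simp: ord_dist_def intro!: Max_mono image_mono)
  qed
  show "ord_dist \<gamma> (gcd2 F G) \<le> ord_dist \<gamma> F"
    by (rule *) (use abc finite_real_roots in \<open>auto simp: real_roots_gcd one_ereal_def\<close>)
  show "ord_dist \<gamma> (gcd2 F G) \<le> ord_dist \<gamma> G"
    by (rule *) (use abc finite_real_roots in \<open>auto simp: real_roots_gcd one_ereal_def\<close>)
qed

lemma exponent_plus_ge_1: "exponent_plus F G \<ge> 1"
proof (cases "root_approximations (F * G) = {}")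
  case False
  then obtain \<gamma> where \<gamma>: "\<gamma> \<in> root_approximations (F * G)" by auto
  obtain a b c where abc: "ord_dist \<gamma> F = ereal a" "ord_dist \<gamma> G = ereal b" "ord_dist \<gamma> (gcd2 F G) =
      ereal c"
    "c \<ge> 1" "contact_ratio F G \<gamma> = ereal (min a b / c)"
    using \<gamma> by (rule ord_dist_real)
  have "c \<le> min a b" using ord_dist_gcd_le[OF \<gamma>] by (simp add: abc)
  hence "1 \<le> min a b / c" using abc(4) by (simp add: le_divide_eq)
  hence "1 \<le> contact_ratio F G \<gamma>" unfolding abc(5) one_ereal_def ereal_less_eq .
  also have "\<dots> \<le> Max (contact_ratio F G ` root_approximations (F * G))"
    using finite_ratios \<gamma> by (intro Max_ge) auto
  finally show ?thesis using False by (simp add: exponent_plus_def)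
qed (simp add: exponent_plus_def)

text \<open>Test the inequality along an approximation \<gamma>. The left side is at least a
  constant times y^(\<sigma> b) with \<sigma> the order of distance to the common zeros, and the
  right side at most a constant times y^min(\<alpha>, \<beta>). Letting y tend to 0 gives
  min(\<alpha>, \<beta>) \<le> \<sigma> b.\<close>

lemma exponent_plus_le:
  assumes b: "b \<ge> 1" and C: "C > 0" and r: "r > 0"
    and ineq: "\<And>x y. norm (x, y) \<le> r \<Longrightarrow> 0 < y \<Longrightarrow>
      C * infdist (x, y) (A \<inter> B) powr b \<le> infdist (x, y) A + infdist (x, y) B"
  shows "exponent_plus F G \<le> ereal b"
proof (cases "root_approximations (F * G) = {}")
  case True
  thus ?thesis using b by (simp add: exponent_plus_def one_ereal_def)
next
  case False
  have "contact_ratio F G \<gamma> \<le> ereal b" if \<gamma>: "\<gamma> \<in> root_approximations (F * G)" for \<gamma>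
  proof -
    obtain \<alpha> \<beta> \<sigma> where ab: "\<alpha> \<ge> 1" "\<beta> \<ge> 1" "\<sigma> \<ge> 1" "contact_ratio F G \<gamma> = ereal (min \<alpha> \<beta> / \<sigma>)"
    "\<exists>C>0. \<forall>\<^sub>F y in at_right 0. root_dist F (real_arc \<gamma> y) y \<le> C * y powr \<alpha>"
    "\<exists>C>0. \<forall>\<^sub>F y in at_right 0. root_dist G (real_arc \<gamma> y) y \<le> C * y powr \<beta>"
    "\<exists>C>0. \<forall>\<^sub>F y in at_right 0. C * y powr \<sigma> \<le> root_dist (gcd2 F G) (real_arc \<gamma> y) y"
      using \<gamma> by (rule ord_dist_real)
    obtain CF where CF: "CF > 0" "\<forall>\<^sub>F y in at_right 0. root_dist F (real_arc \<gamma> y) y \<le> CF * y powr \<alpha>"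
      using ab(5) by auto
    obtain CG where CG: "CG > 0" "\<forall>\<^sub>F y in at_right 0. root_dist G (real_arc \<gamma> y) y \<le> CG * y powr \<beta>"
      using ab(6) by auto
    obtain cH where cH: "cH > 0" "\<forall>\<^sub>F y in at_right 0. cH * y powr \<sigma> \<le>
        root_dist (gcd2 F G) (real_arc \<gamma> y) y"
      using ab(7) by auto
    have "puiseux \<gamma>" using \<gamma> by (rule root_approximationsE)
    then obtain K \<epsilon> where K: "K > 0" "\<epsilon> > 0" "\<And>y. 0 < y \<Longrightarrow> y < \<epsilon> \<Longrightarrow> \<bar>real_arc \<gamma> y\<bar> \<le> K * y"
      by (rule real_arc_Lipschitz) blast
    obtain rA where rA: "rA > 0" "\<And>x y. 0 < y \<Longrightarrow> y < rA \<Longrightarrow> \<bar>x\<bar> \<le> K * y \<Longrightarrow>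
        infdist (x, y) A \<le> (1 + K) * root_dist F x y"
      by (rule infdist_le_branch_dist[OF branches_A less_imp_le[OF K(1)]]) blast
    obtain rB where rB: "rB > 0" "\<And>x y. 0 < y \<Longrightarrow> y < rB \<Longrightarrow> \<bar>x\<bar> \<le> K * y \<Longrightarrow>
        infdist (x, y) B \<le> (1 + K) * root_dist G x y"
      by (rule infdist_le_branch_dist[OF branches_B less_imp_le[OF K(1)]]) blast
    obtain c rH where rH: "c > 0" "rH > 0" "\<And>x y. 0 < y \<Longrightarrow> norm (x, y) < rH \<Longrightarrow>
        c * root_dist (gcd2 F G) x y \<le> infdist (x, y) (A \<inter> B)"
      by (rule infdist_ge_branch_dist[OF branches_AB]) blast
    define \<mu> where "\<mu> = min \<alpha> \<beta>"
    have "rH / (1 + K) > 0" "r / (1 + K) > 0" using K(1) rH(2) r by simp_all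
    \<comment> \<open>The quotients by 1 + K turn bounds on the norm into bounds on y, since |x|
      \<le> K y along the arc; the bound 1 makes powers of y decrease with the exponent.\<close>
    hence "\<exists>e>0. \<forall>z\<in>{\<epsilon>, rA, rB, rH / (1 + K), r / (1 + K), 1}. e \<le> z"
      using K(2) rA(1) rB(1) by (intro finite_pos_lower_bound) auto
    then obtain \<epsilon>' where "\<epsilon>' > 0" "\<forall>z\<in>{\<epsilon>, rA, rB, rH / (1 + K), r / (1 + K), 1}. \<epsilon>' \<le> z"
        by (elim exE conjE)
    hence \<epsilon>': "\<epsilon>' > 0" "\<epsilon>' \<le> \<epsilon>" "\<epsilon>' \<le> rA" "\<epsilon>' \<le> rB" "\<epsilon>' \<le> rH / (1 + K)" "\<epsilon>' \<le> r / (1 + K)" "\<epsilon>' \<le> 1"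
      by simp_all
    have "\<forall>\<^sub>F y in at_right 0. C * (c * cH) powr b * y powr (\<sigma> * b) \<le>
        (1 + K) * (CF + CG) * y powr \<mu>"
      using CF(2) CG(2) cH(2) eventually_at_right_real[OF \<epsilon>'(1)]
    proof eventually_elim
      case (elim y)
      hence y: "0 < y" "y < \<epsilon>'" by auto
      define x where "x = real_arc \<gamma> y"
      have x: "\<bar>x\<bar> \<le> K * y" unfolding x_def using K(3) y \<epsilon>' by simp
      have "norm (x, y) \<le> (1 + K) * y"
        using norm_Pair_le_abs[of x y] x y by (simp add: algebra_simps)
      also have "(1 + K) * y < (1 + K) * \<epsilon>'" using y K(1) by (intro mult_strict_left_mono) auto
      finally have nrm: "norm (x, y) < (1 + K) * \<epsilon>'" .
      have "(1 + K) * \<epsilon>' \<le> r" "(1 + K) * \<epsilon>' \<le> rH" using \<epsilon>'(5,6) K(1) by (simp_all add: field_simps)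
      hence n: "norm (x, y) \<le> r" "norm (x, y) < rH" using nrm by simp_all
      have pw: "y powr \<alpha> \<le> y powr \<mu>" "y powr \<beta> \<le> y powr \<mu>"
        using y \<epsilon>'(7) by (auto intro!: powr_mono' simp: \<mu>_def)
      have "c * (cH * y powr \<sigma>) \<le> c * root_dist (gcd2 F G) x y"
        using elim(3) rH(1) unfolding x_def by (intro mult_left_mono) auto
      also have "\<dots> \<le> infdist (x, y) (A \<inter> B)" by (rule rH(3)[OF y(1) n(2)])
      finally have "(c * (cH * y powr \<sigma>)) powr b \<le> infdist (x, y) (A \<inter> B) powr b"
        using rH(1) cH(1) b by (intro powr_mono2) auto
      moreover have "(c * (cH * y powr \<sigma>)) powr b = (c * cH) powr b * y powr (\<sigma> * b)"
        using rH(1) cH(1) by (simp add: powr_mult powr_powr mult.assoc)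
      ultimately have "C * ((c * cH) powr b * y powr (\<sigma> * b)) \<le> C * infdist (x, y) (A \<inter> B) powr b"
        using C by (intro mult_left_mono) auto
      also have "\<dots> \<le> infdist (x, y) A + infdist (x, y) B" by (rule ineq[OF n(1) y(1)])
      also have "\<dots> \<le> (1 + K) * root_dist F x y + (1 + K) * root_dist G x y"
        using y \<epsilon>' x by (intro add_mono rA(2) rB(2)) auto
      also have "\<dots> \<le> (1 + K) * (CF * y powr \<mu>) + (1 + K) * (CG * y powr \<mu>)"
      proof (intro add_mono mult_left_mono)
        show "root_dist F x y \<le> CF * y powr \<mu>"
          using elim(1) mult_left_mono[OF pw(1), of CF] CF(1) unfolding x_def by linarith
        show "root_dist G x y \<le> CG * y powr \<mu>"
          using elim(2) mult_left_mono[OF pw(2), of CG] CG(1) unfolding x_def by linarith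
      qed (use K(1) in auto)
      finally show ?case by (simp add: algebra_simps)
    qed
    moreover have "C * (c * cH) powr b > 0" using C rH(1) cH(1) by simp
    ultimately have "\<mu> \<le> \<sigma> * b" by (rule powr_exponent_le[rotated])
    hence "min \<alpha> \<beta> / \<sigma> \<le> b" using ab(3) by (simp add: \<mu>_def divide_le_eq mult.commute)
    thus ?thesis unfolding ab(4) ereal_less_eq .
  qed
  hence "Max (contact_ratio F G ` root_approximations (F * G)) \<le> ereal b"
    using finite_ratios False by (intro Max.boundedI) auto
  thus ?thesis using False by (simp add: exponent_plus_def)
qed

text \<open>If the roots coincide, the arc consists of common zeros and D^l \<le> D is enough.
  Otherwise their approximation has distance order \<rho> to both sets and \<sigma> to the common
  zeros, so \<rho> / \<sigma> \<le> l. This is exactly what lets y^(\<sigma> l) be absorbed by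
  y^\<rho>.\<close>

lemma branch_pair_le:
  assumes l: "l \<ge> 1" "exponent_plus F G \<le> ereal l" and K': "K' \<ge> 0"
    and \<beta>: "\<beta> \<in> real_np_roots F" and \<delta>: "\<delta> \<in> real_np_roots G"
  shows "\<exists>C>0. \<forall>\<^sub>F y in at_right 0. \<forall>x. \<bar>x\<bar> \<le> K' * y \<longrightarrow>
    C * root_dist (gcd2 F G) x y powr l \<le> \<bar>x - real_arc \<beta> y\<bar> + \<bar>x - real_arc \<delta> y\<bar>"
proof -
  let ?D = "root_dist (gcd2 F G)"
  note finH = finite_real_roots(3)
  show ?thesis
  proof (cases "\<beta> = \<delta>")
    case True
    hence \<beta>H: "\<beta> \<in> real_np_roots (gcd2 F G)" using \<beta> \<delta> by (simp add: real_roots_gcd)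
    have "\<forall>\<^sub>F y in at_right 0. \<forall>x. \<bar>x\<bar> \<le> K' * y \<longrightarrow> 1 * ?D x y powr l \<le>
        \<bar>x - real_arc \<beta> y\<bar> + \<bar>x - real_arc \<delta> y\<bar>"
      using eventually_at_right_real[OF zero_less_one]
    proof eventually_elim
      case (elim y)
      show ?case
      proof (intro allI impI)
        fix x
        have D: "0 \<le> ?D x y" "?D x y \<le> y"
            using elim branch_dist_nonneg[OF finH] branch_dist_le(1)[OF finH] by auto
        have "?D x y powr l \<le> ?D x y" using D elim l(1) by (intro powr_le_self) auto
        also have "\<dots> \<le> \<bar>x - real_arc \<beta> y\<bar>" by (rule branch_dist_le(2)[OF finH \<beta>H])
        finally show "1 * ?D x y powr l \<le> \<bar>x - real_arc \<beta> y\<bar> + \<bar>x - real_arc \<delta> y\<bar>" by simp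
      qed
    qed
    thus ?thesis by (intro exI[of _ 1] conjI zero_less_one)
  next
    case False
    note p\<beta> = real_np_roots_puiseux[OF \<beta>] and p\<delta> = real_np_roots_puiseux[OF \<delta>]
    have R: "np_root (F * G) \<beta>" "np_root (F * G) \<delta>" using \<beta> \<delta> by (auto intro: real_roots_imp_root)
    have "(\<lambda>q. \<beta> q - \<delta> q) \<noteq> (\<lambda>_. 0)" using False by (auto simp: fun_eq_iff)
    then obtain \<rho> where \<rho>: "\<rho> \<ge> 1" "puiseux_ord (\<lambda>q. \<beta> q - \<delta> q) = ereal (of_rat \<rho>)"
      by (rule puiseux_leading[OF puiseux_diff[OF p\<beta>(1) p\<delta>(1)]]) blast
    have "exceptional_values (F * G) \<rho> \<subseteq> (\<lambda>\<phi>. Re (\<phi> \<rho>)) ` {\<phi>. np_root (F * G) \<phi>}"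
    proof
      fix c assume "c \<in> exceptional_values (F * G) \<rho>"
      then obtain \<phi> where "np_root (F * G) \<phi>" "\<phi> \<rho> = of_real c"
          by (auto simp: exceptional_values_def)
      thus "c \<in> (\<lambda>\<phi>. Re (\<phi> \<rho>)) ` {\<phi>. np_root (F * G) \<phi>}" by (intro image_eqI[of _ _ \<phi>]) auto
    qed
    hence "finite (exceptional_values (F * G) \<rho>)"
        by (rule finite_subset) (intro finite_imageI finite_roots)
    \<comment> \<open>There are finitely many roots, hence finitely many exceptional values, and a
      generic real c exists.\<close>
    then obtain c where c: "c \<notin> exceptional_values (F * G) \<rho>"
      using ex_new_if_finite[OF infinite_UNIV_char_0] by blast
    have exc: "\<phi> \<rho> \<noteq> of_real c" if "np_root (F * G) \<phi>" for \<phi>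
      using c that unfolding exceptional_values_def by blast
    define \<gamma> where "\<gamma> = approximation \<beta> \<rho> c"
    have \<gamma>real: "puiseux_real \<gamma>" using p\<beta>(2) by (simp add: \<gamma>_def puiseux_real_def approximation_def)
    have \<gamma>: "\<gamma> \<in> root_approximations (F * G)"
      unfolding root_approximations_def mem_Collect_eq
      by (rule exI[of _ \<beta>], rule exI[of _ \<delta>], rule exI[of _ \<rho>], rule exI[of _ c])
         (use R False \<rho>(2) c \<gamma>real in \<open>simp add: \<gamma>_def\<close>)
    have \<gamma>pui: "puiseux \<gamma>" unfolding \<gamma>_def by (rule puiseux_approximation[OF p\<beta>(1) p\<delta>(1) \<rho>(2)])
    have ord: "puiseux_ord (\<lambda>q. \<gamma> q - \<phi> q) = min (puiseux_ord (\<lambda>q. \<beta> q - \<phi> q)) (ereal (of_rat \<rho>))"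
      if "np_root (F * G) \<phi>" for \<phi>
      unfolding \<gamma>_def using that by (intro puiseux_ord_approximation p\<beta> exc) (auto simp:
          np_root_def)
    have ord_le: "puiseux_ord (\<lambda>q. \<gamma> q - \<phi> q) \<le> ereal (of_rat \<rho>)" if "np_root (F * G) \<phi>" for \<phi>
      unfolding ord[OF that] by simp
    have ord_\<beta>: "puiseux_ord (\<lambda>q. \<gamma> q - \<beta> q) = ereal (of_rat \<rho>)"
      unfolding ord[OF R(1)] by (simp add: puiseux_ord_def)
    have ord_\<delta>: "puiseux_ord (\<lambda>q. \<gamma> q - \<delta> q) = ereal (of_rat \<rho>)"
      unfolding ord[OF R(2)] \<rho>(2) by simp
    have dF: "ord_dist \<gamma> F = ereal (of_rat \<rho>)"
    proof -
      have "Max ((\<lambda>\<beta>. puiseux_ord (\<lambda>q. \<gamma> q - \<beta> q)) ` real_np_roots F) = ereal (of_rat \<rho>)"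
        using finite_real_roots(1) ord_le real_roots_imp_root(1) ord_\<beta>[symmetric] \<beta>
        by (intro Max_eqI finite_imageI) auto
      thus ?thesis using \<beta> by (auto simp: ord_dist_def)
    qed
    have dG: "ord_dist \<gamma> G = ereal (of_rat \<rho>)"
    proof -
      have "Max ((\<lambda>\<beta>. puiseux_ord (\<lambda>q. \<gamma> q - \<beta> q)) ` real_np_roots G) = ereal (of_rat \<rho>)"
        using finite_real_roots(2) ord_le real_roots_imp_root(2) ord_\<delta>[symmetric] \<delta>
        by (intro Max_eqI finite_imageI) auto
      thus ?thesis using \<delta> by (auto simp: ord_dist_def)
    qed
    obtain a b \<sigma> where abs: "ord_dist \<gamma> F = ereal a" "ord_dist \<gamma> G = ereal b"
        "ord_dist \<gamma> (gcd2 F G) = ereal \<sigma>"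
      "\<sigma> \<ge> 1" "contact_ratio F G \<gamma> = ereal (min a b / \<sigma>)"
      "\<exists>C>0. \<forall>\<^sub>F y in at_right 0. root_dist (gcd2 F G) (real_arc \<gamma> y) y \<le> C * y powr \<sigma>"
      using \<gamma> by (rule ord_dist_real)
    have ab: "a = of_rat \<rho>" "b = of_rat \<rho>" using abs(1,2) dF dG by simp_all
    have \<sigma>\<rho>: "\<sigma> \<le> of_rat \<rho>" using ord_dist_gcd_le(1)[OF \<gamma>] by (simp add: abs(3) dF)
    have "contact_ratio F G \<gamma> \<le> exponent_plus F G"
      using \<gamma> finite_ratios by (auto simp: exponent_plus_def)
    hence "ereal (min a b / \<sigma>) \<le> ereal l" using l(2) unfolding abs(5) by (rule order_trans)
    hence \<rho>l: "of_rat \<rho> \<le> \<sigma> * l" using abs(4) by (simp add: ab divide_le_eq mult.commute)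
    obtain C3 where C3: "C3 > 0" "\<forall>\<^sub>F y in at_right 0. ?D (real_arc \<gamma> y) y \<le> C3 * y powr \<sigma>"
      using abs(6) by auto
    obtain c1 C1 where c1: "c1 > 0" "\<forall>\<^sub>F y in at_right 0. c1 * y powr of_rat \<rho> \<le>
        \<bar>real_arc \<beta> y - real_arc \<delta> y\<bar> \<and>
       \<bar>real_arc \<beta> y - real_arc \<delta> y\<bar> \<le> C1 * y powr of_rat \<rho>"
      by (rule real_arc_asymptotics[OF p\<beta>(1) p\<delta>(1) p\<beta>(2) p\<delta>(2) \<rho>(2)]) blast
    obtain c2 C2 where C2: "C2 > 0" "\<forall>\<^sub>F y in at_right 0. c2 * y powr of_rat \<rho> \<le>
        \<bar>real_arc \<gamma> y - real_arc \<beta> y\<bar> \<and>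
       \<bar>real_arc \<gamma> y - real_arc \<beta> y\<bar> \<le> C2 * y powr of_rat \<rho>"
      by (rule real_arc_asymptotics[OF \<gamma>pui p\<beta>(1) \<gamma>real p\<beta>(2) ord_\<beta>]) blast
    obtain K \<epsilon> where K: "K > 0" "\<epsilon> > 0" "\<And>y. 0 < y \<Longrightarrow> y < \<epsilon> \<Longrightarrow> \<bar>real_arc \<beta> y\<bar> \<le> K * y"
      by (rule real_arc_Lipschitz[OF p\<beta>(1)]) blast
    define C4 where "C4 = C2 + C3"
    have C4: "C4 > 0" using C2(1) C3(1) by (simp add: C4_def)
    \<comment> \<open>From D \<le> u + C4 y^\<sigma> the l-th power is at most 2^l (u^l + C4^l
      y^(\<sigma> l)). Here u^l \<le> u because u \<le> 1, and y^(\<sigma> l) \<le> y^\<rho> \<le>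
      (u + v) / c1.\<close>
    define M where "M = 2 powr l * (1 + C4 powr l / c1)"
    have M: "M > 0" unfolding M_def using c1(1) by (intro mult_pos_pos add_pos_nonneg) auto
    \<comment> \<open>This bound on y ensures u \<le> 1, since u is at most (K' + K) y.\<close>
    have "1 / (K' + K) > 0" using K(1) K' by simp
    hence "\<exists>e>0. \<forall>z\<in>{1, \<epsilon>, 1 / (K' + K)}. e \<le> z"
      using K(2) by (intro finite_pos_lower_bound) auto
    then obtain \<epsilon>' where "\<epsilon>' > 0" "\<forall>z\<in>{1, \<epsilon>, 1 / (K' + K)}. \<epsilon>' \<le> z" by (elim exE conjE)
    hence \<epsilon>': "\<epsilon>' > 0" "\<epsilon>' \<le> 1" "\<epsilon>' \<le> \<epsilon>" "\<epsilon>' \<le> 1 / (K' + K)"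
      by simp_all
    have "\<forall>\<^sub>F y in at_right 0. \<forall>x. \<bar>x\<bar> \<le> K' * y \<longrightarrow>
      1 / M * ?D x y powr l \<le> \<bar>x - real_arc \<beta> y\<bar> + \<bar>x - real_arc \<delta> y\<bar>"
      using C3(2) c1(2) C2(2) eventually_at_right_real[OF \<epsilon>'(1)]
    proof eventually_elim
      case (elim y)
      hence y: "0 < y" "y < \<epsilon>'" by auto
      show ?case
      proof (intro allI impI)
        fix x assume x: "\<bar>x\<bar> \<le> K' * y"
        define u v where "u = \<bar>x - real_arc \<beta> y\<bar>" and "v = \<bar>x - real_arc \<delta> y\<bar>"
        have uv: "u \<ge> 0" "v \<ge> 0" by (simp_all add: u_def v_def)
        have "\<bar>real_arc \<beta> y\<bar> \<le> K * y" using K(3) y \<epsilon>' by simp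
        hence "u \<le> (K' + K) * y" using x by (simp add: u_def algebra_simps)
        also have "(K' + K) * y \<le> (K' + K) * (1 / (K' + K))"
          using y \<epsilon>'(4) K(1) K' by (intro mult_left_mono) auto
        also have "\<dots> = 1" using K(1) K' by simp
        finally have u1: "u \<le> 1" .
        have pw: "y powr of_rat \<rho> \<le> y powr \<sigma>" "y powr (\<sigma> * l) \<le> y powr of_rat \<rho>"
          using y \<epsilon>'(2) \<sigma>\<rho> \<rho>l by (auto intro!: powr_mono')
        have "?D x y \<le> ?D (real_arc \<gamma> y) y + \<bar>x - real_arc \<gamma> y\<bar>"
            by (rule branch_dist_Lipschitz[OF finH])
        also have "\<dots> \<le> C3 * y powr \<sigma> + (u + C2 * y powr of_rat \<rho>)"
          using elim(1,3) by (intro add_mono) (auto simp: u_def)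
        also have "\<dots> \<le> C3 * y powr \<sigma> + (u + C2 * y powr \<sigma>)"
          using pw(1) C2(1) by (intro add_left_mono mult_left_mono) auto
        finally have D: "?D x y \<le> u + C4 * y powr \<sigma>" by (simp add: C4_def algebra_simps)
        have D0: "?D x y \<ge> 0" using branch_dist_nonneg[OF finH] y by simp
        have "?D x y powr l \<le> (u + C4 * y powr \<sigma>) powr l" using D D0 l(1) by (intro powr_mono2) auto
        also have "\<dots> \<le> 2 powr l * (u powr l + (C4 * y powr \<sigma>) powr l)"
          using uv C4 l(1) by (intro powr_add_le) auto
        also have "\<dots> \<le> 2 powr l * ((u + v) + C4 powr l / c1 * (u + v))"
        proof (intro mult_left_mono add_mono)
          show "u powr l \<le> u + v" using powr_le_self[OF uv(1) u1 l(1)] uv by simp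
          have "(C4 * y powr \<sigma>) powr l = C4 powr l * y powr (\<sigma> * l)"
            using C4 by (simp add: powr_mult powr_powr)
          also have "\<dots> \<le> C4 powr l * y powr of_rat \<rho>" using pw(2) by (intro mult_left_mono) auto
          also have "y powr of_rat \<rho> \<le> (u + v) / c1"
          proof -
            have "c1 * y powr of_rat \<rho> \<le> \<bar>real_arc \<beta> y - real_arc \<delta> y\<bar>" using elim(2) by simp
            also have "\<dots> \<le> u + v" unfolding u_def v_def by linarith
            finally show ?thesis using c1(1) by (simp add: field_simps)
          qed
          finally show "(C4 * y powr \<sigma>) powr l \<le> C4 powr l / c1 * (u + v)"
            by (simp add: mult_left_mono)
        qed auto
        also have "\<dots> = M * (u + v)" by (simp add: M_def algebra_simps)
        finally have "?D x y powr l \<le> M * (u + v)" .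
        hence "1 / M * ?D x y powr l \<le> u + v" using M by (simp add: divide_le_eq mult.commute)
        thus "1 / M * ?D x y powr l \<le> \<bar>x - real_arc \<beta> y\<bar> + \<bar>x - real_arc \<delta> y\<bar>"
            by (simp only: u_def v_def)
      qed
    qed
    moreover have "1 / M > 0" using M by simp
    ultimately show ?thesis by (intro exI[of _ "1 / M"] conjI)
  qed
qed

text \<open>Finitely many pairs of roots allow a common constant. At each point the pair of closest
  branches is used, and the passage between branch distances and Euclidean distances is made inside
  the cone |x| \<le> K' y.\<close>

lemma separation_upper:
  assumes l: "l \<ge> 1" "exponent_plus F G \<le> ereal l" and K': "K' \<ge> 0"
  obtains C r where "C > 0" "r > 0" "\<And>x y. 0 < y \<Longrightarrow> y < r \<Longrightarrow> \<bar>x\<bar> \<le> K' * y \<Longrightarrow>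
    C * infdist (x, y) (A \<inter> B) powr l \<le> infdist (x, y) A + infdist (x, y) B"
proof -
  let ?IF = "real_np_roots F" and ?IG = "real_np_roots G"
  let ?D = "root_dist (gcd2 F G)"
  note fin = finite_real_roots
  have "\<forall>z\<in>?IF \<times> ?IG. \<exists>C. C > 0 \<and> (\<forall>\<^sub>F y in at_right 0. \<forall>x. \<bar>x\<bar> \<le> K' * y \<longrightarrow>
    C * ?D x y powr l \<le> \<bar>x - real_arc (fst z) y\<bar> + \<bar>x - real_arc (snd z) y\<bar>)"
  proof
    fix z assume "z \<in> ?IF \<times> ?IG"
    hence "fst z \<in> ?IF" "snd z \<in> ?IG" by auto
    from branch_pair_le[OF l K' this] show "\<exists>C. C > 0 \<and> (\<forall>\<^sub>F y in at_right 0. \<forall>x. \<bar>x\<bar> \<le> K' * y \<longrightarrow>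
      C * ?D x y powr l \<le> \<bar>x - real_arc (fst z) y\<bar> + \<bar>x - real_arc (snd z) y\<bar>)" .
  qed
  from bchoice[OF this] obtain C where C: "\<forall>z\<in>?IF \<times> ?IG. C z > 0 \<and> (\<forall>\<^sub>F y in at_right 0. \<forall>x. \<bar>x\<bar> \<le>
      K' * y \<longrightarrow>
    C z * ?D x y powr l \<le> \<bar>x - real_arc (fst z) y\<bar> + \<bar>x - real_arc (snd z) y\<bar>)" ..
  have finP: "finite (?IF \<times> ?IG)" using fin by simp
  have "\<forall>\<^sub>F y in at_right 0. \<forall>z\<in>?IF \<times> ?IG. \<forall>x. \<bar>x\<bar> \<le> K' * y \<longrightarrow>
    C z * ?D x y powr l \<le> \<bar>x - real_arc (fst z) y\<bar> + \<bar>x - real_arc (snd z) y\<bar>"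
    using C by (intro eventually_ball_finite finP) simp
  then obtain e where e: "e > 0" "\<And>y. 0 < y \<Longrightarrow> y < e \<Longrightarrow> \<forall>z\<in>?IF \<times> ?IG. \<forall>x. \<bar>x\<bar> \<le> K' * y \<longrightarrow>
    C z * ?D x y powr l \<le> \<bar>x - real_arc (fst z) y\<bar> + \<bar>x - real_arc (snd z) y\<bar>"
    unfolding eventually_at_right_field by auto
  define C0 where "C0 = Min (insert 1 (C ` (?IF \<times> ?IG)))"
  have "C0 \<in> insert 1 (C ` (?IF \<times> ?IG))" unfolding C0_def using finP by (intro Min_in) auto
  hence C0: "C0 > 0" using C by auto
  have C0_le: "C0 \<le> z" if "z \<in> insert 1 (C ` (?IF \<times> ?IG))" for z
    unfolding C0_def using finP that by (intro Min_le) auto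
  have key: "C0 * ?D x y powr l \<le> root_dist F x y + root_dist G x y"
    if y: "0 < y" "y < e" "y \<le> 1" and x: "\<bar>x\<bar> \<le> K' * y" for x y
  proof -
    have D: "0 \<le> ?D x y" "?D x y \<le> y"
        using y branch_dist_nonneg[OF fin(3)] branch_dist_le(1)[OF fin(3)] by auto
    have "C0 * ?D x y powr l \<le> 1 * ?D x y powr l" using C0_le[of 1] by (intro mult_right_mono) auto
    also have "\<dots> \<le> ?D x y" using D y l(1) powr_le_self[of "?D x y" l] by simp
    also have "\<dots> \<le> y" by (rule D(2))
    \<comment> \<open>This settles the case that one of the two branch distances is y itself, when
      no pair of branches is available.\<close>
    finally have yy: "C0 * ?D x y powr l \<le> y" .
    have nn: "0 \<le> root_dist F x y" "0 \<le> root_dist G x y"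
      using y branch_dist_nonneg[OF fin(1)] branch_dist_nonneg[OF fin(2)] by auto
    show ?thesis
    proof (rule branch_dist_cases[OF fin(1), of real_arc x y])
      assume "root_dist F x y = y"
      thus ?thesis using yy nn by simp
    next
      fix \<beta> assume \<beta>: "\<beta> \<in> ?IF" "root_dist F x y = \<bar>x - real_arc \<beta> y\<bar>"
      show ?thesis
      proof (rule branch_dist_cases[OF fin(2), of real_arc x y])
        assume "root_dist G x y = y"
        thus ?thesis using yy nn by simp
      next
        fix \<delta> assume \<delta>: "\<delta> \<in> ?IG" "root_dist G x y = \<bar>x - real_arc \<delta> y\<bar>"
        have "C0 * ?D x y powr l \<le> C (\<beta>, \<delta>) * ?D x y powr l"
          using \<beta>(1) \<delta>(1) by (intro mult_right_mono C0_le) auto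
        also have "\<dots> \<le> \<bar>x - real_arc \<beta> y\<bar> + \<bar>x - real_arc \<delta> y\<bar>"
          using bspec[OF e(2)[OF y(1,2)], of "(\<beta>, \<delta>)"] \<beta>(1) \<delta>(1) x by simp
        finally show ?thesis unfolding \<beta>(2) \<delta>(2) .
      qed
    qed
  qed
  obtain cA rA where cA: "cA > 0" "rA > 0" "\<And>x y. 0 < y \<Longrightarrow> norm (x, y) < rA \<Longrightarrow>
      cA * root_dist F x y \<le> infdist (x, y) A"
    by (rule infdist_ge_branch_dist[OF branches_A]) blast
  obtain cB rB where cB: "cB > 0" "rB > 0" "\<And>x y. 0 < y \<Longrightarrow> norm (x, y) < rB \<Longrightarrow>
      cB * root_dist G x y \<le> infdist (x, y) B"
    by (rule infdist_ge_branch_dist[OF branches_B]) blast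
  obtain rH where rH: "rH > 0" "\<And>x y. 0 < y \<Longrightarrow> y < rH \<Longrightarrow> \<bar>x\<bar> \<le> K' * y \<Longrightarrow>
      infdist (x, y) (A \<inter> B) \<le> (1 + K') * ?D x y"
    by (rule infdist_le_branch_dist[OF branches_AB K']) blast
  define c where "c = min cA cB"
  have c: "c > 0" "c \<le> cA" "c \<le> cB" using cA(1) cB(1) by (simp_all add: c_def)
  define M where "M = (1 + K') powr l"
  have M: "M > 0" using K' by (simp add: M_def)
  have "rA / (1 + K') > 0" "rB / (1 + K') > 0" using cA(2) cB(2) K' by simp_all
  hence "\<exists>d>0. \<forall>z\<in>{1, e, rH, rA / (1 + K'), rB / (1 + K')}. d \<le> z"
    using e(1) rH(1) by (intro finite_pos_lower_bound) auto
  then obtain r where "r > 0" "\<forall>z\<in>{1, e, rH, rA / (1 + K'), rB / (1 + K')}. r \<le> z"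
      by (elim exE conjE)
  hence r: "r > 0" "r \<le> 1" "r \<le> e" "r \<le> rH" "r \<le> rA / (1 + K')" "r \<le> rB / (1 + K')"
    by simp_all
  show ?thesis
  proof (rule that[of "c * C0 / M" r])
    show "c * C0 / M > 0" using c(1) C0 M by simp
    show "r > 0" by (rule r)
    fix x y assume y: "0 < y" "y < r" and x: "\<bar>x\<bar> \<le> K' * y"
    have "norm (x, y) \<le> (1 + K') * y"
      using norm_Pair_le_abs[of x y] x y by (simp add: algebra_simps)
    also have "(1 + K') * y < (1 + K') * r" using y K' by (intro mult_strict_left_mono) auto
    finally have nrm: "norm (x, y) < (1 + K') * r" .
    have "(1 + K') * r \<le> rA" "(1 + K') * r \<le> rB" using r(5,6) K' by (simp_all add: field_simps)
    hence n: "norm (x, y) < rA" "norm (x, y) < rB" using nrm by simp_all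
    have D: "0 \<le> ?D x y" using y branch_dist_nonneg[OF fin(3)] by simp
    have nn: "0 \<le> root_dist F x y" "0 \<le> root_dist G x y"
      using y branch_dist_nonneg[OF fin(1)] branch_dist_nonneg[OF fin(2)] by auto
    have "infdist (x, y) (A \<inter> B) powr l \<le> ((1 + K') * ?D x y) powr l"
      using rH(2)[of y x] y x r l(1) infdist_nonneg by (intro powr_mono2) auto
    also have "\<dots> = M * ?D x y powr l" using K' D by (simp add: powr_mult M_def)
    finally have "c * C0 / M * infdist (x, y) (A \<inter> B) powr l \<le> c * C0 / M * (M * ?D x y powr l)"
      using c(1) C0 M by (intro mult_left_mono) auto
    also have "\<dots> = c * (C0 * ?D x y powr l)" using M by simp
    also have "\<dots> \<le> c * (root_dist F x y + root_dist G x y)"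
      using key[of y x] y x r c(1) by (intro mult_left_mono) auto
    also have "\<dots> \<le> cA * root_dist F x y + cB * root_dist G x y"
      unfolding distrib_left using c nn by (intro add_mono mult_right_mono) auto
    also have "\<dots> \<le> infdist (x, y) A + infdist (x, y) B"
      using cA(3)[OF y(1) n(1)] cB(3)[OF y(1) n(2)] by (rule add_mono)
    finally show "c * C0 / M * infdist (x, y) (A \<inter> B) powr l \<le>
        infdist (x, y) A + infdist (x, y) B" .
  qed
qed

end

section \<open>Reflection in the \<open>x\<close>-axis\<close>

lemma coeff2_reflect_y: "coeff2 (reflect_y F) i j = coeff2 F i j * (- 1) ^ j"
  by (simp add: coeff2_def reflect_y.rep_eq)

lemma eval2_reflect_y: "eval2 (reflect_y F) x y = eval2 F x (- y)"
proof -
  have "term2 (reflect_y F) x y = term2 F x (- y)"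
  proof
    fix p :: "nat \<times> nat"
    obtain i j where p: "p = (i, j)" by (cases p)
    have "(- y) ^ j = (- 1) ^ j * y ^ j" by (rule power_minus)
    thus "term2 (reflect_y F) x y p = term2 F x (- y) p"
      by (simp add: p term2_def coeff2_reflect_y)
  qed
  thus ?thesis by (simp add: eval2_eq)
qed

lemma hom_component_reflect_y: "hom_component (reflect_y F) k x y = hom_component F k x (- y)"
  unfolding hom_component_def
proof (intro sum.cong refl)
  fix i
  have "(- y) ^ (k - i) = (- 1) ^ (k - i) * y ^ (k - i)" by (rule power_minus)
  thus "coeff2 (reflect_y F) i (k - i) * x ^ i * y ^ (k - i) =
      coeff2 F i (k - i) * x ^ i * (- y) ^ (k - i)"
    by (simp add: coeff2_reflect_y)
qed

lemma mini_regular_reflect_y: "mini_regular F m \<Longrightarrow> mini_regular (reflect_y F) m"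
  by (simp add: mini_regular_def hom_component_reflect_y)

definition reflect_set :: "(real \<times> real) set \<Rightarrow> (real \<times> real) set" where
  "reflect_set A = {(x, y). (x, - y) \<in> A}"

lemma reflect_set_Int: "reflect_set (A \<inter> B) = reflect_set A \<inter> reflect_set B"
  by (auto simp: reflect_set_def)

lemma norm_reflect: "norm (x, - y) = norm (x::real, y::real)"
  by (simp add: norm_Pair)

lemma infdist_reflect_set: "infdist (x, y) (reflect_set A) = infdist (x, - y) A"
proof (cases "A = {}")
  case True
  thus ?thesis by (simp add: reflect_set_def infdist_def)
next
  case False
  have img: "reflect_set A = (\<lambda>(u, v). (u, - v)) ` A"
  proof
    show "reflect_set A \<subseteq> (\<lambda>(u, v). (u, - v)) ` A"
    proof
      fix q assume "q \<in> reflect_set A"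
      hence "(fst q, - snd q) \<in> A" by (simp add: reflect_set_def case_prod_unfold)
      thus "q \<in> (\<lambda>(u, v). (u, - v)) ` A" by (rule rev_image_eqI) simp
    qed
  qed (auto simp: reflect_set_def)
  have "dist (x, y) ((\<lambda>(u, v). (u, - v)) q) = dist (x, - y) q" for q :: "real \<times> real"
  proof -
    obtain u v where q: "q = (u, v)" by (cases q)
    have "- (- y - v) = y + v" by simp
    hence "norm (x - u, y + v) = norm (x - u, - y - v)"
      using norm_reflect[of "x - u" "- y - v"] by (simp only:)
    thus ?thesis by (simp add: q dist_norm)
  qed
  moreover have "(\<lambda>(u, v). (u, - v)) ` A \<noteq> {}" using False by simp
  ultimately show ?thesis unfolding img using False by (simp add: infdist_notempty image_comp o_def)
qed

lemma zero_germ_reflect: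
  assumes "zero_germ A F"
  shows "zero_germ (reflect_set A) (reflect_y F)"
proof -
  obtain r where r: "r > 0" "\<And>x y. \<bar>x\<bar> < r \<Longrightarrow> \<bar>y\<bar> < r \<Longrightarrow> (x, y) \<in> A \<longleftrightarrow> eval2 F x y = 0"
    using assms unfolding zero_germ_def by auto
  show ?thesis unfolding zero_germ_def
  proof (intro exI[of _ r] conjI r(1) allI impI)
    fix x y :: real assume "\<bar>x\<bar> < r" "\<bar>y\<bar> < r"
    thus "(x, y) \<in> reflect_set A \<longleftrightarrow> eval2 (reflect_y F) x y = 0"
      using r(2)[of x "- y"] by (simp add: reflect_set_def eval2_reflect_y)
  qed
qed

lemma germ_pair_reflect:
  assumes "germ_pair A B F G m n"
  shows "germ_pair (reflect_set A) (reflect_set B) (reflect_y F) (reflect_y G) m n"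
proof -
  interpret germ_pair A B F G m n by (rule assms)
  show ?thesis
  proof
    show "(0, 0) \<in> reflect_set A" "(0, 0) \<in> reflect_set B" using A(1) B(1)
        by (simp_all add: reflect_set_def)
  qed (intro zero_germ_reflect mini_regular_reflect_y A B)+
qed

text \<open>The two exponents govern the upper and the lower half-plane separately, and the region
  outside a cone around the y-axis imposes no condition beyond b \<ge> 1. The constants of the three
  regions are merged by taking minima.\<close>

lemma germ_pair_separation_iff:
  assumes "germ_pair A B F G m n"
  shows "(b \<ge> 1 \<and> (\<exists>C>0. \<exists>r>0. \<forall>p. norm p \<le> r \<longrightarrow>
        infdist p A + infdist p B \<ge> C * infdist p (A \<inter> B) powr b)) \<longleftrightarrow>
     max (exponent_plus F G) (exponent_minus F G) \<le> ereal b"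
proof -
  interpret P: germ_pair A B F G m n by (rule assms)
  interpret N: germ_pair "reflect_set A" "reflect_set B" "reflect_y F" "reflect_y G" m n
    by (rule germ_pair_reflect[OF assms])
  have N_dist: "infdist (x, y) (reflect_set A \<inter> reflect_set B) = infdist (x, - y) (A \<inter> B)" for x y
    unfolding reflect_set_Int[symmetric] by (rule infdist_reflect_set)
  show ?thesis
  proof
    assume "b \<ge> 1 \<and> (\<exists>C>0. \<exists>r>0. \<forall>p. norm p \<le> r \<longrightarrow>
        infdist p A + infdist p B \<ge> C * infdist p (A \<inter> B) powr b)"
    then obtain C r where b: "b \<ge> 1" and C: "C > 0" and r: "r > 0" and
      ineq: "\<forall>p. norm p \<le> r \<longrightarrow> infdist p A + infdist p B \<ge> C * infdist p (A \<inter> B) powr b"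
      by (elim conjE exE)
    have "exponent_plus F G \<le> ereal b"
      by (rule P.exponent_plus_le[OF b C r]) (use ineq in blast)
    moreover have "exponent_plus (reflect_y F) (reflect_y G) \<le> ereal b"
    proof (rule N.exponent_plus_le[OF b C r])
      fix x y :: real assume "norm (x, y) \<le> r"
      hence "norm (x, - y) \<le> r" by (simp add: norm_reflect)
      with ineq have "C * infdist (x, - y) (A \<inter> B) powr b \<le> infdist (x, - y) A + infdist (x, - y) B"
          by blast
      thus "C * infdist (x, y) (reflect_set A \<inter> reflect_set B) powr b \<le>
          infdist (x, y) (reflect_set A) + infdist (x, y) (reflect_set B)"
        unfolding N_dist infdist_reflect_set .
    qed
    ultimately show "max (exponent_plus F G) (exponent_minus F G) \<le> ereal b"
      by (simp add: exponent_minus_def)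
  next
    assume M: "max (exponent_plus F G) (exponent_minus F G) \<le> ereal b"
    hence Mp: "exponent_plus F G \<le> ereal b"
        and Mn: "exponent_plus (reflect_y F) (reflect_y G) \<le> ereal b"
      by (simp_all add: exponent_minus_def)
    have "1 \<le> ereal b" using P.exponent_plus_ge_1 Mp by (rule order_trans)
    hence b: "b \<ge> 1" by (simp add: one_ereal_def)
    obtain r0 where r0: "r0 > 0" "\<And>x y. \<bar>x\<bar> < r0 \<Longrightarrow> \<bar>y\<bar> < r0 \<Longrightarrow> (x, y) \<in> A \<longleftrightarrow> eval2 F x y = 0"
      using P.A(2) unfolding zero_germ_def by auto
    obtain K \<epsilon> where K: "K > 0" "\<epsilon> > 0"
      "\<And>x y :: real. \<bar>x\<bar> < \<epsilon> \<Longrightarrow> \<bar>y\<bar> < \<epsilon> \<Longrightarrow> eval2 F x y = 0 \<Longrightarrow> \<bar>x\<bar> \<le> K * \<bar>y\<bar>"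
      by (rule mini_regular_cone[OF P.A(3)]) blast
    have pos: "min r0 \<epsilon> > 0" using r0(1) K(2) by simp
    have cone: "\<bar>x\<bar> \<le> K * \<bar>y\<bar>" if "(x, y) \<in> A" "\<bar>x\<bar> < min r0 \<epsilon>" "\<bar>y\<bar> < min r0 \<epsilon>" for x y
      using that r0(2)[of x y] K(3)[of x y] by simp
    obtain c rc where c: "c > 0" "rc > 0" "\<And>x y. norm (x, y) < rc \<Longrightarrow> 2 * K * \<bar>y\<bar> \<le> \<bar>x\<bar> \<Longrightarrow>
        c * norm (x, y) \<le> infdist (x, y) A"
    proof (rule infdist_outside_cone[OF P.A(1) K(1) pos cone])
      fix c' r' :: real
      assume *: "c' > 0" "r' > 0" "\<And>x y. norm (x, y) < r' \<Longrightarrow> 2 * K * \<bar>y\<bar> \<le> \<bar>x\<bar> \<Longrightarrow> c' * norm (x, y) \<le>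
          infdist (x, y) A"
      show thesis by (rule that[OF *])
    qed
    have K2: "2 * K \<ge> 0" using K(1) by simp
    obtain C1 r1 where C1: "C1 > 0" "r1 > 0" "\<And>x y. 0 < y \<Longrightarrow> y < r1 \<Longrightarrow> \<bar>x\<bar> \<le> 2 * K * y \<Longrightarrow>
      C1 * infdist (x, y) (A \<inter> B) powr b \<le> infdist (x, y) A + infdist (x, y) B"
      by (rule P.separation_upper[OF b Mp K2]) blast
    obtain C2 r2 where C2: "C2 > 0" "r2 > 0" "\<And>x y. 0 < y \<Longrightarrow> y < r2 \<Longrightarrow> \<bar>x\<bar> \<le> 2 * K * y \<Longrightarrow>
      C2 * infdist (x, y) (reflect_set A \<inter> reflect_set B) powr b \<le>
          infdist (x, y) (reflect_set A) + infdist (x, y) (reflect_set B)"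
      by (rule N.separation_upper[OF b Mn K2]) blast
    have "\<exists>r>0. \<forall>z\<in>{1, rc, r1, r2}. r \<le> z" using c(2) C1(2) C2(2)
        by (intro finite_pos_lower_bound) auto
    then obtain r where r: "r > 0" "\<forall>z\<in>{1, rc, r1, r2}. r \<le> z" by (elim exE conjE)
    have "\<exists>C>0. \<forall>z\<in>{c, C1, C2}. C \<le> z" using c(1) C1(1) C2(1) by (intro finite_pos_lower_bound) auto
    then obtain C where C: "C > 0" "\<forall>z\<in>{c, C1, C2}. C \<le> z" by (elim exE conjE)
    have "C * infdist p (A \<inter> B) powr b \<le> infdist p A + infdist p B" if p: "norm p \<le> r / 2" for p
    proof -
      obtain x y where xy: "p = (x, y)" by (cases p)
      have n: "norm (x, y) < r" using p r(1) by (simp add: xy)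
      have y: "\<bar>y\<bar> < r" using abs_le_norm_Pair(2)[of y x] n by simp
      define t where "t = infdist (x, y) (A \<inter> B) powr b"
      have t: "t \<ge> 0" by (simp add: t_def)
      consider "2 * K * \<bar>y\<bar> \<le> \<bar>x\<bar>" | "\<bar>x\<bar> < 2 * K * \<bar>y\<bar>" "0 < y" | "\<bar>x\<bar> < 2 * K * \<bar>y\<bar>"
          "y < 0" | "\<bar>x\<bar> < 2 * K * \<bar>y\<bar>" "y = 0"
        by linarith
      hence "C * t \<le> infdist (x, y) A + infdist (x, y) B"
      proof cases
        \<comment> \<open>Outside the cone the distance to A alone is comparable with the norm,
          while the distance to the common zeros is at most the norm because the origin is one of
          them.\<close>
        case 1
        have "infdist (x, y) (A \<inter> B) \<le> norm (x, y)"
          using infdist_le[of "(0, 0)" "A \<inter> B" "(x, y)"] P.A(1) P.B(1) by (simp add: dist_norm)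
        hence "t \<le> norm (x, y) powr b" unfolding t_def using b infdist_nonneg
            by (intro powr_mono2) auto
        also have "\<dots> \<le> norm (x, y)" using n r(2) b by (intro powr_le_self) auto
        finally have "C * t \<le> c * norm (x, y)" using C t by (intro mult_mono) auto
        also have "\<dots> \<le> infdist (x, y) A" using n r(2) 1 by (intro c(3)) auto
        also have "\<dots> \<le> infdist (x, y) A + infdist (x, y) B" using infdist_nonneg[of "(x, y)" B]
            by linarith
        finally show ?thesis .
      next
        case 2
        have "C * t \<le> C1 * t" using C t by (intro mult_right_mono) auto
        also have "\<dots> \<le> infdist (x, y) A + infdist (x, y) B"
          unfolding t_def using 2 y r(2) by (intro C1(3)) auto
        finally show ?thesis .
      next
        case 3
        have "C * t \<le> C2 * t" using C t by (intro mult_right_mono) auto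
        also have "\<dots> \<le> infdist (x, y) A + infdist (x, y) B"
          using C2(3)[of "- y" x] 3 y r(2) by (simp add: N_dist infdist_reflect_set t_def)
        finally show ?thesis .
      next
        \<comment> \<open>For y = 0 the inequality reads |x| < 0, which is impossible.\<close>
        case 4
        thus ?thesis by simp
      qed
      thus ?thesis by (simp add: xy t_def)
    qed
    moreover have "r / 2 > 0" using r(1) by simp
    ultimately have q: "\<exists>r>0. \<forall>p. norm p \<le> r \<longrightarrow> infdist p A + infdist p B \<ge> C * infdist p (A \<inter> B)
        powr b"
      by (intro exI[of _ "r / 2"] conjI allI impI)
    show "b \<ge> 1 \<and> (\<exists>C>0. \<exists>r>0. \<forall>p. norm p \<le> r \<longrightarrow>
        infdist p A + infdist p B \<ge> C * infdist p (A \<inter> B) powr b)"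
      by (rule conjI[OF b], rule exI[of _ C], rule conjI[OF C(1) q])
  qed
qed

section \<open>From germs of functions to the separation exponent\<close>

lemma zero_germ_of_has_germ:
  assumes "has_germ f F"
  shows "zero_germ {p. f p = 0} F"
proof -
  have "\<forall>\<^sub>F (x, y) in nhds (0::real, 0::real). f (x, y) = eval2 F x y" using assms
      by (simp add: has_germ_def)
  then obtain r where "r > 0" "\<And>x y. \<bar>x\<bar> < r \<Longrightarrow> \<bar>y\<bar> < r \<Longrightarrow> f (x, y) = eval2 F x y"
    unfolding eventually_nhds_00_iff real_norm_def by auto
  thus ?thesis unfolding zero_germ_def by (intro exI[of _ r]) auto
qed

lemma has_germ_imp_pos_order:
  assumes "has_germ f F" "f (0, 0) = 0" "mini_regular F m"
  shows "m > 0"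
proof (rule ccontr)
  assume "\<not> m > 0"
  hence "coeff2 F 0 0 \<noteq> 0" using mini_regular_coeff_m0[OF assms(3)] by simp
  moreover have "f (0, 0) = eval2 F 0 (0::real)"
    using eventually_nhds_x_imp_x[of "\<lambda>(x, y). f (x, y) = eval2 F x y" "(0, 0)"] assms(1)
    by (simp add: has_germ_def)
  ultimately show False using assms(2) by (simp add: eval2_0_0)
qed

theorem theorem3p1:
  fixes f g :: "real \<times> real \<Rightarrow> real" and F G :: cps2 and m :: nat
  assumes "has_germ f F" and "has_germ g G"
    and "f (0, 0) = 0" and "g (0, 0) = 0"
    and "F \<noteq> 0" and "G \<noteq> 0"
    and "squarefree F" and "squarefree G"
    and "mini_regular F m" and "mini_regular G m"
  shows "separation_exponent {p. f p = 0} {p. g p = 0} =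
    max (exponent_plus F G) (exponent_minus F G)"
proof -
  let ?A = "{p. f p = 0}" and ?B = "{p. g p = 0}"
  let ?M = "max (exponent_plus F G) (exponent_minus F G)"
  have m: "m > 0" using assms by (intro has_germ_imp_pos_order)
  have gp: "germ_pair ?A ?B F G m m"
    by standard (use assms m zero_germ_of_has_germ in auto)
  have M1: "1 \<le> ?M" using germ_pair.exponent_plus_ge_1[OF gp] by (simp add: le_max_iff_disj)
  \<comment> \<open>The admissible exponents are exactly the real numbers at or above the maximum,
    so a finite maximum is attained.\<close>
  have "separation_exponent ?A ?B = Inf {ereal \<beta> | \<beta>. ?M \<le> ereal \<beta>}"
    unfolding separation_exponent_def germ_pair_separation_iff[OF gp] ..
  also have "\<dots> = ?M"
  proof (rule antisym)
    show "?M \<le> Inf {ereal \<beta> | \<beta>. ?M \<le> ereal \<beta>}" by (rule Inf_greatest) auto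
    show "Inf {ereal \<beta> | \<beta>. ?M \<le> ereal \<beta>} \<le> ?M"
    \<comment> \<open>The infimum runs over real exponents. The value plus infinity is harmless for
      this inequality, and minus infinity is excluded by the lower bound 1.\<close>
    proof (cases "?M")
      case (real \<mu>)
      have "?M \<in> {ereal \<beta> | \<beta>. ?M \<le> ereal \<beta>}" using real by (intro CollectI exI[of _ \<mu>]) simp
      thus ?thesis by (rule Inf_lower)
    next
      case PInf
      thus ?thesis by simp
    next
      case MInf
      thus ?thesis using M1 by simp
    qed
  qed
  finally show ?thesis .
qed

end
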